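(* Let $G$ be a non-elementary torsion-free hyperbolic group. Then for every countable domain $R$, the group ring $RG$ of $G$ over $R$ is primitive. In particular, for every field $K$ (of any cardinality), the group ring $KG$ is primitive.
   Context: Rings are associative with identity. A domain is a nonzero ring in which the product of any two nonzero elements is nonzero. Countable means finite or countably infinite. A ring $S$ is (right) primitive if there exists a faithful irreducible (i.e. simple) right $S$-module. Hyperbolic groups: let $G$ be a group with finite generating set $X$. The Cayley graph $\Gamma_X(G)$ has vertex set $G$ and an $x$-labelled edge directed from $g$ to $gx$ for all $g\in G$, $x\in X$; giving each edge length one makes it a geodesic metric space. For a real constant $\delta>0$, $\Gamma_X(G)$ satisfies the $\delta$-thin triangles condition if every side of every geodesic triangle is contained in the $\delta$-neighborhood of the union of the other two sides. $G$ is hyperbolic if it admits a finite generating set $X$ and a real $\delta>0$ such that $\Gamma_X(G)$ satisfies the $\delta$-thin triangles condition. A hyperbolic group is elementary if it is finite or virtually infinite cyclic (has an infinite cyclic subgroup of finite index), and non-elementary otherwise. *)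

theory Defs
  imports
    Complex_Main
    "HOL-Library.Countable_Set"
    "HOL-Algebra.Elementary_Groups"
    "HOL-Algebra.Module"
begin

section \<open>Noncommutative domains\<close>

text \<open>
  The locale \<^locale>\<open>domain\<close> of the library is commutative; here commutativity is not required.
\<close>

definition nc_domain :: "('r, 'n) ring_scheme \<Rightarrow> bool" where
  "nc_domain R \<longleftrightarrow> ring R \<and> \<one>\<^bsub>R\<^esub> \<noteq> \<zero>\<^bsub>R\<^esub> \<and>
     (\<forall>a \<in> carrier R - {\<zero>\<^bsub>R\<^esub>}. \<forall>b \<in> carrier R - {\<zero>\<^bsub>R\<^esub>}. a \<otimes>\<^bsub>R\<^esub> b \<noteq> \<zero>\<^bsub>R\<^esub>)"


section \<open>Right modules and right primitive rings\<close>

text \<open>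
  The library's \<^locale>\<open>module\<close> needs a commutative ring of scalars. We reuse its record, but read
  the term \<open>s \<odot>\<^bsub>M\<^esub> x\<close> as the right action \<open>x \<cdot> s\<close>; hence the order of the factors in
  \<open>smult_assoc\<close>. The fields \<open>mult\<close> and \<open>one\<close> of \<open>M\<close> play no role.
\<close>

locale right_module = S?: ring S + M?: abelian_group M for S (structure) and M (structure) +
  assumes smult_closed:
      "\<lbrakk>s \<in> carrier S; x \<in> carrier M\<rbrakk> \<Longrightarrow> s \<odot>\<^bsub>M\<^esub> x \<in> carrier M"
    and smult_scalar_distr:
      "\<lbrakk>s \<in> carrier S; t \<in> carrier S; x \<in> carrier M\<rbrakk> \<Longrightarrow>
        (s \<oplus>\<^bsub>S\<^esub> t) \<odot>\<^bsub>M\<^esub> x = s \<odot>\<^bsub>M\<^esub> x \<oplus>\<^bsub>M\<^esub> t \<odot>\<^bsub>M\<^esub> x"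
    and smult_vector_distr:
      "\<lbrakk>s \<in> carrier S; x \<in> carrier M; y \<in> carrier M\<rbrakk> \<Longrightarrow>
        s \<odot>\<^bsub>M\<^esub> (x \<oplus>\<^bsub>M\<^esub> y) = s \<odot>\<^bsub>M\<^esub> x \<oplus>\<^bsub>M\<^esub> s \<odot>\<^bsub>M\<^esub> y"
    and smult_assoc:
      "\<lbrakk>s \<in> carrier S; t \<in> carrier S; x \<in> carrier M\<rbrakk> \<Longrightarrow>
        (s \<otimes>\<^bsub>S\<^esub> t) \<odot>\<^bsub>M\<^esub> x = t \<odot>\<^bsub>M\<^esub> (s \<odot>\<^bsub>M\<^esub> x)"
    and smult_one:
      "x \<in> carrier M \<Longrightarrow> \<one>\<^bsub>S\<^esub> \<odot>\<^bsub>M\<^esub> x = x"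

definition right_submodule :: "('s, 'n) ring_scheme \<Rightarrow> ('s, 'b, 'k) module_scheme \<Rightarrow> 'b set \<Rightarrow> bool" where
  "right_submodule S M N \<longleftrightarrow>
     N \<subseteq> carrier M \<and> \<zero>\<^bsub>M\<^esub> \<in> N \<and>
     (\<forall>x\<in>N. \<forall>y\<in>N. x \<oplus>\<^bsub>M\<^esub> y \<in> N) \<and>
     (\<forall>x\<in>N. \<ominus>\<^bsub>M\<^esub> x \<in> N) \<and>
     (\<forall>s\<in>carrier S. \<forall>x\<in>N. s \<odot>\<^bsub>M\<^esub> x \<in> N)"

definition simple_right_module :: "('s, 'n) ring_scheme \<Rightarrow> ('s, 'b, 'k) module_scheme \<Rightarrow> bool" where
  "simple_right_module S M \<longleftrightarrow>
     right_module S M \<and> carrier M \<noteq> {\<zero>\<^bsub>M\<^esub>} \<and>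
     (\<forall>N. right_submodule S M N \<longrightarrow> N = {\<zero>\<^bsub>M\<^esub>} \<or> N = carrier M)"

definition faithful_right_module :: "('s, 'n) ring_scheme \<Rightarrow> ('s, 'b, 'k) module_scheme \<Rightarrow> bool" where
  "faithful_right_module S M \<longleftrightarrow>
     right_module S M \<and>
     (\<forall>s\<in>carrier S. (\<forall>x\<in>carrier M. s \<odot>\<^bsub>M\<^esub> x = \<zero>\<^bsub>M\<^esub>) \<longrightarrow> s = \<zero>\<^bsub>S\<^esub>)"

text \<open>
  The module ranges over carriers in the type of sets of ring elements. This is no restriction:
  a simple module is a quotient of \<open>S\<close> by a right ideal, whose elements are cosets. See
  \<open>right_primitiveI\<close> below, where the carrier type of the module is arbitrary.
\<close>

definition right_primitive :: "('s, 'n) ring_scheme \<Rightarrow> bool" where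
  "right_primitive S \<longleftrightarrow>
     (\<exists>M :: ('s, 's set) module. faithful_right_module S M \<and> simple_right_module S M)"

lemma right_primitiveI:
  fixes N :: "('s, 'b, 'k) module_scheme"
  assumes f: "faithful_right_module S N" and s: "simple_right_module S N"
  shows "right_primitive S"
proof -
  interpret right_module S N using f by (simp add: faithful_right_module_def)
  obtain v where v: "v \<in> carrier N" "v \<noteq> \<zero>\<^bsub>N\<^esub>"
    using s by (auto simp: simple_right_module_def)
  have "right_submodule S N ((\<lambda>s. s \<odot>\<^bsub>N\<^esub> v) ` carrier S)"
  proof -
    have z: "\<zero>\<^bsub>S\<^esub> \<odot>\<^bsub>N\<^esub> v = \<zero>\<^bsub>N\<^esub>"
      by (metis M.add.l_cancel_one' S.add.one_closed S.l_zero smult_closed smult_scalar_distr v(1))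
    have m: "\<ominus>\<^bsub>N\<^esub> (s \<odot>\<^bsub>N\<^esub> v) = (\<ominus>\<^bsub>S\<^esub> s) \<odot>\<^bsub>N\<^esub> v" if "s \<in> carrier S" for s
      using that v smult_scalar_distr[of "\<ominus>\<^bsub>S\<^esub> s" s v] z
      by (metis M.minus_equality S.add.inv_closed S.l_neg smult_closed)
    show ?thesis unfolding right_submodule_def
      using v z m
      by (auto simp: smult_closed image_iff smult_scalar_distr[symmetric] smult_assoc[symmetric] intro: S.a_inv_closed)
         (metis S.zero_closed)
  qed
  moreover have "v \<in> (\<lambda>s. s \<odot>\<^bsub>N\<^esub> v) ` carrier S" using smult_one[OF v(1)] by (metis S.one_closed image_eqI)
  ultimately have gen: "(\<lambda>s. s \<odot>\<^bsub>N\<^esub> v) ` carrier S = carrier N"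
    using s v by (auto simp: simple_right_module_def)
  define \<phi> where "\<phi> n = {s \<in> carrier S. s \<odot>\<^bsub>N\<^esub> v = n}" for n
  have "inj_on \<phi> (carrier N)"
  proof (rule inj_onI)
    fix x y assume x: "x \<in> carrier N" and xy: "\<phi> x = \<phi> y"
    obtain t where "t \<in> carrier S" "t \<odot>\<^bsub>N\<^esub> v = x" using x gen by (metis imageE)
    then show "x = y" using xy by (auto simp: \<phi>_def)
  qed
  then obtain \<psi> where \<psi>: "\<And>n. n \<in> carrier N \<Longrightarrow> \<psi> (\<phi> n) = n"
    by (metis the_inv_into_f_f)
  define M :: "('s, 's set) module" where
    "M = \<lparr>carrier = \<phi> ` carrier N, mult = undefined, one = undefined, zero = \<phi> \<zero>\<^bsub>N\<^esub>,
          add = (\<lambda>x y. \<phi> (\<psi> x \<oplus>\<^bsub>N\<^esub> \<psi> y)), smult = (\<lambda>s x. \<phi> (s \<odot>\<^bsub>N\<^esub> \<psi> x))\<rparr>"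
  have ab: "abelian_group M"
  proof (rule abelian_groupI)
    fix x assume "x \<in> carrier M"
    then show "\<exists>y\<in>carrier M. y \<oplus>\<^bsub>M\<^esub> x = \<zero>\<^bsub>M\<^esub>"
      by (auto simp: M_def \<psi> M.l_neg intro!: bexI[of _ "\<ominus>\<^bsub>N\<^esub> _"])
  qed (auto simp: M_def \<psi> M.a_ac)
  have rm: "right_module S M"
    by (intro right_module.intro ab S.ring_axioms right_module_axioms.intro)
       (auto simp: M_def \<psi> smult_closed smult_one smult_assoc smult_vector_distr smult_scalar_distr)
  have inv: "\<ominus>\<^bsub>M\<^esub> (\<phi> n) = \<phi> (\<ominus>\<^bsub>N\<^esub> n)" if "n \<in> carrier N" for n
  proof -
    interpret A: abelian_group M by fact
    show ?thesis using that by (intro A.minus_equality) (auto simp: M_def \<psi> M.l_neg)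
  qed
  have "simple_right_module S M"
    unfolding simple_right_module_def
  proof (intro conjI rm allI impI)
    show "carrier M \<noteq> {\<zero>\<^bsub>M\<^esub>}" 
    proof
      assume "carrier M = {\<zero>\<^bsub>M\<^esub>}"
      then have "\<phi> v = \<phi> \<zero>\<^bsub>N\<^esub>" using v by (auto simp: M_def)
      then have "\<psi> (\<phi> v) = \<psi> (\<phi> \<zero>\<^bsub>N\<^esub>)" by (rule arg_cong)
      then show False using v by (simp add: \<psi>)
    qed
    fix L assume L: "right_submodule S M L"
    then have LM: "L \<subseteq> \<phi> ` carrier N" by (auto simp: right_submodule_def M_def)
    have "right_submodule S N {n \<in> carrier N. \<phi> n \<in> L}"
    proof -
      have L': "\<phi> \<zero>\<^bsub>N\<^esub> \<in> L" "\<And>x y. x \<in> L \<Longrightarrow> y \<in> L \<Longrightarrow> x \<oplus>\<^bsub>M\<^esub> y \<in> L"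
        "\<And>x. x \<in> L \<Longrightarrow> \<ominus>\<^bsub>M\<^esub> x \<in> L" "\<And>s x. s \<in> carrier S \<Longrightarrow> x \<in> L \<Longrightarrow> s \<odot>\<^bsub>M\<^esub> x \<in> L"
        using L by (simp_all add: right_submodule_def M_def)
      have ops: "\<phi> x \<oplus>\<^bsub>M\<^esub> \<phi> y = \<phi> (x \<oplus>\<^bsub>N\<^esub> y)" "s \<odot>\<^bsub>M\<^esub> \<phi> x = \<phi> (s \<odot>\<^bsub>N\<^esub> x)"
        if "x \<in> carrier N" "y \<in> carrier N" for x y s
        using that by (simp_all add: M_def \<psi>)
      show ?thesis unfolding right_submodule_def
      proof (intro conjI ballI)
        show "{n \<in> carrier N. \<phi> n \<in> L} \<subseteq> carrier N" by blast
        show "\<zero>\<^bsub>N\<^esub> \<in> {n \<in> carrier N. \<phi> n \<in> L}" using L' by simp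
      next
        fix x y assume "x \<in> {n \<in> carrier N. \<phi> n \<in> L}" "y \<in> {n \<in> carrier N. \<phi> n \<in> L}"
        then show "x \<oplus>\<^bsub>N\<^esub> y \<in> {n \<in> carrier N. \<phi> n \<in> L}" using L'(2)[of "\<phi> x" "\<phi> y"] by (simp add: ops)
      next
        fix x assume "x \<in> {n \<in> carrier N. \<phi> n \<in> L}"
        then show "\<ominus>\<^bsub>N\<^esub> x \<in> {n \<in> carrier N. \<phi> n \<in> L}" using L'(3)[of "\<phi> x"] by (simp add: inv)
      next
        fix s x assume "s \<in> carrier S" "x \<in> {n \<in> carrier N. \<phi> n \<in> L}"
        then show "s \<odot>\<^bsub>N\<^esub> x \<in> {n \<in> carrier N. \<phi> n \<in> L}"
          using L'(4)[of s "\<phi> x"] by (simp add: ops(2)[of x x] smult_closed)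
      qed
    qed
    then have "{n \<in> carrier N. \<phi> n \<in> L} = {\<zero>\<^bsub>N\<^esub>} \<or> {n \<in> carrier N. \<phi> n \<in> L} = carrier N"
      using s by (auto simp: simple_right_module_def)
    moreover have "L = \<phi> ` {n \<in> carrier N. \<phi> n \<in> L}" using LM by auto
    ultimately show "L = {\<zero>\<^bsub>M\<^esub>} \<or> L = carrier M" by (auto simp: M_def)
  qed
  moreover have "faithful_right_module S M"
    unfolding faithful_right_module_def
  proof (intro conjI rm ballI impI)
    fix s assume s: "s \<in> carrier S" "\<forall>x\<in>carrier M. s \<odot>\<^bsub>M\<^esub> x = \<zero>\<^bsub>M\<^esub>"
    have "s \<odot>\<^bsub>N\<^esub> n = \<zero>\<^bsub>N\<^esub>" if n: "n \<in> carrier N" for n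
    proof -
      have "\<phi> (s \<odot>\<^bsub>N\<^esub> n) = \<phi> \<zero>\<^bsub>N\<^esub>" using s(2) n by (simp add: M_def \<psi>)
      then have "\<psi> (\<phi> (s \<odot>\<^bsub>N\<^esub> n)) = \<psi> (\<phi> \<zero>\<^bsub>N\<^esub>)" by (rule arg_cong)
      then show ?thesis using n s(1) by (simp add: \<psi> smult_closed)
    qed
    then show "s = \<zero>\<^bsub>S\<^esub>" using f s(1) by (simp add: faithful_right_module_def)
  qed
  ultimately show ?thesis by (auto simp: right_primitive_def)
qed


section \<open>Group rings\<close>

text \<open>
  Elements are the finitely supported functions \<open>G \<rightarrow> R\<close>, extended by zero outside the carrier
  of \<open>G\<close>. In a product \<open>f * h\<close> the sum runs over the (finite) support of \<open>f\<close>.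
\<close>

definition group_ring :: "('r, 'n) ring_scheme \<Rightarrow> ('g, 'm) monoid_scheme \<Rightarrow> ('g \<Rightarrow> 'r) ring" where
  "group_ring R G =
     \<lparr>carrier = {f. (\<forall>g. f g \<in> carrier R) \<and> (\<forall>g. g \<notin> carrier G \<longrightarrow> f g = \<zero>\<^bsub>R\<^esub>) \<and>
                    finite {g. f g \<noteq> \<zero>\<^bsub>R\<^esub>}},
      mult = (\<lambda>f h g. if g \<in> carrier G
                then \<Oplus>\<^bsub>R\<^esub>x\<in>{x. f x \<noteq> \<zero>\<^bsub>R\<^esub>}. f x \<otimes>\<^bsub>R\<^esub> h (inv\<^bsub>G\<^esub> x \<otimes>\<^bsub>G\<^esub> g)
                else \<zero>\<^bsub>R\<^esub>),
      one = (\<lambda>g. if g = \<one>\<^bsub>G\<^esub> then \<one>\<^bsub>R\<^esub> else \<zero>\<^bsub>R\<^esub>),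
      zero = (\<lambda>g. \<zero>\<^bsub>R\<^esub>),
      add = (\<lambda>f h g. f g \<oplus>\<^bsub>R\<^esub> h g)\<rparr>"

lemma finsum_swap:
  assumes R: "abelian_monoid R" and fin: "finite A" "finite B"
    and f: "\<And>x y. x \<in> A \<Longrightarrow> y \<in> B \<Longrightarrow> f x y \<in> carrier R"
  shows "(\<Oplus>\<^bsub>R\<^esub>x\<in>A. \<Oplus>\<^bsub>R\<^esub>y\<in>B. f x y) = (\<Oplus>\<^bsub>R\<^esub>y\<in>B. \<Oplus>\<^bsub>R\<^esub>x\<in>A. f x y)"
proof -
  interpret abelian_monoid R by fact
  show ?thesis using fin(1) f
  proof (induction A)
    case empty
    then show ?case by simp
  next
    case (insert a A)
    have c: "f x y \<in> carrier R" if "x \<in> insert a A" "y \<in> B" for x y using insert.prems that by blast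
    have "(\<Oplus>\<^bsub>R\<^esub>x\<in>insert a A. \<Oplus>\<^bsub>R\<^esub>y\<in>B. f x y) = finsum R (f a) B \<oplus>\<^bsub>R\<^esub> (\<Oplus>\<^bsub>R\<^esub>y\<in>B. \<Oplus>\<^bsub>R\<^esub>x\<in>A. f x y)"
      using insert c by (subst finsum_insert) (auto intro!: finsum_closed)
    also have "\<dots> = (\<Oplus>\<^bsub>R\<^esub>y\<in>B. f a y \<oplus>\<^bsub>R\<^esub> (\<Oplus>\<^bsub>R\<^esub>x\<in>A. f x y))"
      using c by (subst finsum_addf) (auto intro!: finsum_closed)
    also have "\<dots> = (\<Oplus>\<^bsub>R\<^esub>y\<in>B. \<Oplus>\<^bsub>R\<^esub>x\<in>insert a A. f x y)"
    proof (rule finsum_cong')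
      fix y assume "y \<in> B"
      then show "f a y \<oplus>\<^bsub>R\<^esub> (\<Oplus>\<^bsub>R\<^esub>x\<in>A. f x y) = (\<Oplus>\<^bsub>R\<^esub>x\<in>insert a A. f x y)"
        using insert.hyps c by (subst finsum_insert) auto
    qed (use c in \<open>auto intro!: finsum_closed\<close>)
    finally show ?case .
  qed
qed

lemma group_ring_mult_eq:
  fixes R (structure)
  assumes "ring R" "group G" "f \<in> carrier (group_ring R G)" "h \<in> carrier (group_ring R G)"
    "finite A" "{x. f x \<noteq> \<zero>\<^bsub>R\<^esub>} \<subseteq> A" "g \<in> carrier G"
  shows "(f \<otimes>\<^bsub>group_ring R G\<^esub> h) g = (\<Oplus>\<^bsub>R\<^esub>x\<in>A. f x \<otimes>\<^bsub>R\<^esub> h (inv\<^bsub>G\<^esub> x \<otimes>\<^bsub>G\<^esub> g))"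
proof -
  interpret ring R by fact
  have c: "f x \<in> carrier R" "h x \<in> carrier R" for x using assms by (auto simp: group_ring_def)
  have "(\<Oplus>x\<in>{x. f x \<noteq> \<zero>}. f x \<otimes> h (inv\<^bsub>G\<^esub> x \<otimes>\<^bsub>G\<^esub> g)) = (\<Oplus>x\<in>A. f x \<otimes> h (inv\<^bsub>G\<^esub> x \<otimes>\<^bsub>G\<^esub> g))"
    using assms(5,6) c by (intro add.finprod_mono_neutral_cong_left) auto
  then show ?thesis using assms(7) by (simp add: group_ring_def)
qed

lemma group_ring_mult_closed:
  fixes R (structure)
  assumes "ring R" "group G" "f \<in> carrier (group_ring R G)" "h \<in> carrier (group_ring R G)"
  shows "f \<otimes>\<^bsub>group_ring R G\<^esub> h \<in> carrier (group_ring R G)"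
proof -
  interpret ring R by fact
  interpret G: group G by fact
  have c: "f x \<in> carrier R" "h x \<in> carrier R" for x using assms by (auto simp: group_ring_def)
  have o: "f x \<noteq> \<zero> \<Longrightarrow> x \<in> carrier G" "h x \<noteq> \<zero> \<Longrightarrow> x \<in> carrier G" for x
    using assms(3,4) unfolding group_ring_def partial_object.simps by blast+
  let ?P = "f \<otimes>\<^bsub>group_ring R G\<^esub> h"
  have P: "?P g = (if g \<in> carrier G then \<Oplus>x\<in>{x. f x \<noteq> \<zero>}. f x \<otimes> h (inv\<^bsub>G\<^esub> x \<otimes>\<^bsub>G\<^esub> g) else \<zero>)" for g
    by (simp add: group_ring_def)
  have 1: "?P g \<in> carrier R" for g using c by (auto simp: P intro!: finsum_closed)
  have "{g. ?P g \<noteq> \<zero>} \<subseteq> (\<lambda>(x,y). x \<otimes>\<^bsub>G\<^esub> y) ` ({x. f x \<noteq> \<zero>} \<times> {y. h y \<noteq> \<zero>})"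
  proof
    fix g assume "g \<in> {g. ?P g \<noteq> \<zero>}"
    then have g: "g \<in> carrier G" and "(\<Oplus>x\<in>{x. f x \<noteq> \<zero>}. f x \<otimes> h (inv\<^bsub>G\<^esub> x \<otimes>\<^bsub>G\<^esub> g)) \<noteq> \<zero>"
      by (auto simp: P split: if_splits)
    then obtain x where x: "f x \<noteq> \<zero>" "f x \<otimes> h (inv\<^bsub>G\<^esub> x \<otimes>\<^bsub>G\<^esub> g) \<noteq> \<zero>"
      by (metis (mono_tags, lifting) add.finprod_one_eqI mem_Collect_eq)
    then have "h (inv\<^bsub>G\<^esub> x \<otimes>\<^bsub>G\<^esub> g) \<noteq> \<zero>" using c by auto
    moreover have "g = x \<otimes>\<^bsub>G\<^esub> (inv\<^bsub>G\<^esub> x \<otimes>\<^bsub>G\<^esub> g)" using o(1)[OF x(1)] g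
      by (simp add: G.m_assoc[symmetric])
    ultimately show "g \<in> (\<lambda>(x,y). x \<otimes>\<^bsub>G\<^esub> y) ` ({x. f x \<noteq> \<zero>} \<times> {y. h y \<noteq> \<zero>})"
      using x(1) by (auto intro!: image_eqI[of _ _ "(x, inv\<^bsub>G\<^esub> x \<otimes>\<^bsub>G\<^esub> g)"])
  qed
  moreover have "finite {x. f x \<noteq> \<zero>}" "finite {x. h x \<noteq> \<zero>}"
    using assms(3,4) by (simp_all add: group_ring_def)
  then have "finite ((\<lambda>(x,y). x \<otimes>\<^bsub>G\<^esub> y) ` ({x. f x \<noteq> \<zero>} \<times> {y. h y \<noteq> \<zero>}))" by simp
  ultimately have "finite {g. ?P g \<noteq> \<zero>}" by (rule finite_subset)
  moreover have "?P g = \<zero>" if "g \<notin> carrier G" for g using that by (simp add: P)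
  ultimately have "?P \<in> {f. (\<forall>g. f g \<in> carrier R) \<and> (\<forall>g. g \<notin> carrier G \<longrightarrow> f g = \<zero>) \<and> finite {g. f g \<noteq> \<zero>}}"
    using 1 by (intro CollectI conjI allI impI)
  moreover have "carrier (group_ring R G) = {f. (\<forall>g. f g \<in> carrier R) \<and> (\<forall>g. g \<notin> carrier G \<longrightarrow> f g = \<zero>) \<and> finite {g. f g \<noteq> \<zero>}}"
    by (simp add: group_ring_def)
  ultimately show ?thesis by simp
qed

lemma group_ring_m_assoc:
  fixes R (structure)
  assumes "ring R" "group G" "f \<in> carrier (group_ring R G)" "h \<in> carrier (group_ring R G)"
    "k \<in> carrier (group_ring R G)"
  shows "(f \<otimes>\<^bsub>group_ring R G\<^esub> h) \<otimes>\<^bsub>group_ring R G\<^esub> k = f \<otimes>\<^bsub>group_ring R G\<^esub> (h \<otimes>\<^bsub>group_ring R G\<^esub> k)"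
proof
  interpret ring R by fact
  interpret G: group G by fact
  fix g
  have c: "f x \<in> carrier R" "h x \<in> carrier R" "k x \<in> carrier R" for x
    using assms by (auto simp: group_ring_def)
  have o: "f x \<noteq> \<zero> \<Longrightarrow> x \<in> carrier G" "h x \<noteq> \<zero> \<Longrightarrow> x \<in> carrier G" for x
    using assms(3,4) unfolding group_ring_def partial_object.simps by blast+
  define A where "A = {x. f x \<noteq> \<zero>}"
  let ?P = "f \<otimes>\<^bsub>group_ring R G\<^esub> h"
  define B where "B = (\<lambda>(x,y). x \<otimes>\<^bsub>G\<^esub> y) ` (A \<times> {y. h y \<noteq> \<zero>}) \<union> {g. ?P g \<noteq> \<zero>}"
  note cl = group_ring_mult_closed[OF assms(1,2)]
  have hk: "(h \<otimes>\<^bsub>group_ring R G\<^esub> k) x \<in> carrier R" for x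
    using cl[OF assms(4,5)] unfolding group_ring_def[of R G] partial_object.simps by blast
  have A: "finite A" "A \<subseteq> carrier G" using assms(3) by (auto simp: A_def group_ring_def)
  have Pc: "?P \<in> carrier (group_ring R G)" using cl assms by auto
  have fh: "finite {y. h y \<noteq> \<zero>}" "finite {g. ?P g \<noteq> \<zero>}"
    using assms(4) Pc by (auto simp: group_ring_def)
  have "{g. ?P g \<noteq> \<zero>} \<subseteq> carrier G" using Pc by (auto simp: group_ring_def)
  then have B: "finite B" "B \<subseteq> carrier G" using A fh o(2) by (auto simp: B_def subset_eq)
  show "((f \<otimes>\<^bsub>group_ring R G\<^esub> h) \<otimes>\<^bsub>group_ring R G\<^esub> k) g =
     (f \<otimes>\<^bsub>group_ring R G\<^esub> (h \<otimes>\<^bsub>group_ring R G\<^esub> k)) g"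
  proof (cases "g \<in> carrier G")
    case False
    then show ?thesis by (simp add: group_ring_def)
  next
    case g: True
    have "(?P \<otimes>\<^bsub>group_ring R G\<^esub> k) g = (\<Oplus>u\<in>B. ?P u \<otimes> k (inv\<^bsub>G\<^esub> u \<otimes>\<^bsub>G\<^esub> g))"
      using assms Pc B g by (intro group_ring_mult_eq) (auto simp: B_def)
    also have "\<dots> = (\<Oplus>u\<in>B. (\<Oplus>x\<in>A. f x \<otimes> h (inv\<^bsub>G\<^esub> x \<otimes>\<^bsub>G\<^esub> u)) \<otimes> k (inv\<^bsub>G\<^esub> u \<otimes>\<^bsub>G\<^esub> g))"
      using assms A B c by (intro finsum_cong') (auto simp: A_def subset_eq group_ring_mult_eq intro!: finsum_closed)
    also have "\<dots> = (\<Oplus>u\<in>B. \<Oplus>x\<in>A. f x \<otimes> (h (inv\<^bsub>G\<^esub> x \<otimes>\<^bsub>G\<^esub> u) \<otimes> k (inv\<^bsub>G\<^esub> u \<otimes>\<^bsub>G\<^esub> g)))"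
      using c A by (intro finsum_cong') (auto simp: finsum_ldistr m_assoc intro!: finsum_cong' finsum_closed)
    also have "\<dots> = (\<Oplus>x\<in>A. \<Oplus>u\<in>B. f x \<otimes> (h (inv\<^bsub>G\<^esub> x \<otimes>\<^bsub>G\<^esub> u) \<otimes> k (inv\<^bsub>G\<^esub> u \<otimes>\<^bsub>G\<^esub> g)))"
      using c A B by (intro finsum_swap) (auto intro: abelian_monoid_axioms)
    also have "\<dots> = (\<Oplus>x\<in>A. f x \<otimes> (\<Oplus>u\<in>B. h (inv\<^bsub>G\<^esub> x \<otimes>\<^bsub>G\<^esub> u) \<otimes> k (inv\<^bsub>G\<^esub> u \<otimes>\<^bsub>G\<^esub> g)))"
      using c B by (intro finsum_cong') (auto simp: finsum_rdistr intro!: finsum_closed)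
    also have "\<dots> = (\<Oplus>x\<in>A. f x \<otimes> (h \<otimes>\<^bsub>group_ring R G\<^esub> k) (inv\<^bsub>G\<^esub> x \<otimes>\<^bsub>G\<^esub> g))"
    proof (intro finsum_cong')
      fix x assume x: "x \<in> A"
      then have xG: "x \<in> carrier G" using A by auto
      have inj: "inj_on ((\<otimes>\<^bsub>G\<^esub>) (inv\<^bsub>G\<^esub> x)) B" using xG B by (auto simp: inj_on_def subset_eq)
      have sub: "{y. h y \<noteq> \<zero>} \<subseteq> (\<otimes>\<^bsub>G\<^esub>) (inv\<^bsub>G\<^esub> x) ` B"
      proof
        fix y assume y: "y \<in> {y. h y \<noteq> \<zero>}"
        then have "y \<in> carrier G" using o by auto
        then have "y = inv\<^bsub>G\<^esub> x \<otimes>\<^bsub>G\<^esub> (x \<otimes>\<^bsub>G\<^esub> y)" using xG by (metis G.inv_closed G.l_inv G.l_one G.m_assoc)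
        moreover have "x \<otimes>\<^bsub>G\<^esub> y \<in> B" using x y by (auto simp: B_def)
        ultimately show "y \<in> (\<otimes>\<^bsub>G\<^esub>) (inv\<^bsub>G\<^esub> x) ` B" by blast
      qed
      have "(h \<otimes>\<^bsub>group_ring R G\<^esub> k) (inv\<^bsub>G\<^esub> x \<otimes>\<^bsub>G\<^esub> g) =
         (\<Oplus>y\<in>(\<otimes>\<^bsub>G\<^esub>) (inv\<^bsub>G\<^esub> x) ` B. h y \<otimes> k (inv\<^bsub>G\<^esub> y \<otimes>\<^bsub>G\<^esub> (inv\<^bsub>G\<^esub> x \<otimes>\<^bsub>G\<^esub> g)))"
        using assms B sub g xG by (intro group_ring_mult_eq) auto
      also have "\<dots> = (\<Oplus>u\<in>B. h (inv\<^bsub>G\<^esub> x \<otimes>\<^bsub>G\<^esub> u) \<otimes> k (inv\<^bsub>G\<^esub> (inv\<^bsub>G\<^esub> x \<otimes>\<^bsub>G\<^esub> u) \<otimes>\<^bsub>G\<^esub> (inv\<^bsub>G\<^esub> x \<otimes>\<^bsub>G\<^esub> g)))"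
        using c inj by (subst finsum_reindex) auto
      also have "\<dots> = (\<Oplus>u\<in>B. h (inv\<^bsub>G\<^esub> x \<otimes>\<^bsub>G\<^esub> u) \<otimes> k (inv\<^bsub>G\<^esub> u \<otimes>\<^bsub>G\<^esub> g))"
      proof (intro finsum_cong')
        fix u assume "u \<in> B"
        then have u: "u \<in> carrier G" using B by auto
        have "inv\<^bsub>G\<^esub> (inv\<^bsub>G\<^esub> x \<otimes>\<^bsub>G\<^esub> u) \<otimes>\<^bsub>G\<^esub> (inv\<^bsub>G\<^esub> x \<otimes>\<^bsub>G\<^esub> g) = inv\<^bsub>G\<^esub> u \<otimes>\<^bsub>G\<^esub> (x \<otimes>\<^bsub>G\<^esub> (inv\<^bsub>G\<^esub> x \<otimes>\<^bsub>G\<^esub> g))"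
          using xG u g by (simp add: G.inv_mult_group G.m_assoc)
        also have "x \<otimes>\<^bsub>G\<^esub> (inv\<^bsub>G\<^esub> x \<otimes>\<^bsub>G\<^esub> g) = g" using xG g by (metis G.inv_closed G.l_one G.m_assoc G.r_inv)
        finally show "h (inv\<^bsub>G\<^esub> x \<otimes>\<^bsub>G\<^esub> u) \<otimes> k (inv\<^bsub>G\<^esub> (inv\<^bsub>G\<^esub> x \<otimes>\<^bsub>G\<^esub> u) \<otimes>\<^bsub>G\<^esub> (inv\<^bsub>G\<^esub> x \<otimes>\<^bsub>G\<^esub> g)) =
           h (inv\<^bsub>G\<^esub> x \<otimes>\<^bsub>G\<^esub> u) \<otimes> k (inv\<^bsub>G\<^esub> u \<otimes>\<^bsub>G\<^esub> g)" by simp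
      qed (use c in auto)
      finally show "f x \<otimes> (\<Oplus>u\<in>B. h (inv\<^bsub>G\<^esub> x \<otimes>\<^bsub>G\<^esub> u) \<otimes> k (inv\<^bsub>G\<^esub> u \<otimes>\<^bsub>G\<^esub> g)) =
         f x \<otimes> (h \<otimes>\<^bsub>group_ring R G\<^esub> k) (inv\<^bsub>G\<^esub> x \<otimes>\<^bsub>G\<^esub> g)" by simp
    qed (use c hk in auto)
    also have "\<dots> = (f \<otimes>\<^bsub>group_ring R G\<^esub> (h \<otimes>\<^bsub>group_ring R G\<^esub> k)) g"
      using assms cl[OF assms(4,5)] A g by (intro group_ring_mult_eq[symmetric]) (auto simp: A_def)
    finally show ?thesis .
  qed
qed

lemma group_ring_is_ring:
  fixes R (structure)
  assumes "ring R" "group G"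
  shows "ring (group_ring R G)"
proof -
  interpret ring R by fact
  interpret G: group G by fact
  note cl = group_ring_mult_closed[OF assms]
  have E: "carrier (group_ring R G) = {f. (\<forall>g. f g \<in> carrier R) \<and> (\<forall>g. g \<notin> carrier G \<longrightarrow> f g = \<zero>) \<and> finite {g. f g \<noteq> \<zero>}}"
    "\<zero>\<^bsub>group_ring R G\<^esub> = (\<lambda>g. \<zero>)" "\<one>\<^bsub>group_ring R G\<^esub> = (\<lambda>g. if g = \<one>\<^bsub>G\<^esub> then \<one> else \<zero>)"
    "\<And>f h. f \<oplus>\<^bsub>group_ring R G\<^esub> h = (\<lambda>g. f g \<oplus> h g)"
    by (auto simp: group_ring_def)
  have add: "f \<oplus>\<^bsub>group_ring R G\<^esub> h \<in> carrier (group_ring R G)"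
    if "f \<in> carrier (group_ring R G)" "h \<in> carrier (group_ring R G)" for f h
  proof -
    have "{g. f g \<oplus> h g \<noteq> \<zero>} \<subseteq> {g. f g \<noteq> \<zero>} \<union> {g. h g \<noteq> \<zero>}" by auto
    then show ?thesis using that unfolding E by (auto intro: finite_subset)
  qed
  have "abelian_group (group_ring R G)"
  proof (rule abelian_groupI)
    fix f assume f: "f \<in> carrier (group_ring R G)"
    then show "\<exists>h\<in>carrier (group_ring R G). h \<oplus>\<^bsub>group_ring R G\<^esub> f = \<zero>\<^bsub>group_ring R G\<^esub>"
      by (intro bexI[of _ "\<lambda>g. \<ominus> f g"])
         (auto simp: E l_neg elim: rev_finite_subset)
  qed (use add in \<open>auto simp: E a_ac\<close>)
  moreover have one: "\<one>\<^bsub>group_ring R G\<^esub> \<in> carrier (group_ring R G)" by (auto simp: E)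
  have "monoid (group_ring R G)"
  proof (rule monoidI)
    fix f assume f: "f \<in> carrier (group_ring R G)"
    then have c: "f x \<in> carrier R" for x by (auto simp: E)
    show "\<one>\<^bsub>group_ring R G\<^esub> \<otimes>\<^bsub>group_ring R G\<^esub> f = f"
    proof
      fix g show "(\<one>\<^bsub>group_ring R G\<^esub> \<otimes>\<^bsub>group_ring R G\<^esub> f) g = f g"
      proof (cases "g \<in> carrier G")
        case True
        have "(\<one>\<^bsub>group_ring R G\<^esub> \<otimes>\<^bsub>group_ring R G\<^esub> f) g = (\<Oplus>x\<in>{\<one>\<^bsub>G\<^esub>}. \<one>\<^bsub>group_ring R G\<^esub> x \<otimes> f (inv\<^bsub>G\<^esub> x \<otimes>\<^bsub>G\<^esub> g))"
          using assms f one True by (intro group_ring_mult_eq) (auto simp: E)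
        also have "\<dots> = f g" using c True by (simp add: E)
        finally show ?thesis .
      next
        case False
        then show ?thesis using f by (auto simp: group_ring_def)
      qed
    qed
    show "f \<otimes>\<^bsub>group_ring R G\<^esub> \<one>\<^bsub>group_ring R G\<^esub> = f"
    proof
      fix g show "(f \<otimes>\<^bsub>group_ring R G\<^esub> \<one>\<^bsub>group_ring R G\<^esub>) g = f g"
      proof (cases "g \<in> carrier G")
        case True
        have "(f \<otimes>\<^bsub>group_ring R G\<^esub> \<one>\<^bsub>group_ring R G\<^esub>) g = (\<Oplus>x\<in>insert g {x. f x \<noteq> \<zero>}. f x \<otimes> \<one>\<^bsub>group_ring R G\<^esub> (inv\<^bsub>G\<^esub> x \<otimes>\<^bsub>G\<^esub> g))"
          using assms f one True by (intro group_ring_mult_eq) (auto simp: E)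
        also have "\<dots> = (\<Oplus>x\<in>insert g {x. f x \<noteq> \<zero>}. if g = x then f x else \<zero>)"
        proof (intro finsum_cong')
          fix x assume "x \<in> insert g {x. f x \<noteq> \<zero>}"
          then have "x \<in> carrier G" using True f by (auto simp: E)
          then have "inv\<^bsub>G\<^esub> x \<otimes>\<^bsub>G\<^esub> g = \<one>\<^bsub>G\<^esub> \<longleftrightarrow> g = x" using True
            by (metis G.inv_closed G.inv_equality G.inv_inv G.l_inv)
          then show "f x \<otimes> \<one>\<^bsub>group_ring R G\<^esub> (inv\<^bsub>G\<^esub> x \<otimes>\<^bsub>G\<^esub> g) = (if g = x then f x else \<zero>)"
            using c by (auto simp: E)
        qed (use c in auto)
        also have "\<dots> = f g" using c f by (intro add.finprod_singleton) (auto simp: E)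
        finally show ?thesis .
      next
        case False
        then show ?thesis using f by (auto simp: group_ring_def)
      qed
    qed
  qed (use cl one group_ring_m_assoc[OF assms] in auto)
  moreover have "(f \<oplus>\<^bsub>group_ring R G\<^esub> h) \<otimes>\<^bsub>group_ring R G\<^esub> k = f \<otimes>\<^bsub>group_ring R G\<^esub> k \<oplus>\<^bsub>group_ring R G\<^esub> h \<otimes>\<^bsub>group_ring R G\<^esub> k"
    "k \<otimes>\<^bsub>group_ring R G\<^esub> (f \<oplus>\<^bsub>group_ring R G\<^esub> h) = k \<otimes>\<^bsub>group_ring R G\<^esub> f \<oplus>\<^bsub>group_ring R G\<^esub> k \<otimes>\<^bsub>group_ring R G\<^esub> h"
    if f: "f \<in> carrier (group_ring R G)" and h: "h \<in> carrier (group_ring R G)" and k: "k \<in> carrier (group_ring R G)" for f h k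
  proof -
    have c: "f x \<in> carrier R" "h x \<in> carrier R" "k x \<in> carrier R" for x using that by (auto simp: E)
    have fin: "finite {x. f x \<noteq> \<zero>}" "finite {x. h x \<noteq> \<zero>}" "finite {x. k x \<noteq> \<zero>}" using that by (auto simp: E)
    let ?A = "{x. f x \<noteq> \<zero>} \<union> {x. h x \<noteq> \<zero>} \<union> {x. k x \<noteq> \<zero>}"
    have A: "finite ?A" using fin by auto
    show "(f \<oplus>\<^bsub>group_ring R G\<^esub> h) \<otimes>\<^bsub>group_ring R G\<^esub> k = f \<otimes>\<^bsub>group_ring R G\<^esub> k \<oplus>\<^bsub>group_ring R G\<^esub> h \<otimes>\<^bsub>group_ring R G\<^esub> k"
    proof
      fix g show "((f \<oplus>\<^bsub>group_ring R G\<^esub> h) \<otimes>\<^bsub>group_ring R G\<^esub> k) g = (f \<otimes>\<^bsub>group_ring R G\<^esub> k \<oplus>\<^bsub>group_ring R G\<^esub> h \<otimes>\<^bsub>group_ring R G\<^esub> k) g"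
      proof (cases "g \<in> carrier G")
        case True
        have 1: "((f \<oplus>\<^bsub>group_ring R G\<^esub> h) \<otimes>\<^bsub>group_ring R G\<^esub> k) g = (\<Oplus>x\<in>?A. (f x \<oplus> h x) \<otimes> k (inv\<^bsub>G\<^esub> x \<otimes>\<^bsub>G\<^esub> g))"
          proof -
          have "{x. (f \<oplus>\<^bsub>group_ring R G\<^esub> h) x \<noteq> \<zero>} \<subseteq> ?A" by (auto simp: E)
          then show ?thesis using group_ring_mult_eq[OF assms add[OF f h] k A _ True] by (simp add: E(4))
        qed
        have 2: "(f \<otimes>\<^bsub>group_ring R G\<^esub> k) g = (\<Oplus>x\<in>?A. f x \<otimes> k (inv\<^bsub>G\<^esub> x \<otimes>\<^bsub>G\<^esub> g))"
          "(h \<otimes>\<^bsub>group_ring R G\<^esub> k) g = (\<Oplus>x\<in>?A. h x \<otimes> k (inv\<^bsub>G\<^esub> x \<otimes>\<^bsub>G\<^esub> g))"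
          using group_ring_mult_eq[OF assms f k A _ True] group_ring_mult_eq[OF assms h k A _ True] by auto
        have "((f \<oplus>\<^bsub>group_ring R G\<^esub> h) \<otimes>\<^bsub>group_ring R G\<^esub> k) g = (f \<otimes>\<^bsub>group_ring R G\<^esub> k) g \<oplus> (h \<otimes>\<^bsub>group_ring R G\<^esub> k) g"
          unfolding 1 2 using c by (subst finsum_addf[symmetric]) (auto simp: l_distr)
        then show ?thesis by (simp add: E(4)[of "f \<otimes>\<^bsub>group_ring R G\<^esub> k"])
      qed (use c in \<open>simp add: group_ring_def\<close>)
    qed
    show "k \<otimes>\<^bsub>group_ring R G\<^esub> (f \<oplus>\<^bsub>group_ring R G\<^esub> h) = k \<otimes>\<^bsub>group_ring R G\<^esub> f \<oplus>\<^bsub>group_ring R G\<^esub> k \<otimes>\<^bsub>group_ring R G\<^esub> h"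
    proof
      fix g show "(k \<otimes>\<^bsub>group_ring R G\<^esub> (f \<oplus>\<^bsub>group_ring R G\<^esub> h)) g = (k \<otimes>\<^bsub>group_ring R G\<^esub> f \<oplus>\<^bsub>group_ring R G\<^esub> k \<otimes>\<^bsub>group_ring R G\<^esub> h) g"
      proof (cases "g \<in> carrier G")
        case True
        have 1: "(k \<otimes>\<^bsub>group_ring R G\<^esub> f) g \<oplus> (k \<otimes>\<^bsub>group_ring R G\<^esub> h) g =
            (\<Oplus>x\<in>{x. k x \<noteq> \<zero>}. k x \<otimes> f (inv\<^bsub>G\<^esub> x \<otimes>\<^bsub>G\<^esub> g) \<oplus> k x \<otimes> h (inv\<^bsub>G\<^esub> x \<otimes>\<^bsub>G\<^esub> g))"
          using c True by (subst finsum_addf) (auto simp: group_ring_def)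
        show ?thesis unfolding E(4)[of "k \<otimes>\<^bsub>group_ring R G\<^esub> f"] 1
          using c True by (simp add: group_ring_def r_distr)
      qed (use c in \<open>simp add: group_ring_def\<close>)
    qed
  qed
  ultimately show ?thesis by (rule ringI)
qed


section \<open>Thin triangles\<close>

text \<open>Below, \<open>M\<close> is the set of points of a metric space and \<open>d\<close> its distance.\<close>

definition geodesic_segment :: "'p set \<Rightarrow> ('p \<Rightarrow> 'p \<Rightarrow> real) \<Rightarrow> 'p \<Rightarrow> 'p \<Rightarrow> 'p set \<Rightarrow> bool" where
  "geodesic_segment M d p q A \<longleftrightarrow>
     (\<exists>(c :: real \<Rightarrow> 'p) L. 0 \<le> L \<and> c ` {0..L} = A \<and> A \<subseteq> M \<and> c 0 = p \<and> c L = q \<and>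
        (\<forall>s\<in>{0..L}. \<forall>t\<in>{0..L}. d (c s) (c t) = \<bar>s - t\<bar>))"

definition metric_nbhd :: "'p set \<Rightarrow> ('p \<Rightarrow> 'p \<Rightarrow> real) \<Rightarrow> real \<Rightarrow> 'p set \<Rightarrow> 'p set" where
  "metric_nbhd M d \<delta> A = {p \<in> M. \<exists>a\<in>A. d p a < \<delta>}"

definition thin_triangles :: "'p set \<Rightarrow> ('p \<Rightarrow> 'p \<Rightarrow> real) \<Rightarrow> real \<Rightarrow> bool" where
  "thin_triangles M d \<delta> \<longleftrightarrow>
     (\<forall>p q r A B C.
        geodesic_segment M d p q A \<and> geodesic_segment M d q r B \<and> geodesic_segment M d r p C \<longrightarrow>
          A \<subseteq> metric_nbhd M d \<delta> (B \<union> C) \<and>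
          B \<subseteq> metric_nbhd M d \<delta> (C \<union> A) \<and>
          C \<subseteq> metric_nbhd M d \<delta> (A \<union> B))"


section \<open>Cayley graphs as metric spaces\<close>

text \<open>
  The points of the geometric realization are the vertices and the interior points of the edges:
  \<open>On_edge g x t\<close> with \<open>0 < t < 1\<close> is the point at distance \<open>t\<close> from \<open>g\<close> along the \<open>x\<close>-labelled
  edge from \<open>g\<close> to \<open>g x\<close>.
\<close>

datatype 'g cayley_point = Vertex 'g | On_edge 'g 'g real

definition cayley_points :: "('g, 'm) monoid_scheme \<Rightarrow> 'g set \<Rightarrow> 'g cayley_point set" where
  "cayley_points G X =
     {Vertex g | g. g \<in> carrier G} \<union>
     {On_edge g x t | g x t. g \<in> carrier G \<and> x \<in> X \<and> 0 < t \<and> t < 1}"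

text \<open>Edges may be traversed in both directions.\<close>

definition cayley_adj :: "('g, 'm) monoid_scheme \<Rightarrow> 'g set \<Rightarrow> ('g \<times> 'g) set" where
  "cayley_adj G X =
     {(g, h). g \<in> carrier G \<and> h \<in> carrier G \<and> (\<exists>x\<in>X. h = g \<otimes>\<^bsub>G\<^esub> x \<or> g = h \<otimes>\<^bsub>G\<^esub> x)}"

definition vertex_dist :: "('g, 'm) monoid_scheme \<Rightarrow> 'g set \<Rightarrow> 'g \<Rightarrow> 'g \<Rightarrow> nat" where
  "vertex_dist G X g h = (LEAST n. (g, h) \<in> cayley_adj G X ^^ n)"

text \<open>
  \<open>exits G p\<close> lists the vertices through which a path can leave the open edge containing \<open>p\<close>,
  with the length of the segment from \<open>p\<close> to that vertex. A shortest path between two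
  points either stays in an edge or passes through exits of both points.
\<close>

fun exits :: "('g, 'm) monoid_scheme \<Rightarrow> 'g cayley_point \<Rightarrow> ('g \<times> real) set" where
  "exits G (Vertex g) = {(g, 0)}"
| "exits G (On_edge g x t) = {(g, t), (g \<otimes>\<^bsub>G\<^esub> x, 1 - t)}"

fun along_edge :: "'g cayley_point \<Rightarrow> 'g cayley_point \<Rightarrow> real set" where
  "along_edge (On_edge g x s) (On_edge h y t) = (if g = h \<and> x = y then {\<bar>s - t\<bar>} else {})"
| "along_edge _ _ = {}"

definition cayley_dist ::
    "('g, 'm) monoid_scheme \<Rightarrow> 'g set \<Rightarrow> 'g cayley_point \<Rightarrow> 'g cayley_point \<Rightarrow> real" where
  "cayley_dist G X p q =
     Min (along_edge p q \<union>
          (\<lambda>((u, a), (v, b)). a + real (vertex_dist G X u v) + b) ` (exits G p \<times> exits G q))"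


section \<open>Hyperbolic groups\<close>

definition hyperbolic_group :: "('g, 'm) monoid_scheme \<Rightarrow> bool" where
  "hyperbolic_group G \<longleftrightarrow> group G \<and>
     (\<exists>X \<delta>. finite X \<and> X \<subseteq> carrier G \<and> generate G X = carrier G \<and> 0 < \<delta> \<and>
        thin_triangles (cayley_points G X) (cayley_dist G X) \<delta>)"

definition elementary_group :: "('g, 'm) monoid_scheme \<Rightarrow> bool" where
  "elementary_group G \<longleftrightarrow> finite (carrier G) \<or>
     (\<exists>H. subgroup H G \<and> cyclic_group (G\<lparr>carrier := H\<rparr>) \<and> infinite H \<and>
        finite (rcosets\<^bsub>G\<^esub> H))"

definition torsion_free_group :: "('g, 'm) monoid_scheme \<Rightarrow> bool" where
  "torsion_free_group G \<longleftrightarrow>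
     (\<forall>g\<in>carrier G. \<forall>n::nat. 0 < n \<and> g [^]\<^bsub>G\<^esub> n = \<one>\<^bsub>G\<^esub> \<longrightarrow> g = \<one>\<^bsub>G\<^esub>)"

end

theory Submission
  imports Defs "HOL-Algebra.Ideal" "HOL-Algebra.Subrings"
begin

text \<open>
  To make a group ring \<open>RG\<close> primitive it suffices to find a proper right ideal \<open>J\<close> with \<open>J + I = RG\<close>
  for all nonzero two-sided ideals \<open>I\<close> (Formanek). For a sequence \<open>b\<^sub>i\<close> of nonzero elements that meets
  all these ideals, take \<open>J\<close> generated by \<open>1 + \<epsilon>\<^sub>i\<close> with \<open>\<epsilon>\<^sub>i = x\<^sub>i b\<^sub>i (y\<^sub>i + y'\<^sub>i)\<close>. The group elements are
  chosen, using hyperbolicity, such that the elements \<open>u\<close> of the supports of all \<open>\<epsilon>\<^sub>i\<close> split up early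
  compared with their lengths, and such that for each \<open>i\<close> there are two of them whose inverses split
  up early. Given \<open>\<Sum> (1 + \<epsilon>\<^sub>i) r\<^sub>i\<close>, a longest element \<open>h\<close> of the supports of the \<open>r\<^sub>i\<close> therefore has a
  product \<open>uh\<close> that is longer than \<open>h\<close> and cannot cancel, so the sum is not \<open>1\<close>.

  The choice needs elements \<open>y\<close> that diverge from \<open>ty\<close> for all \<open>t\<close> in a finite set without \<open>1\<close>. They exist
  by B. H. Neumann's lemma on unions of cosets, because centralizers of nontrivial elements have
  infinite index: such a centralizer has linear growth, hence contains the powers of the element
  with finite index.

  For an uncountable field, it suffices to consider \<open>b\<^sub>i\<close> with coefficients in the image of \<open>\<int>\<close>, since
  each nonzero ideal contains such an element.
\<close>

text \<open>Nothing bounds the supports of the \<open>r_i\<close> in advance, so the choice of the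
  blocks cannot depend on them. All conditions on the blocks compare Gromov products with the
  lengths of the \<open>u\<close> alone; the four-point inequality transfers them to the products
  \<open>uh\<close> for arbitrary \<open>h\<close>. With a single \<open>y_i\<close>, the inverses
  of all \<open>x s y\<close> would start along that of \<open>y_i\<close>, and \<open>h\<close>
  might cancel with every one of them. The second summand \<open>y'_i\<close> offers an alternative
  that \<open>h\<close> cannot spoil at the same time.

  Infinitely many blocks have to be separated, each relative to its own lengths. They are built by
  recursion, every block starting along a prefix that its predecessor has left free; this is why the
  test set must be countable.

  Of the Cayley graph only an integer length with finite balls, points on geodesics and a four-point
  inequality is kept, so the real-valued thin triangles are translated once. Torsion-freeness makes
  the powers of a nontrivial element distinct, and non-elementarity keeps the infinite cyclic group
  they form from having finite index.\<close>

lemma (in group) inv_cancel_left [simp]: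
  assumes "x \<in> carrier G" "y \<in> carrier G"
  shows "inv x \<otimes> (x \<otimes> y) = y" "x \<otimes> (inv x \<otimes> y) = y"
  using assms by (simp_all add: m_assoc[symmetric])

section \<open>Finite unions of cosets\<close>

text \<open>Right translation by \<open>inv a \<otimes> f\<close> carries \<open>H #> a\<close> onto
  \<open>H #> f\<close>; one coset inside \<open>C\<close> thus places every coset of
  \<open>H\<close> inside a translate of \<open>C\<close>.\<close>

lemma (in group) r_coset_shift_subset:
  assumes H: "subgroup H G" and a: "a \<in> carrier G" and f: "f \<in> carrier G" and C: "C \<subseteq> carrier G"
    and sub: "H #> a \<subseteq> C"
  shows "H #> f \<subseteq> C #> (inv a \<otimes> f)"
proof
  fix z assume "z \<in> H #> f"
  then obtain h where h: "h \<in> H" "z = h \<otimes> f" by (auto simp: r_coset_def)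
  have hG: "h \<in> carrier G" using subgroup.mem_carrier[OF H h(1)] .
  have "h \<otimes> a \<in> C" using h sub by (auto simp: r_coset_def)
  moreover have "z = (h \<otimes> a) \<otimes> (inv a \<otimes> f)"
    using h hG a f by (simp add: m_assoc)
  ultimately show "z \<in> C #> (inv a \<otimes> f)" by (auto simp: r_coset_def)
qed

text \<open>B. H. Neumann's lemma, by induction on the number of subgroups. If the listed cosets of
  \<open>K\<close> miss some \<open>a\<close>, then the other subgroups cover \<open>K #> a\<close>;
  translating this covering covers every listed coset of \<open>K\<close>, so \<open>K\<close> can
  be discarded. Only finiteness matters, so one list \<open>F\<close> of representatives serves all
  subgroups.\<close>

lemma (in group) finite_index_of_coset_cover:
  assumes "finite \<H>" "\<And>H. H \<in> \<H> \<Longrightarrow> subgroup H G" "finite F" "F \<subseteq> carrier G"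
    "carrier G \<subseteq> (\<Union>H\<in>\<H>. \<Union>f\<in>F. H #> f)"
  shows "\<exists>H\<in>\<H>. \<exists>F. finite F \<and> F \<subseteq> carrier G \<and> carrier G \<subseteq> (\<Union>f\<in>F. H #> f)"
  using assms
proof (induction \<H> arbitrary: F rule: finite_induct)
  case empty
  then show ?case by auto
next
  case (insert K \<H>)
  show ?case
  proof (cases "carrier G \<subseteq> (\<Union>f\<in>F. K #> f)")
    case True
    then show ?thesis using insert.prems by blast
  next
    case False
    then obtain a where a: "a \<in> carrier G" "\<forall>f\<in>F. a \<notin> K #> f" by blast
    have K: "subgroup K G" using insert.prems(1) by simp
    then have KG: "K \<subseteq> carrier G" by (rule subgroup.subset)
    define C where "C = (\<Union>H\<in>\<H>. \<Union>f\<in>F. H #> f)"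
    have HG: "H \<subseteq> carrier G" if "H \<in> \<H>" for H
      using subgroup.subset[OF insert.prems(1)] that by simp
    have CG: "C \<subseteq> carrier G"
      unfolding C_def using HG insert.prems(3) by (intro UN_least r_coset_subset_G) auto
    \<comment> \<open>Distinct cosets of \<open>K\<close> are disjoint, so none of the listed ones
      meets the coset of the missed element \<open>a\<close>.\<close>
    have aC: "K #> a \<subseteq> C"
    proof
      fix z assume z: "z \<in> K #> a"
      then have zG: "z \<in> carrier G" using r_coset_subset_G[OF KG a(1)] by blast
      then obtain H f where Hf: "H \<in> insert K \<H>" "f \<in> F" "z \<in> H #> f" using insert.prems(4) by blast
      have "H \<noteq> K"
      proof
        assume "H = K"
        then have "z \<in> K #> f" using Hf by simp
        then have "K #> f = K #> z" using repr_independence[OF _ _ K] Hf(2) insert.prems(3) by (simp add: subset_eq)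
        moreover have "K #> a = K #> z" using repr_independence[OF z a(1) K] .
        ultimately have "a \<in> K #> f" using rcos_self[OF a(1) K] by simp
        then show False using a(2) Hf(2) by blast
      qed
      then show "z \<in> C" using Hf by (auto simp: C_def)
    qed
    \<comment> \<open>\<open>F\<close> keeps the old cosets; the products represent the cosets that
      arise on translating them by \<open>inv a \<otimes> g\<close>.\<close>
    define F' where "F' = F \<union> (\<lambda>(f,g). f \<otimes> (inv a \<otimes> g)) ` (F \<times> F)"
    have F': "finite F'" "F' \<subseteq> carrier G"
      using insert.prems(2,3) a(1) by (auto simp: F'_def subset_eq)
    have "C #> (inv a \<otimes> g) \<subseteq> (\<Union>H\<in>\<H>. \<Union>f\<in>F'. H #> f)" if g: "g \<in> F" for g
    proof
      fix z assume "z \<in> C #> (inv a \<otimes> g)"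
      then obtain c where c: "c \<in> C" "z = c \<otimes> (inv a \<otimes> g)" by (auto simp: r_coset_def)
      then obtain H f where H: "H \<in> \<H>" "f \<in> F" "c \<in> H #> f" by (auto simp: C_def)
      have "z \<in> (H #> f) #> (inv a \<otimes> g)" using c H(3) by (auto simp: r_coset_def)
      also have "\<dots> = H #> (f \<otimes> (inv a \<otimes> g))"
        using HG[OF H(1)] H(2) insert.prems(3) a(1) g by (intro coset_mult_assoc) auto
      finally show "z \<in> (\<Union>H\<in>\<H>. \<Union>f\<in>F'. H #> f)" using H g by (auto simp: F'_def)
    qed
    moreover have "K #> g \<subseteq> C #> (inv a \<otimes> g)" if "g \<in> F" for g
      using that insert.prems(3) by (intro r_coset_shift_subset[OF K a(1) _ CG aC]) auto
    ultimately have 1: "K #> g \<subseteq> (\<Union>H\<in>\<H>. \<Union>f\<in>F'. H #> f)" if "g \<in> F" for g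
      using that by (meson subset_trans)
    have 2: "C \<subseteq> (\<Union>H\<in>\<H>. \<Union>f\<in>F'. H #> f)" by (auto simp: C_def F'_def)
    have "carrier G \<subseteq> (\<Union>f\<in>F. K #> f) \<union> C"
      using insert.prems(4) unfolding C_def UN_insert .
    also have "\<dots> \<subseteq> (\<Union>H\<in>\<H>. \<Union>f\<in>F'. H #> f)"
      using 1 2 by (intro Un_least UN_least) simp_all
    finally have "\<exists>H\<in>\<H>. \<exists>F. finite F \<and> F \<subseteq> carrier G \<and> carrier G \<subseteq> (\<Union>f\<in>F. H #> f)"
      using F' insert.prems(1) by (intro insert.IH) auto
    then show ?thesis by (meson insertI2)
  qed
qed

section \<open>Hyperbolic length functions\<close>

text \<open>A word length reduced to what the argument uses. \<open>geodesic_point\<close> stands in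
  for geodesics from the identity, and \<open>four_point\<close> is Gromov's inequality for the
  doubled product, so \<open>\<delta>\<close> is on the doubled scale too and everything stays in
  the integers.\<close>

locale hyperbolic_length = group G for G (structure) +
  fixes len :: "'a \<Rightarrow> int" and X :: "'a set" and \<delta> :: int
  assumes len_one [simp]: "len \<one> = 0"
    and len_nonneg: "x \<in> carrier G \<Longrightarrow> 0 \<le> len x"
    and len_inv [simp]: "x \<in> carrier G \<Longrightarrow> len (inv x) = len x"
    and len_mult_le: "x \<in> carrier G \<Longrightarrow> y \<in> carrier G \<Longrightarrow> len (x \<otimes> y) \<le> len x + len y"
    and finite_len_ball: "finite {x \<in> carrier G. len x \<le> r}"
    and geodesic_point: "x \<in> carrier G \<Longrightarrow> 0 \<le> r \<Longrightarrow> r \<le> len x \<Longrightarrow>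
      \<exists>p\<in>carrier G. len p = r \<and> len (inv p \<otimes> x) = len x - r"
    and delta_nonneg: "0 \<le> \<delta>"
    and four_point: "x \<in> carrier G \<Longrightarrow> y \<in> carrier G \<Longrightarrow> z \<in> carrier G \<Longrightarrow>
      min (len x + len y - len (inv x \<otimes> y)) (len y + len z - len (inv y \<otimes> z)) - \<delta>
        \<le> len x + len z - len (inv x \<otimes> z)"
    and finite_gens: "finite X"
    and gens: "X \<subseteq> carrier G" "generate G X = carrier G"
begin

text \<open>Twice the Gromov product with respect to the identity, which keeps it an integer.\<close>

definition gp :: "'a \<Rightarrow> 'a \<Rightarrow> int" where
  "gp x y = len x + len y - len (inv x \<otimes> y)"

lemma gp_sym: "x \<in> carrier G \<Longrightarrow> y \<in> carrier G \<Longrightarrow> gp x y = gp y x"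
  using len_inv[of "inv x \<otimes> y"] by (simp add: gp_def inv_mult_group)

text \<open>The minimum is read as an alternative: if \<open>x\<close> and \<open>z\<close> split up
  early, any \<open>y\<close> splits up early from one of them. Conversely, large products of
  \<open>y\<close> with both force a large product of \<open>x\<close> and \<open>z\<close>.\<close>

lemma gp_four_point:
  "\<lbrakk>x \<in> carrier G; y \<in> carrier G; z \<in> carrier G\<rbrakk> \<Longrightarrow> gp x y \<le> gp x z + \<delta> \<or> gp y z \<le> gp x z + \<delta>"
  using four_point[of x y z] by (auto simp: gp_def)

lemma gp_le: "\<lbrakk>x \<in> carrier G; y \<in> carrier G\<rbrakk> \<Longrightarrow> gp x y \<le> 2 * len x"
  using len_mult_le[of x "inv x \<otimes> y"] by (simp add: gp_def)

lemma gp_le': "\<lbrakk>x \<in> carrier G; y \<in> carrier G\<rbrakk> \<Longrightarrow> gp x y \<le> 2 * len y"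
  using gp_le[of y x] by (simp add: gp_sym)

lemma gp_nonneg: "\<lbrakk>x \<in> carrier G; y \<in> carrier G\<rbrakk> \<Longrightarrow> 0 \<le> gp x y"
  using len_mult_le[of "inv x" y] by (simp add: gp_def)

lemma gp_self: "x \<in> carrier G \<Longrightarrow> gp x x = 2 * len x"
  by (simp add: gp_def)

text \<open>\<open>gp (inv x) y\<close> is the length lost by cancellation in
  \<open>x \<otimes> y\<close>.\<close>

lemma len_mult: "\<lbrakk>x \<in> carrier G; y \<in> carrier G\<rbrakk> \<Longrightarrow> len (x \<otimes> y) = len x + len y - gp (inv x) y"
  by (simp add: gp_def)

text \<open>As \<open>gp x _\<close> never exceeds \<open>2 * len x\<close>, this says that
  \<open>x \<otimes> y\<close> follows \<open>x\<close> except for what cancels between the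
  factors.\<close>

lemma gp_prefix: "\<lbrakk>x \<in> carrier G; y \<in> carrier G\<rbrakk> \<Longrightarrow> gp x (x \<otimes> y) = 2 * len x - gp (inv x) y"
  by (simp add: gp_def)

lemma gp_translate:
  "\<lbrakk>x \<in> carrier G; a \<in> carrier G; b \<in> carrier G\<rbrakk> \<Longrightarrow>
    gp (x \<otimes> a) (x \<otimes> b) = 2 * len x - gp (inv x) a - gp (inv x) b + gp a b"
  by (simp add: gp_def inv_mult_group m_assoc)

lemma len_translate_ge:
  "\<lbrakk>q \<in> carrier G; a \<in> carrier G\<rbrakk> \<Longrightarrow> len a - len q \<le> len (q \<otimes> a)"
  using len_mult_le[of "inv q" "q \<otimes> a"] by simp

lemma len_mult_right_ge:
  "\<lbrakk>q \<in> carrier G; a \<in> carrier G\<rbrakk> \<Longrightarrow> len a - len q \<le> len (a \<otimes> q)"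
  using len_mult_le[of "a \<otimes> q" "inv q"] by (simp add: m_assoc)

lemma gp_translate_le:
  "\<lbrakk>q \<in> carrier G; a \<in> carrier G; b \<in> carrier G\<rbrakk> \<Longrightarrow> gp (q \<otimes> a) (q \<otimes> b) \<le> gp a b + 2 * len q"
  using gp_nonneg[of "inv q" a] gp_nonneg[of "inv q" b] by (simp add: gp_translate)

lemma gp_translate_ge:
  "\<lbrakk>q \<in> carrier G; a \<in> carrier G; b \<in> carrier G\<rbrakk> \<Longrightarrow> gp a b - 2 * len q \<le> gp (q \<otimes> a) (q \<otimes> b)"
  using gp_le[of "inv q" a] gp_le[of "inv q" b] by (simp add: gp_translate)

lemma gp_mult_right_le:
  assumes "a \<in> carrier G" "b \<in> carrier G" "g \<in> carrier G" "h \<in> carrier G"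
  shows "gp (a \<otimes> g) (b \<otimes> h) \<le> gp a b + 2 * len g + 2 * len h"
proof -
  have "len (inv a \<otimes> b) \<le> len g + len (inv g \<otimes> (inv a \<otimes> (b \<otimes> h))) + len h"
    using len_mult_le[of g "inv g \<otimes> (inv a \<otimes> (b \<otimes> h))"] len_mult_le[of "inv a \<otimes> (b \<otimes> h)" "inv h"] assms
    by (simp add: m_assoc)
  then show ?thesis using len_mult_le[of a g] len_mult_le[of b h] assms
    by (simp add: gp_def inv_mult_group m_assoc)
qed

subsection \<open>Centralizers\<close>

lemma powers_leave_balls:
  assumes t: "t \<in> carrier G" and inj: "inj (\<lambda>n::nat. t [^] n)"
  shows "\<exists>n::nat. r < len (t [^] n)"
proof (rule ccontr)
  assume "\<not> ?thesis"
  then have "range (\<lambda>n::nat. t [^] n) \<subseteq> {x \<in> carrier G. len x \<le> r}" using t by (auto simp: not_less)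
  then have "finite (range (\<lambda>n::nat. t [^] n))" using finite_len_ball by (rule finite_subset)
  then show False using inj finite_imageD by (metis infinite_UNIV_nat)
qed

text \<open>
  An element \<open>z\<close> commuting with \<open>y\<close> maps a geodesic from \<open>1\<close> to \<open>y\<close> to one with nearby endpoints; so
  it maps the middle of the geodesic close to the geodesic.
\<close>

lemma commuting_moves_along_geodesic:
  assumes c: "y \<in> carrier G" "m \<in> carrier G" "z \<in> carrier G" and comm: "y \<otimes> z = z \<otimes> y"
    and m: "len (inv m \<otimes> y) = len y - len m"
    and far: "len z + \<delta> < len m" "len z + \<delta> < len y - len m"
  shows "2 * len (z \<otimes> m) - 2 * \<delta> \<le> gp (z \<otimes> m) y"
proof -
  \<comment> \<open>Translates by \<open>inv m\<close> of \<open>\<one>\<close>,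
    \<open>inv z\<close>, \<open>inv z \<otimes> y\<close> and \<open>y\<close>. Seen from
    \<open>m\<close>, the first and the last point lie in opposite directions, while the neighbours
    at either end are close compared with their distance from \<open>m\<close>. Hence the middle two
    lie in opposite directions as well.\<close>
  let ?a = "inv m" and ?b = "inv m \<otimes> inv z" and ?c = "inv m \<otimes> (inv z \<otimes> y)" and ?d = "inv m \<otimes> y"
  have comm': "inv y \<otimes> (z \<otimes> y) = z" using comm c by (metis inv_cancel_left(1))
  have lz: "len (z \<otimes> m) \<ge> len m - len z" using len_translate_ge[of z m] c by simp
  have "len (inv m \<otimes> inv z) = len (z \<otimes> m)" using c len_inv[of "z \<otimes> m"] by (simp add: inv_mult_group)
  then have ab: "gp ?a ?b \<ge> 2 * len m - 2 * len z" using c lz by (simp add: gp_def)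
  have "?c = inv m \<otimes> (y \<otimes> inv z)"
    using comm c by (metis inv_closed inv_comm inv_solve_left inv_solve_right m_assoc m_closed)
  then have "?c = ?d \<otimes> inv z" using c by (simp add: m_assoc)
  then have "len ?c \<ge> len ?d - len z" using len_mult_right_ge[of "inv z" ?d] c by simp
  moreover have "inv ?c \<otimes> ?d = z" using c comm' by (simp add: inv_mult_group m_assoc)
  ultimately have cd: "gp ?c ?d \<ge> 2 * (len y - len m) - 2 * len z" using m by (simp add: gp_def)
  have ad: "gp ?a ?d = 0" using m c by (simp add: gp_def)
  have bc: "gp ?b ?c = len (z \<otimes> m) + len ?c - len y"
    using c \<open>len (inv m \<otimes> inv z) = len (z \<otimes> m)\<close> by (simp add: gp_def inv_mult_group m_assoc)
  have "gp ?a ?b \<le> \<delta> \<or> gp ?b ?d \<le> \<delta>" using gp_four_point[of ?a ?b ?d] c ad by simp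
  then have "gp ?b ?d \<le> \<delta>" using ab far(1) delta_nonneg by linarith
  moreover have "gp ?b ?c \<le> gp ?b ?d + \<delta> \<or> gp ?c ?d \<le> gp ?b ?d + \<delta>" using gp_four_point[of ?b ?c ?d] c by simp
  ultimately have "gp ?b ?c \<le> 2 * \<delta>" using cd far(2) by auto
  then show ?thesis using bc c by (simp add: gp_def inv_mult_group m_assoc)
qed

text \<open>Each counted \<open>z\<close> moves one chosen point \<open>m\<close>, on a geodesic to
  a long power of \<open>t\<close>, to a point near that geodesic. The length of
  \<open>z \<otimes> m\<close> takes at most \<open>2 * W + 1\<close> values, and two points near a
  geodesic at equal distance from \<open>\<one>\<close> are at most \<open>3 * \<delta>\<close>
  apart.\<close>

lemma centralizer_linear_growth:
  assumes t: "t \<in> carrier G" and inj: "inj (\<lambda>n::nat. t [^] n)" and W: "0 \<le> W"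
  shows "int (card {z \<in> carrier G. t \<otimes> z = z \<otimes> t \<and> len z \<le> W})
    \<le> (2 * W + 1) * int (card {x \<in> carrier G. len x \<le> 3 * \<delta>})"
proof -
  \<comment> \<open>Long enough for the point \<open>m\<close> at distance
    \<open>W + \<delta> + 1\<close> to be farther than \<open>W + \<delta>\<close> from both
    ends.\<close>
  obtain n :: nat where n: "2 * W + 2 * \<delta> + 2 < len (t [^] n)" using powers_leave_balls[OF t inj] by blast
  define y where "y = t [^] n"
  have y: "y \<in> carrier G" "2 * W + 2 * \<delta> + 2 < len y" using t n by (simp_all add: y_def)
  have "0 \<le> W + \<delta> + 1" "W + \<delta> + 1 \<le> len y" using W delta_nonneg y(2) by simp_all
  from geodesic_point[OF y(1) this] obtain m where m: "m \<in> carrier G" "len m = W + \<delta> + 1"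
    "len (inv m \<otimes> y) = len y - (W + \<delta> + 1)" by blast
  define A where "A = {z \<in> carrier G. t \<otimes> z = z \<otimes> t \<and> len z \<le> W}"
  define B where "B = {x \<in> carrier G. len x \<le> 3 * \<delta>}"
  have finB: "finite B" unfolding B_def by (rule finite_len_ball)
  have finA: "finite A" unfolding A_def using finite_len_ball[of W] by (rule rev_finite_subset) auto
  have near: "2 * len (z \<otimes> m) - 2 * \<delta> \<le> gp (z \<otimes> m) y" if "z \<in> A" for z
  proof (rule commuting_moves_along_geodesic)
    have "z \<otimes> t = t \<otimes> z" "z \<in> carrier G" using that by (auto simp: A_def)
    then have "z \<otimes> t [^] n = t [^] n \<otimes> z" using t by (metis pow_mult_distrib group_commutes_pow)
    then show "y \<otimes> z = z \<otimes> y" by (simp add: y_def)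
  qed (use that y m delta_nonneg in \<open>auto simp: A_def\<close>)
  define lev where "lev i = {z \<in> A. len (z \<otimes> m) = i}" for i
  have card_lev: "card (lev i) \<le> card B" for i
  proof (cases "lev i = {}")
    case False
    then obtain z where z: "z \<in> lev i" by blast
    have zG: "z \<in> carrier G" using z by (auto simp: lev_def A_def)
    have "(\<lambda>w. inv (z \<otimes> m) \<otimes> (w \<otimes> m)) ` lev i \<subseteq> B"
    proof
      fix x assume "x \<in> (\<lambda>w. inv (z \<otimes> m) \<otimes> (w \<otimes> m)) ` lev i"
      then obtain w where w: "w \<in> lev i" "x = inv (z \<otimes> m) \<otimes> (w \<otimes> m)" by blast
      have wG: "w \<in> carrier G" using w by (auto simp: lev_def A_def)
      have "2 * i - 2 * \<delta> \<le> gp (z \<otimes> m) y" "2 * i - 2 * \<delta> \<le> gp (w \<otimes> m) y"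
        using near[of z] near[of w] z w by (simp_all add: lev_def)
      \<comment> \<open>Each product falls short of its maximum \<open>2 * i\<close> by at most
        \<open>2 * \<delta>\<close>, and the four-point inequality costs one more
        \<open>\<delta>\<close>.\<close>
      then have "2 * i - 3 * \<delta> \<le> gp (z \<otimes> m) (w \<otimes> m)"
        using gp_four_point[of "z \<otimes> m" y "w \<otimes> m"] gp_sym[of "w \<otimes> m" y] zG wG m(1) y(1) by auto
      moreover have "len (z \<otimes> m) = i" "len (w \<otimes> m) = i" using z w by (auto simp: lev_def)
      ultimately show "x \<in> B" using w(2) zG wG m(1) by (simp add: gp_def B_def)
    qed
    moreover have "inj_on (\<lambda>w. inv (z \<otimes> m) \<otimes> (w \<otimes> m)) (lev i)"
      using zG m(1) by (auto simp: inj_on_def lev_def A_def)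
    ultimately show ?thesis using finB by (meson card_inj_on_le)
  qed auto
  have "A \<subseteq> (\<Union>i\<in>{len m - W..len m + W}. lev i)"
  proof
    fix z assume z: "z \<in> A"
    then have "z \<in> carrier G" "len z \<le> W" by (auto simp: A_def)
    then have "len (z \<otimes> m) \<in> {len m - W..len m + W}"
      using len_mult_le[of z m] len_translate_ge[of z m] m(1) by auto
    then show "z \<in> (\<Union>i\<in>{len m - W..len m + W}. lev i)" using z by (auto simp: lev_def)
  qed
  moreover have "finite (lev i)" for i using finA by (simp add: lev_def)
  ultimately have "card A \<le> card (\<Union>i\<in>{len m - W..len m + W}. lev i)" by (intro card_mono) auto
  also have "\<dots> \<le> (\<Sum>i\<in>{len m - W..len m + W}. card (lev i))" by (rule card_UN_le) simp
  also have "\<dots> \<le> (\<Sum>i\<in>{len m - W..len m + W}. card B)" by (intro sum_mono card_lev)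
  also have "\<dots> = nat (2 * W + 1) * card B" by (simp add: algebra_simps)
  finally have "int (card A) \<le> int (nat (2 * W + 1) * card B)" by linarith
  then show ?thesis using W by (simp add: A_def B_def)
qed

end

definition (in group) centralizer :: "'a \<Rightarrow> 'a set" where
  "centralizer t = {z \<in> carrier G. t \<otimes> z = z \<otimes> t}"

lemma (in group) subgroup_centralizer:
  assumes t: "t \<in> carrier G"
  shows "subgroup (centralizer t) G"
proof (rule subgroupI)
  fix a b assume "a \<in> centralizer t" "b \<in> centralizer t"
  then have ab: "a \<in> carrier G" "b \<in> carrier G" "t \<otimes> a = a \<otimes> t" "t \<otimes> b = b \<otimes> t"
    by (auto simp: centralizer_def)
  have "t \<otimes> (a \<otimes> b) = a \<otimes> (t \<otimes> b)" using t ab by (metis m_assoc)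
  then show "a \<otimes> b \<in> centralizer t" using t ab by (simp add: centralizer_def m_assoc)
  have "t \<otimes> inv a = inv a \<otimes> (a \<otimes> t) \<otimes> inv a" using t ab by (simp add: m_assoc)
  also have "\<dots> = inv a \<otimes> (t \<otimes> a) \<otimes> inv a" using ab(3) by simp
  also have "\<dots> = inv a \<otimes> t" using t ab(1) by (simp add: m_assoc)
  finally show "inv a \<in> centralizer t" using ab(1) by (simp add: centralizer_def)
qed (use t in \<open>auto simp: centralizer_def\<close>)

section \<open>Infinite index of centralizers\<close>

locale torsion_free_nonelementary = hyperbolic_length +
  assumes torsion_free: "torsion_free_group G" and nonelementary: "\<not> elementary_group G"
begin

lemma infinite_carrier: "infinite (carrier G)"
  using nonelementary by (simp add: elementary_group_def)

lemma inj_powers: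
  assumes t: "t \<in> carrier G" "t \<noteq> \<one>"
  shows "inj (\<lambda>n::nat. t [^] n)"
proof -
  have *: "t [^] i \<noteq> t [^] j" if "i < j" for i j :: nat
  proof
    assume eq: "t [^] i = t [^] j"
    have "t [^] j = t [^] i \<otimes> t [^] (j - i)" using that t by (simp add: nat_pow_mult)
    then have "t [^] i = t [^] i \<otimes> t [^] (j - i)" using eq by simp
    then have "t [^] (j - i) = \<one>" using t(1) l_cancel_one' by simp
    moreover have "0 < j - i" using that by simp
    ultimately show False using torsion_free t unfolding torsion_free_group_def by blast
  qed
  show ?thesis
  proof (rule injI)
    fix i j :: nat assume "t [^] i = t [^] j"
    then show "i = j" using *[of i j] *[of j i] by (metis linorder_neqE_nat)
  qed
qed

text \<open>Representatives of different cosets times powers of \<open>t\<close> are distinct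
  elements of the centralizer, \<open>card Z\<close> of them per power. As one more power adds at
  most \<open>len t\<close> to the length, linear growth allows only about
  \<open>2 * len t * N\<close> per power.\<close>

lemma finitely_many_cosets_in_centralizer:
  assumes t: "t \<in> carrier G" "t \<noteq> \<one>"
  shows "finite ((\<lambda>z. generate G {t} #> z) ` centralizer t)"
proof (rule ccontr)
  define H where "H = generate G {t}"
  define N where "N = int (card {x \<in> carrier G. len x \<le> 3 * \<delta>})"
  have H: "subgroup H G" using t by (simp add: H_def generate_is_subgroup)
  have pow_H: "inv (t [^] i) \<otimes> t [^] j \<in> H" for i j :: nat
  proof -
    have "t [^] k \<in> H" for k :: nat
      using generate_pow[OF t(1)] int_pow_int[of G t k] by (auto simp: H_def) (metis int_pow_int)
    then show ?thesis using H by (simp add: subgroup.m_closed subgroup.m_inv_closed)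
  qed
  assume "\<not> ?thesis"
  then obtain D where D: "D \<subseteq> (\<lambda>z. H #> z) ` centralizer t" "card D = nat (2 * len t * N + 1)" "finite D"
    unfolding H_def by (meson infinite_arbitrarily_large)
  then obtain Z where Z: "Z \<subseteq> centralizer t" "inj_on (\<lambda>z. H #> z) Z" "D = (\<lambda>z. H #> z) ` Z"
    by (auto simp: subset_image_inj)
  have finZ: "finite Z" using D(3) Z finite_imageD by blast
  have cardZ: "card Z = nat (2 * len t * N + 1)" using D(2) Z by (simp add: card_image)
  have ZG: "z \<in> carrier G" "t \<otimes> z = z \<otimes> t" if "z \<in> Z" for z using Z(1) that by (auto simp: centralizer_def)
  have N0: "0 \<le> N" by (simp add: N_def)
  have lt: "0 \<le> len t" using len_nonneg t(1) .
  define b where "b = (\<Sum>z\<in>Z. len z)"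
  have b: "len z \<le> b" if "z \<in> Z" for z
    unfolding b_def using that finZ ZG len_nonneg by (intro member_le_sum) auto
  have b0: "0 \<le> b" unfolding b_def using ZG len_nonneg by (intro sum_nonneg) auto
  \<comment> \<open>With this many powers the share \<open>(2 * b + 1) * N\<close> of the
    representatives in the bound is just \<open>int J\<close>, and
    \<open>card Z = 2 * len t * N + 1\<close> exceeds what the bound admits.\<close>
  define J where "J = nat ((2 * b + 1) * N)"
  have J: "int J = (2 * b + 1) * N" using b0 N0 by (simp add: J_def)
  define W where "W = b + int J * len t"
  have W0: "0 \<le> W" using b0 lt by (simp add: W_def)
  have len_pow: "len (t [^] n) \<le> int n * len t" for n :: nat
  proof (induction n)
    case (Suc n)
    then show ?case using len_mult_le[of "t [^] n" t] t by (simp add: algebra_simps)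
  qed simp
  have comm: "t [^] n \<otimes> z = z \<otimes> t [^] n" if "z \<in> Z" for z and n :: nat
    using ZG[OF that] t(1) by (metis group_commutes_pow)
  have "z \<otimes> t [^] n \<in> {z \<in> carrier G. t \<otimes> z = z \<otimes> t \<and> len z \<le> W}"
    if z: "z \<in> Z" and n: "n \<in> {..J}" for z n
  proof (intro CollectI conjI)
    show "z \<otimes> t [^] n \<in> carrier G" using ZG[OF z] t by simp
    have "t \<otimes> (z \<otimes> t [^] n) = z \<otimes> (t \<otimes> t [^] n)" using ZG[OF z] t(1) by (metis m_assoc nat_pow_closed)
    also have "t \<otimes> t [^] n = t [^] n \<otimes> t" using t by (metis nat_pow_Suc nat_pow_Suc2)
    finally show "t \<otimes> (z \<otimes> t [^] n) = z \<otimes> t [^] n \<otimes> t" using ZG[OF z] t by (simp add: m_assoc)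
    have "int n * len t \<le> int J * len t" using n lt by (simp add: mult_right_mono)
    then show "len (z \<otimes> t [^] n) \<le> W"
      using len_mult_le[of z "t [^] n"] ZG[OF z] t(1) b[OF z] len_pow[of n] by (simp add: W_def)
  qed
  then have "(\<lambda>(z, n). z \<otimes> t [^] n) ` (Z \<times> {..J}) \<subseteq> {z \<in> carrier G. t \<otimes> z = z \<otimes> t \<and> len z \<le> W}"
    by auto
  moreover have "inj_on (\<lambda>(z, n). z \<otimes> t [^] n) (Z \<times> {..J})"
  proof (rule inj_onI, clarify)
    fix z i w j assume z: "z \<in> Z" and w: "w \<in> Z" and eq: "z \<otimes> t [^] (i::nat) = w \<otimes> t [^] (j::nat)"
    have "t [^] i \<otimes> z = t [^] j \<otimes> w" using eq comm[OF z] comm[OF w] by simp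
    then have "z = (inv (t [^] i) \<otimes> t [^] j) \<otimes> w"
      using ZG[OF z] ZG[OF w] t by (metis inv_cancel_left(1) inv_closed m_assoc nat_pow_closed)
    then have "z \<in> H #> w" using pow_H by (auto simp: r_coset_def)
    then have "H #> z = H #> w" using repr_independence[OF _ _ H, of z w] ZG[OF w] by simp
    then have "z = w" using Z(2) z w by (auto dest: inj_onD)
    moreover then have "t [^] i = t [^] j" using eq ZG[OF w] t(1) by simp
    ultimately show "z = w \<and> i = j" using inj_powers[OF t] by (auto dest: injD)
  qed
  ultimately have "card (Z \<times> {..J}) \<le> card {z \<in> carrier G. t \<otimes> z = z \<otimes> t \<and> len z \<le> W}"
    by (intro card_inj_on_le) (auto intro: rev_finite_subset[OF finite_len_ball[of W]])
  then have "int (card Z * Suc J) \<le> int (card {z \<in> carrier G. t \<otimes> z = z \<otimes> t \<and> len z \<le> W})"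
    by (simp only: card_cartesian_product card_atMost of_nat_le_iff)
  also have "\<dots> \<le> (2 * W + 1) * N"
    unfolding N_def by (rule centralizer_linear_growth[OF t(1) inj_powers[OF t] W0])
  also have "int (card Z * Suc J) = (2 * len t * N + 1) * (int J + 1)" using cardZ lt N0 by (simp add: algebra_simps)
  also have "(2 * W + 1) * N = int J + 2 * (int J * (len t * N))" by (simp add: W_def J algebra_simps)
  finally have "1 + 2 * (len t * N) \<le> 0" by (simp add: algebra_simps)
  then show False using mult_nonneg_nonneg[OF lt N0] by linarith
qed

text \<open>Finitely many cosets of the powers of \<open>t\<close> in the centralizer, and finitely
  many of the centralizer in the group, would give an infinite cyclic subgroup of finite
  index.\<close>

lemma centralizer_infinite_index:
  assumes t: "t \<in> carrier G" "t \<noteq> \<one>" and F: "finite F" "F \<subseteq> carrier G"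
  shows "\<not> carrier G \<subseteq> (\<Union>f\<in>F. centralizer t #> f)"
proof
  assume cover: "carrier G \<subseteq> (\<Union>f\<in>F. centralizer t #> f)"
  let ?H = "generate G {t}"
  have H: "subgroup ?H G" using t by (simp add: generate_is_subgroup)
  note HG = subgroup.subset[OF H]
  have "rcosets ?H \<subseteq> (\<lambda>(C, f). C #> f) ` ((\<lambda>z. ?H #> z) ` centralizer t \<times> F)"
  proof
    fix K assume "K \<in> rcosets ?H"
    then obtain a where a: "a \<in> carrier G" "K = ?H #> a" by (auto simp: RCOSETS_def)
    then obtain f z where z: "f \<in> F" "z \<in> centralizer t" "a = z \<otimes> f"
      using cover by (auto simp: r_coset_def)
    then have "K = (?H #> z) #> f" using a(2) HG F(2)
      by (simp add: coset_mult_assoc centralizer_def subset_eq)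
    then show "K \<in> (\<lambda>(C, f). C #> f) ` ((\<lambda>z. ?H #> z) ` centralizer t \<times> F)" using z by force
  qed
  then have 1: "finite (rcosets ?H)"
    using finitely_many_cosets_in_centralizer[OF t] F(1) by (meson finite_SigmaI finite_imageI finite_subset)
  have "t [^] n \<in> ?H" for n :: nat
    using generate_pow[OF t(1)] by (auto) (metis int_pow_int)
  then have "range (\<lambda>n::nat. t [^] n) \<subseteq> ?H" by auto
  then have 2: "infinite ?H"
    using inj_powers[OF t] by (meson finite_imageD finite_subset infinite_UNIV_nat)
  have "subgroup_generated G {t} = G\<lparr>carrier := ?H\<rparr>"
    using t(1) by (simp add: subgroup_generated_def)
  then have 3: "cyclic_group (G\<lparr>carrier := ?H\<rparr>)" using cyclic_group_generated[of t] by simp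
  have "elementary_group G"
    unfolding elementary_group_def by (intro disjI2 exI[of _ ?H] conjI H 1 2 3)
  with nonelementary show False ..
qed

text \<open>The solutions \<open>y\<close> of \<open>inv y \<otimes> (t \<otimes> y) = v\<close> lie
  in a single coset of the centralizer of \<open>t\<close>. With \<open>t\<close> in
  \<open>T\<close> and \<open>v\<close> in a finite ball there are finitely many such cosets, and by
  Neumann's lemma they cannot cover the group.\<close>

lemma conjugates_leave_balls:
  assumes T: "finite T" "T \<subseteq> carrier G - {\<one>}"
  shows "\<exists>y\<in>carrier G. \<forall>t\<in>T. K < len (inv y \<otimes> (t \<otimes> y))"
proof (rule ccontr)
  assume contr: "\<not> ?thesis"
  define B where "B = {x \<in> carrier G. len x \<le> K}"
  \<comment> \<open>One chosen solution per pair; for pairs without solution the value is arbitrary,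
    hence the intersection with the carrier in \<open>F\<close>.\<close>
  define k where "k = (\<lambda>(t, v). SOME k. k \<in> carrier G \<and> inv k \<otimes> (t \<otimes> k) = v)"
  define F where "F = k ` (T \<times> B) \<inter> carrier G"
  have F: "finite F" "F \<subseteq> carrier G"
    using T(1) finite_len_ball[of K] by (auto simp: F_def B_def)
  have "carrier G \<subseteq> (\<Union>H\<in>centralizer ` T. \<Union>f\<in>F. H #> f)"
  proof
    fix y assume y: "y \<in> carrier G"
    then obtain t where t: "t \<in> T" "len (inv y \<otimes> (t \<otimes> y)) \<le> K" using contr by (auto simp: not_less)
    have tG: "t \<in> carrier G" using t T by auto
    define v where "v = inv y \<otimes> (t \<otimes> y)"
    have v: "v \<in> B" using t tG y by (simp add: v_def B_def)
    have "\<exists>k. k \<in> carrier G \<and> inv k \<otimes> (t \<otimes> k) = v" using y v_def by blast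
    from someI_ex[OF this] have k: "k (t, v) \<in> carrier G" "inv (k (t, v)) \<otimes> (t \<otimes> k (t, v)) = v"
      by (simp_all add: k_def)
    then have kF: "k (t, v) \<in> F" using t v by (auto simp: F_def)
    let ?k = "k (t, v)"
    have "t \<otimes> (y \<otimes> inv ?k) = y \<otimes> (v \<otimes> inv ?k)" using y tG k(1) by (simp add: v_def m_assoc)
    also have "\<dots> = y \<otimes> ((inv ?k \<otimes> (t \<otimes> ?k)) \<otimes> inv ?k)" using k(2) by simp
    also have "\<dots> = y \<otimes> inv ?k \<otimes> t" using y tG k(1) by (simp add: m_assoc)
    finally have "y \<otimes> inv ?k \<in> centralizer t" using y k(1) by (simp add: centralizer_def)
    moreover have "y = (y \<otimes> inv ?k) \<otimes> ?k" using y k(1) by (simp add: m_assoc)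
    ultimately have "y \<in> centralizer t #> ?k" unfolding r_coset_def by blast
    then show "y \<in> (\<Union>H\<in>centralizer ` T. \<Union>f\<in>F. H #> f)" using t kF by blast
  qed
  moreover have "subgroup H G" if "H \<in> centralizer ` T" for H
    using that T subgroup_centralizer by auto
  ultimately obtain t F' where "t \<in> T" "finite F'" "F' \<subseteq> carrier G"
    "carrier G \<subseteq> (\<Union>f\<in>F'. centralizer t #> f)"
    using finite_index_of_coset_cover[of "centralizer ` T" F] T(1) F by auto
  then show False using centralizer_infinite_index[of t F'] T by auto
qed

end

section \<open>Generic elements\<close>

context torsion_free_nonelementary
begin

text \<open>If \<open>inv y0 \<otimes> (t \<otimes> y0)\<close> is long, then \<open>y0\<close> and
  \<open>t \<otimes> y0\<close> have split up before their ends, and so have all their extensions.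
  The bound \<open>E\<close> depends on \<open>y0\<close> and \<open>Q\<close> only; the extensions
  can thus be chosen afterwards, much longer than \<open>E\<close>.\<close>

lemma diverging_translates:
  assumes Q: "finite Q" "Q \<subseteq> carrier G"
  shows "\<exists>y0\<in>carrier G. \<exists>E\<ge>0. \<forall>y\<in>carrier G. \<forall>y'\<in>carrier G.
    2 * len y0 - 2 * \<delta> \<le> gp y0 y \<longrightarrow> 2 * len y0 - 2 * \<delta> \<le> gp y0 y' \<longrightarrow>
    (\<forall>q\<in>Q. \<forall>q'\<in>Q. q \<noteq> q' \<longrightarrow> gp (q \<otimes> y) (q' \<otimes> y') \<le> E)"
proof -
  define T where "T = (\<lambda>(q, q'). inv q \<otimes> q') ` {(q, q') \<in> Q \<times> Q. q \<noteq> q'}"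
  define M where "M = (\<Sum>q\<in>Q. len q)"
  have M: "len q \<le> M" if "q \<in> Q" for q
    unfolding M_def using that Q len_nonneg by (intro member_le_sum) auto
  have M0: "0 \<le> M" unfolding M_def using Q len_nonneg by (intro sum_nonneg) auto
  have "finite {(q, q') \<in> Q \<times> Q. q \<noteq> q'}" using Q(1) by (rule_tac finite_subset[of _ "Q \<times> Q"]) auto
  then have T: "finite T" "T \<subseteq> carrier G - {\<one>}"
    using Q(2) by (auto simp: T_def subset_eq dest: inv_unique' inv_equality)
  \<comment> \<open>The conditions on \<open>y\<close> and \<open>y'\<close> are slack by
    \<open>2 * \<delta>\<close> and two four-point steps add as much; the shift by \<open>t\<close>
    costs \<open>3 * len t\<close>, and \<open>len t \<le> 2 * M\<close>.\<close>
  obtain y0 where y0: "y0 \<in> carrier G" "\<forall>t\<in>T. 4 * \<delta> + 6 * M < len (inv y0 \<otimes> (t \<otimes> y0))"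
    using conjugates_leave_balls[OF T] by blast
  have "gp (q \<otimes> y) (q' \<otimes> y') \<le> 2 * len y0 + 2 * M"
    if y: "y \<in> carrier G" "2 * len y0 - 2 * \<delta> \<le> gp y0 y"
      and y': "y' \<in> carrier G" "2 * len y0 - 2 * \<delta> \<le> gp y0 y'"
      and q: "q \<in> Q" "q' \<in> Q" "q \<noteq> q'" for y y' q q'
  proof -
    have qG: "q \<in> carrier G" "q' \<in> carrier G" using q Q by auto
    define t where "t = inv q \<otimes> q'"
    have t: "t \<in> T" "t \<in> carrier G" using q qG by (auto simp: t_def T_def)
    have lt: "len t \<le> 2 * M" using len_mult_le[of "inv q" q'] M[OF q(1)] M[OF q(2)] qG by (simp add: t_def)
    have "gp y (t \<otimes> y') \<le> 2 * len y0"
    proof (rule ccontr)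
      assume far: "\<not> ?thesis"
      have "2 * len y0 - 2 * \<delta> - 2 * len t \<le> gp (t \<otimes> y') (t \<otimes> y0)"
        using gp_translate_ge[of t y' y0] y' y0(1) t(2) gp_sym[of y0 y'] by simp
      moreover have "gp y (t \<otimes> y') \<le> gp y (t \<otimes> y0) + \<delta> \<or> gp (t \<otimes> y') (t \<otimes> y0) \<le> gp y (t \<otimes> y0) + \<delta>"
        using gp_four_point[of y "t \<otimes> y'" "t \<otimes> y0"] y y' y0(1) t(2) by simp
      moreover have "gp y0 y \<le> gp y0 (t \<otimes> y0) + \<delta> \<or> gp y (t \<otimes> y0) \<le> gp y0 (t \<otimes> y0) + \<delta>"
        using gp_four_point[of y0 y "t \<otimes> y0"] y y0(1) t(2) by simp
      ultimately have "2 * len y0 - 4 * \<delta> - 2 * len t \<le> gp y0 (t \<otimes> y0)"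
        using far y(2) y'(2) delta_nonneg len_nonneg[OF t(2)] by auto
      then have "len (inv y0 \<otimes> (t \<otimes> y0)) \<le> 4 * \<delta> + 3 * len t"
        using len_mult_le[of t y0] t(2) y0(1) by (simp add: gp_def)
      then show False using y0(2) t(1) lt by force
    qed
    moreover have "q' \<otimes> y' = q \<otimes> (t \<otimes> y')" using qG y' by (simp add: t_def m_assoc)
    ultimately show ?thesis
      using gp_translate_le[of q y "t \<otimes> y'"] M[OF q(1)] qG y y' t(2) by simp
  qed
  moreover have "0 \<le> 2 * len y0 + 2 * M" using M0 len_nonneg[OF y0(1)] by simp
  ultimately show ?thesis using y0(1) by blast
qed

text \<open>Otherwise the centralizer of \<open>w\<close> would contain all generators and have
  index one.\<close>

lemma nontrivial_commutator_with_generator: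
  assumes w: "w \<in> carrier G" "w \<noteq> \<one>"
  shows "\<exists>x\<in>X. w \<otimes> x \<noteq> x \<otimes> w"
proof (rule ccontr)
  assume "\<not> ?thesis"
  then have "X \<subseteq> centralizer w" using gens(1) by (auto simp: centralizer_def)
  then have "carrier G \<subseteq> centralizer w"
    using generate_subgroup_incl[OF _ subgroup_centralizer[OF w(1)], of X] gens(2) by simp
  moreover have "centralizer w \<subseteq> carrier G" by (auto simp: centralizer_def)
  ultimately have "carrier G \<subseteq> (\<Union>f\<in>{\<one>}. centralizer w #> f)" by simp
  then show False using centralizer_infinite_index[OF w, of "{\<one>}"] by simp
qed

lemma gens_bound: "\<exists>M\<ge>0. \<forall>x\<in>X. len x \<le> M"
proof (intro exI conjI ballI)
  show "0 \<le> (\<Sum>x\<in>X. len x)" using gens(1) len_nonneg by (intro sum_nonneg) auto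
  fix x assume "x \<in> X"
  then show "len x \<le> (\<Sum>x\<in>X. len x)" using finite_gens gens(1) len_nonneg by (intro member_le_sum) auto
qed

text \<open>
  If all generators almost fixed a long initial segment of \<open>y\<close>, two of its points would give the
  same conjugates of the generators, and their quotient would be central.
\<close>

lemma some_generator_moves:
  "\<exists>C\<ge>0. \<forall>y\<in>carrier G. \<exists>x\<in>X. gp y (x \<otimes> y) \<le> C"
proof -
  obtain M where M: "0 \<le> M" "\<And>x. x \<in> X \<Longrightarrow> len x \<le> M" using gens_bound by blast
  define B where "B = {x \<in> carrier G. len x \<le> 3 * M + 2 * \<delta>}"
  \<comment> \<open>The number of ways in which a point can conjugate the generators into the ball;
    the \<open>N + 1\<close> points of a segment of length \<open>N\<close> must repeat one.\<close>
  define N where "N = card (X \<rightarrow>\<^sub>E B)"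
  have finE: "finite (X \<rightarrow>\<^sub>E B)"
    using finite_gens finite_len_ball by (intro finite_PiE) (auto simp: B_def)
  have "\<exists>x\<in>X. gp y (x \<otimes> y) \<le> 2 * int N" if y: "y \<in> carrier G" for y
  proof (rule ccontr)
    assume "\<not> ?thesis"
    then have far: "2 * int N < gp y (x \<otimes> y)" if "x \<in> X" for x using that by force
    \<comment> \<open>Guarantees a generator, whose \<open>far\<close> bound shows that
      \<open>y\<close> has length at least \<open>N\<close>.\<close>
    obtain g where g: "g \<in> carrier G" "g \<noteq> \<one>"
      using infinite_carrier by (metis finite.emptyI finite_insert finite_subset insertCI subsetI)
    obtain x0 where x0: "x0 \<in> X" using nontrivial_commutator_with_generator[OF g] by blast
    have "x0 \<in> carrier G" using x0 gens(1) by blast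
    then have "int N \<le> len y" using far[OF x0] gp_le[of y "x0 \<otimes> y"] y by simp
    then have "\<exists>p\<in>carrier G. len p = int r \<and> len (inv p \<otimes> y) = len y - int r" if "r \<le> N" for r
      using geodesic_point[OF y, of "int r"] that by simp
    then have "\<forall>r\<in>{..N}. \<exists>p. p \<in> carrier G \<and> len p = int r \<and> len (inv p \<otimes> y) = len y - int r"
      by (simp add: Bex_def)
    from bchoice[OF this] obtain p where "\<forall>r\<in>{..N}. p r \<in> carrier G \<and> len (p r) = int r
        \<and> len (inv (p r) \<otimes> y) = len y - int r" by blast
    then have p: "p r \<in> carrier G" "len (p r) = int r" "len (inv (p r) \<otimes> y) = len y - int r"
      if "r \<le> N" for r using that by simp_all
    have conj: "inv (p r) \<otimes> (x \<otimes> p r) \<in> B" if r: "r \<le> N" and x: "x \<in> X" for r x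
    proof -
      note pr = p[OF r]
      have xG: "x \<in> carrier G" using x gens by auto
      have 1: "gp (p r) y = 2 * int r" using pr by (simp add: gp_def)
      have 2: "2 * int r - 2 * len x \<le> gp (x \<otimes> y) (x \<otimes> p r)"
        using gp_translate_ge[of x y "p r"] gp_sym[of y "p r"] 1 xG y pr by simp
      have 3: "gp y (x \<otimes> y) \<le> gp y (x \<otimes> p r) + \<delta> \<or> gp (x \<otimes> y) (x \<otimes> p r) \<le> gp y (x \<otimes> p r) + \<delta>"
        using gp_four_point[of y "x \<otimes> y" "x \<otimes> p r"] y pr xG by simp
      have 4: "gp (p r) y \<le> gp (p r) (x \<otimes> p r) + \<delta> \<or> gp y (x \<otimes> p r) \<le> gp (p r) (x \<otimes> p r) + \<delta>"
        using gp_four_point[of "p r" y "x \<otimes> p r"] y pr xG by simp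
      have "2 * int r - 2 * len x - 2 * \<delta> \<le> gp (p r) (x \<otimes> p r)"
        using 1 2 3 4 far[OF x] r delta_nonneg len_nonneg[OF xG] by auto
      then have "len (inv (p r) \<otimes> (x \<otimes> p r)) \<le> 3 * len x + 2 * \<delta>"
        using len_mult_le[of x "p r"] pr xG by (simp add: gp_def)
      then show ?thesis using M(2)[OF x] pr xG by (simp add: B_def)
    qed
    define f where "f r = (\<lambda>x\<in>X. inv (p r) \<otimes> (x \<otimes> p r))" for r
    have "f ` {..N} \<subseteq> X \<rightarrow>\<^sub>E B" using conj by (auto simp: f_def)
    then have "card (f ` {..N}) \<le> N" unfolding N_def by (rule card_mono[OF finE])
    then have "\<not> inj_on f {..N}" using card_image[of f "{..N}"] by auto
    then obtain r s where rs: "r \<le> N" "s \<le> N" "r \<noteq> s" "f r = f s" by (auto simp: inj_on_def)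
    note pr = p(1)[OF rs(1)] and ps = p(1)[OF rs(2)]
    have "p s \<otimes> inv (p r) \<otimes> x = x \<otimes> (p s \<otimes> inv (p r))" if x: "x \<in> X" for x
    proof -
      have xG: "x \<in> carrier G" using x gens by auto
      have "inv (p r) \<otimes> (x \<otimes> p r) = inv (p s) \<otimes> (x \<otimes> p s)"
        using fun_cong[OF rs(4), of x] x by (simp add: f_def)
      then have "p s \<otimes> ((inv (p r) \<otimes> (x \<otimes> p r)) \<otimes> inv (p r)) = p s \<otimes> ((inv (p s) \<otimes> (x \<otimes> p s)) \<otimes> inv (p r))"
        by simp
      then show ?thesis using pr ps xG by (simp add: m_assoc)
    qed
    then have "p s \<otimes> inv (p r) = \<one>"
      using nontrivial_commutator_with_generator[of "p s \<otimes> inv (p r)"] pr ps by auto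
    then have "p s = p r" using pr ps by (metis inv_equality inv_inv inv_closed)
    then show False using p(2)[OF rs(1)] p(2)[OF rs(2)] rs(3) by simp
  qed
  then show ?thesis by (intro exI[of _ "2 * int N"]) auto
qed

text \<open>Cut a long element \<open>v\<close> at \<open>p\<close>: seen from \<open>p\<close>, its
  two ends \<open>inv p\<close> and \<open>inv p \<otimes> v\<close> lie in opposite directions, so
  \<open>a\<close> can follow only one of them.\<close>

lemma extension:
  assumes a: "a \<in> carrier G" and n: "0 \<le> n"
  shows "\<exists>k\<in>carrier G. n \<le> len k \<and> gp a k \<le> \<delta>"
proof -
  have "\<not> carrier G \<subseteq> {x \<in> carrier G. len x \<le> 2 * n}"
    using infinite_carrier finite_len_ball finite_subset by blast
  then obtain v where v: "v \<in> carrier G" "2 * n < len v" by (metis (mono_tags, lifting) linorder_not_le mem_Collect_eq subsetI)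
  then obtain p where p: "p \<in> carrier G" "len p = n" "len (inv p \<otimes> v) = len v - n"
    using geodesic_point[OF v(1) n] n by auto
  have "gp (inv p) (inv p \<otimes> v) = 0" using p v by (simp add: gp_def)
  then have "gp (inv p) a \<le> \<delta> \<or> gp a (inv p \<otimes> v) \<le> \<delta>"
    using gp_four_point[of "inv p" a "inv p \<otimes> v"] p(1) v(1) a by simp
  then show ?thesis
  proof
    assume "gp (inv p) a \<le> \<delta>"
    then show ?thesis using p a gp_sym[of a "inv p"] by (intro bexI[of _ "inv p"]) auto
  next
    assume "gp a (inv p \<otimes> v) \<le> \<delta>"
    then show ?thesis using p v by (intro bexI[of _ "inv p \<otimes> v"]) auto
  qed
qed

text \<open>A conjugate \<open>k x k\<inverse>\<close> of a generator starts and ends along \<open>k\<close>.\<close>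

lemma symmetric_extension:
  assumes a: "a \<in> carrier G" and n: "0 \<le> n"
  shows "\<exists>m\<in>carrier G. n \<le> len m \<and> gp a m \<le> 2 * \<delta> \<and> gp a (inv m) \<le> 2 * \<delta>"
proof -
  obtain M where M: "0 \<le> M" "\<And>x. x \<in> X \<Longrightarrow> len x \<le> M" using gens_bound by blast
  obtain C where C: "0 \<le> C" "\<And>y. y \<in> carrier G \<Longrightarrow> \<exists>x\<in>X. gp y (x \<otimes> y) \<le> C"
    using some_generator_moves by blast
  have "0 \<le> n + C + 2 * M + 2 * \<delta> + 1" using n C(1) M(1) delta_nonneg by simp
  from extension[OF a this] obtain k where k: "k \<in> carrier G" "n + C + 2 * M + 2 * \<delta> + 1 \<le> len k" "gp a k \<le> \<delta>"
    by blast
  \<comment> \<open>\<open>x\<close> moves \<open>inv k\<close>, so little cancels where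
    \<open>k\<close> meets \<open>x \<otimes> inv k\<close>, and \<open>m\<close> is nearly twice as
    long as \<open>k\<close>.\<close>
  obtain x where x: "x \<in> X" "gp (inv k) (x \<otimes> inv k) \<le> C" using C(2)[of "inv k"] k by auto
  have xG: "x \<in> carrier G" using x gens by auto
  define m where "m = k \<otimes> (x \<otimes> inv k)"
  have mG: "m \<in> carrier G" using k xG by (simp add: m_def)
  have lm: "2 * len k - M - C \<le> len m"
    using len_mult[of k "x \<otimes> inv k"] len_translate_ge[of x "inv k"] x(2) M(2)[OF x(1)] k(1) xG
    by (simp add: m_def)
  have "inv m \<otimes> k = k \<otimes> inv x" "m \<otimes> k = k \<otimes> x"
    using k(1) xG by (simp_all add: m_def inv_mult_group m_assoc)
  then have "gp m k = len m + len k - len (k \<otimes> inv x)" "gp (inv m) k = len m + len k - len (k \<otimes> x)"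
    using mG by (simp_all add: gp_def)
  moreover have "len (k \<otimes> inv x) \<le> len k + M" "len (k \<otimes> x) \<le> len k + M"
    using len_mult_le[of k x] len_mult_le[of k "inv x"] M(2)[OF x(1)] k(1) xG by auto
  ultimately have "2 * \<delta> < gp m k" "2 * \<delta> < gp (inv m) k"
    using lm k(2) n C(1) M(1) delta_nonneg by linarith+
  \<comment> \<open>\<open>k\<close> splits from \<open>a\<close> within \<open>\<delta>\<close>,
    but \<open>m\<close> and \<open>inv m\<close> both follow \<open>k\<close> beyond
    \<open>2 * \<delta>\<close>.\<close>
  then have "gp a m \<le> 2 * \<delta>" "gp a (inv m) \<le> 2 * \<delta>"
    using gp_four_point[of a m k] gp_four_point[of a "inv m" k] a mG k(1,3) by auto
  moreover have "n \<le> len m" using lm k(2) n C(1) M(1) delta_nonneg by linarith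
  ultimately show ?thesis using mG by blast
qed

text \<open>Take \<open>y' = y \<otimes> m\<close>. The two conditions of
  \<open>symmetric_extension\<close> for \<open>inv y\<close> have separate purposes: that on
  \<open>m\<close> prevents cancellation, so \<open>y'\<close> follows \<open>y\<close> and hence
  \<open>y0\<close>; that on \<open>inv m\<close> separates the inverses, as \<open>inv y'\<close>
  starts along \<open>inv m\<close>.\<close>

lemma extension_pair:
  assumes y0: "y0 \<in> carrier G" and n: "0 \<le> n"
  shows "\<exists>y\<in>carrier G. \<exists>y'\<in>carrier G. n \<le> len y \<and> n \<le> len y' \<and>
    2 * len y0 - 2 * \<delta> \<le> gp y0 y \<and> 2 * len y0 - 2 * \<delta> \<le> gp y0 y' \<and> gp (inv y) (inv y') \<le> 3 * \<delta>"
proof -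
  have "0 \<le> n + 2 * \<delta>" using n delta_nonneg by simp
  from extension[OF inv_closed[OF y0] this]
  obtain k where k: "k \<in> carrier G" "n + 2 * \<delta> \<le> len k" "gp (inv y0) k \<le> \<delta>" by blast
  define y where "y = y0 \<otimes> k"
  have y: "y \<in> carrier G" using y0 k by (simp add: y_def)
  have ly: "len y0 + n + \<delta> \<le> len y" using len_mult[OF y0 k(1)] k by (simp add: y_def)
  have y0y: "2 * len y0 - \<delta> \<le> gp y0 y" using gp_prefix[OF y0 k(1)] k(3) by (simp add: y_def)
  have "0 \<le> n + 3 * \<delta> + 1" using n delta_nonneg by simp
  from symmetric_extension[OF inv_closed[OF y] this]
  obtain m where m: "m \<in> carrier G" "n + 3 * \<delta> + 1 \<le> len m" "gp (inv y) m \<le> 2 * \<delta>" "gp (inv y) (inv m) \<le> 2 * \<delta>"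
    by blast
  define y' where "y' = y \<otimes> m"
  have y': "y' \<in> carrier G" using y m by (simp add: y'_def)
  have ly': "n \<le> len y'" using len_mult[OF y m(1)] m ly len_nonneg[OF y] delta_nonneg by (simp add: y'_def)
  have yy': "2 * len y - 2 * \<delta> \<le> gp y y'" using gp_prefix[OF y m(1)] m(3) by (simp add: y'_def)
  have "gp y0 y \<le> gp y0 y' + \<delta> \<or> gp y y' \<le> gp y0 y' + \<delta>" using gp_four_point[OF y0 y y'] .
  then have y0y': "2 * len y0 - 2 * \<delta> \<le> gp y0 y'" using y0y yy' ly n delta_nonneg by auto
  have "gp (inv m) (inv y') = 2 * len m - gp m (inv y)"
    using gp_prefix[of "inv m" "inv y"] m(1) y by (simp add: y'_def inv_mult_group)
  moreover have "gp m (inv y) = gp (inv y) m" "gp (inv m) (inv y') = gp (inv y') (inv m)"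
    using gp_sym m(1) y y' by auto
  ultimately have "3 * \<delta> < gp (inv y') (inv m)" using m(2,3) n delta_nonneg by linarith
  then have "gp (inv y) (inv y') \<le> 3 * \<delta>"
    using gp_four_point[of "inv y" "inv y'" "inv m"] y y' m(1,4) by auto
  then show ?thesis using y y' ly ly' y0y y0y' delta_nonneg len_nonneg[OF y0] by (intro bexI[of _ y] bexI[of _ y']) auto
qed

text \<open>A new translate only has to avoid the finitely many
  \<open>inv s \<otimes> (s' \<otimes> t k)\<close>. The copies \<open>s \<otimes> t k\<close> of
  \<open>S\<close> serve as spare directions when the blocks are chosen.\<close>

lemma disjoint_translates:
  assumes S: "finite S" "S \<subseteq> carrier G"
  shows "\<exists>t :: nat \<Rightarrow> 'a. (\<forall>k<n. t k \<in> carrier G) \<and>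
    (\<forall>k<n. \<forall>l<n. k \<noteq> l \<longrightarrow> (\<forall>s\<in>S. \<forall>s'\<in>S. s \<otimes> t k \<noteq> s' \<otimes> t l))"
proof (induction n)
  case (Suc n)
  then obtain t :: "nat \<Rightarrow> 'a" where t: "\<forall>k<n. t k \<in> carrier G"
    "\<forall>k<n. \<forall>l<n. k \<noteq> l \<longrightarrow> (\<forall>s\<in>S. \<forall>s'\<in>S. s \<otimes> t k \<noteq> s' \<otimes> t l)" by blast
  define F where "F = (\<Union>s\<in>S. \<Union>s'\<in>S. (\<lambda>k. inv s \<otimes> (s' \<otimes> t k)) ` {..<n})"
  have "finite F" using S by (simp add: F_def)
  then obtain u where u: "u \<in> carrier G" "u \<notin> F" using infinite_carrier by (meson finite_subset subsetI)
  have "s \<otimes> u \<noteq> s' \<otimes> t k" if "s \<in> S" "s' \<in> S" "k < n" for s s' k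
  proof
    assume "s \<otimes> u = s' \<otimes> t k"
    then have "u = inv s \<otimes> (s' \<otimes> t k)" using that S u(1) inv_cancel_left(1)[of s u] by auto
    then show False using u(2) that by (auto simp: F_def)
  qed
  then show ?case using t u(1)
    by (intro exI[of _ "t(n := u)"]) (auto simp: less_Suc_eq dest: sym)
qed simp

end

section \<open>Unique longest products\<close>

context hyperbolic_length
begin

text \<open>
  The longest factor \<open>h\<close> has little cancellation with one of the two \<open>u\<close> provided for its index,
  so \<open>u h\<close> is longer than all factors and starts like \<open>u\<close>; no other \<open>u'\<close> does.
\<close>

lemma unique_longest_product:
  assumes U: "\<And>i. U i \<subseteq> carrier G"
    and sep: "\<And>i j u u'. u \<in> U i \<Longrightarrow> u' \<in> U j \<Longrightarrow> (i, u) \<noteq> (j, u') \<Longrightarrow> gp u u' + \<delta> < len u \<and> gp u u' + \<delta> < len u'"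
    and two: "\<And>i. \<exists>u\<in>U i. \<exists>u'\<in>U i. gp (inv u) (inv u') + \<delta> < len u \<and> gp (inv u) (inv u') + \<delta> < len u'"
    and I: "finite I" "\<And>i. i \<in> I \<Longrightarrow> finite (H i) \<and> H i \<subseteq> carrier G" "\<exists>i\<in>I. H i \<noteq> {}"
  shows "\<exists>j\<in>I. \<exists>u\<in>U j. \<exists>h\<in>H j. u \<otimes> h \<noteq> \<one> \<and> (\<forall>i\<in>I. u \<otimes> h \<notin> H i) \<and>
    (\<forall>i\<in>I. \<forall>u'\<in>U i. \<forall>h'\<in>H i. u' \<otimes> h' = u \<otimes> h \<longrightarrow> i = j \<and> u' = u)"
proof -
  define L where "L = len ` (\<Union>i\<in>I. H i)"
  have L: "finite L" "L \<noteq> {}" using I by (auto simp: L_def)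
  then obtain j h where jh: "j \<in> I" "h \<in> H j" "len h = Max L" using Max_in[OF L] unfolding L_def by (metis UN_E imageE)
  have max: "len h' \<le> len h" if "i \<in> I" "h' \<in> H i" for i h'
    unfolding jh(3) using L(1) that by (intro Max_ge) (auto simp: L_def)
  have hG: "h \<in> carrier G" using jh I(2) by auto
  obtain u1 u2 where u12: "u1 \<in> U j" "u2 \<in> U j"
    "gp (inv u1) (inv u2) + \<delta> < len u1" "gp (inv u1) (inv u2) + \<delta> < len u2" using two by blast
  have G12: "u1 \<in> carrier G" "u2 \<in> carrier G" using u12 U by auto
  have "gp (inv u1) h \<le> gp (inv u1) (inv u2) + \<delta> \<or> gp h (inv u2) \<le> gp (inv u1) (inv u2) + \<delta>"
    using gp_four_point[of "inv u1" h "inv u2"] G12 hG by simp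
  then obtain u where u: "u \<in> U j" "gp (inv u) h < len u"
  proof
    assume "gp (inv u1) h \<le> gp (inv u1) (inv u2) + \<delta>"
    then show ?thesis using u12 that[of u1] by simp
  next
    assume "gp h (inv u2) \<le> gp (inv u1) (inv u2) + \<delta>"
    then show ?thesis using u12 that[of u2] gp_sym[OF hG, of "inv u2"] G12 by simp
  qed
  have uG: "u \<in> carrier G" using u U by auto
  have long: "len h < len (u \<otimes> h)" using len_mult[OF uG hG] u by simp
  have start: "len u < gp u (u \<otimes> h)" using gp_prefix[OF uG hG] u by simp
  have "u \<otimes> h \<noteq> \<one>" using long len_nonneg[OF hG] by auto
  moreover have "u \<otimes> h \<notin> H i" if "i \<in> I" for i using max[OF that] long by force
  moreover have "i = j \<and> u' = u" if "i \<in> I" "u' \<in> U i" "h' \<in> H i" "u' \<otimes> h' = u \<otimes> h" for i u' h'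
  proof (rule ccontr)
    assume "\<not> ?thesis"
    then have s: "gp u u' + \<delta> < len u" "gp u u' + \<delta> < len u'" using sep[OF u(1) that(2)] by auto
    have u'G: "u' \<in> carrier G" and h'G: "h' \<in> carrier G" using that U I(2) by auto
    have "gp u (u \<otimes> h) \<le> gp u u' + \<delta> \<or> gp (u \<otimes> h) u' \<le> gp u u' + \<delta>"
      using gp_four_point[of u "u \<otimes> h" u'] uG hG u'G by simp
    \<comment> \<open>\<open>u \<otimes> h\<close> follows \<open>u\<close> past the point where
      \<open>u'\<close> leaves, so multiplying it by \<open>inv u'\<close> makes it longer; but the
      result \<open>h'\<close> is at most as long as \<open>h\<close>.\<close>
    then have "gp u' (u \<otimes> h) < len u'" using start s gp_sym[of u' "u \<otimes> h"] uG hG u'G by auto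
    moreover have "inv u' \<otimes> (u \<otimes> h) = h'" using that(4) u'G h'G by (metis inv_cancel_left(1))
    ultimately have "len (u \<otimes> h) < len h'" by (simp add: gp_def)
    then show False using max[OF that(1,3)] long by simp
  qed
  ultimately show ?thesis using jh u by blast
qed

end

section \<open>Separated blocks and their recursive choice\<close>

context torsion_free_nonelementary
begin

text \<open>
  The elements of \<open>xSy \<union> xSy'\<close> and \<open>v'\<close> all start along \<open>v\<close>, but split up within length \<open>D\<close>,
  a small fraction of their lengths. The prefix \<open>v'\<close> is reserved for the later blocks.
\<close>

definition separated_block :: "'a set \<Rightarrow> 'a \<Rightarrow> 'a \<Rightarrow> 'a \<Rightarrow> 'a \<Rightarrow> 'a \<Rightarrow> int \<Rightarrow> bool" where
  "separated_block S v x y y' v' D \<longleftrightarrow>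
    x \<in> carrier G \<and> y \<in> carrier G \<and> y' \<in> carrier G \<and> v' \<in> carrier G \<and> 0 \<le> D \<and>
    (\<forall>s\<in>S. \<forall>s'\<in>S. gp (x \<otimes> (s \<otimes> y)) (x \<otimes> (s' \<otimes> y')) \<le> D) \<and>
    (\<forall>s\<in>S. \<forall>s'\<in>S. s \<noteq> s' \<longrightarrow> gp (x \<otimes> (s \<otimes> y)) (x \<otimes> (s' \<otimes> y)) \<le> D \<and> gp (x \<otimes> (s \<otimes> y')) (x \<otimes> (s' \<otimes> y')) \<le> D) \<and>
    (\<forall>s\<in>S. \<forall>z\<in>{y, y'}. gp (x \<otimes> (s \<otimes> z)) v' \<le> D \<and> D + 10 * \<delta> < len (x \<otimes> (s \<otimes> z)) \<and>
       2 * len v - 2 * \<delta> \<le> gp v (x \<otimes> (s \<otimes> z))) \<and>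
    (\<forall>s\<in>S. gp (inv (x \<otimes> (s \<otimes> y))) (inv (x \<otimes> (s \<otimes> y'))) \<le> D) \<and>
    D + 10 * \<delta> + len v < len v' \<and> 2 * len v - 2 * \<delta> \<le> gp v v'"

text \<open>The order of the choices matters: the divergence bound \<open>E\<close>, then
  \<open>x\<close> as an extension of \<open>v\<close> by more than \<open>E\<close>, then
  \<open>D\<close>, and the long elements \<open>y\<close>, \<open>y'\<close> last. Of four disjoint
  copies of \<open>S\<close>, at most one can cancel much against \<open>x\<close>; of three others,
  two are completed by \<open>y\<close> and \<open>y'\<close>, and one supplies the reserved prefix
  \<open>v'\<close>.\<close>

lemma separated_block_exists:
  assumes S: "finite S" "S \<noteq> {}" "S \<subseteq> carrier G" and v: "v \<in> carrier G"
  shows "\<exists>x y y' v' D. separated_block S v x y y' v' D"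
proof -
  obtain t :: "nat \<Rightarrow> 'a" where t: "\<forall>k<4. t k \<in> carrier G"
    "\<forall>k<4. \<forall>l<4. k \<noteq> l \<longrightarrow> (\<forall>s\<in>S. \<forall>s'\<in>S. s \<otimes> t k \<noteq> s' \<otimes> t l)"
    using disjoint_translates[OF S(1,3)] by blast
  define Q where "Q = (\<Union>k\<in>{..<4}. (\<lambda>s. s \<otimes> t k) ` S)"
  have Q: "finite Q" "Q \<subseteq> carrier G" using S t(1) by (auto simp: Q_def)
  define M where "M = (\<Sum>q\<in>Q. len q)"
  have M: "len q \<le> M" if "q \<in> Q" for q
    unfolding M_def using that Q len_nonneg by (intro member_le_sum) auto
  have M0: "0 \<le> M" unfolding M_def using Q len_nonneg by (intro sum_nonneg) auto
  obtain y0 E where y0: "y0 \<in> carrier G" "0 \<le> E" and E: "\<And>y y' q q'. \<lbrakk>y \<in> carrier G; y' \<in> carrier G;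
      2 * len y0 - 2 * \<delta> \<le> gp y0 y; 2 * len y0 - 2 * \<delta> \<le> gp y0 y'; q \<in> Q; q' \<in> Q; q \<noteq> q'\<rbrakk>
    \<Longrightarrow> gp (q \<otimes> y) (q' \<otimes> y') \<le> E"
    using diverging_translates[OF Q] by blast
  define cone where "cone = {y \<in> carrier G. 2 * len y0 - 2 * \<delta> \<le> gp y0 y}"
  \<comment> \<open>With a tail of this length, a product \<open>gp (inv x) _\<close> of up to
    \<open>E + \<delta>\<close> does not reach back into \<open>v\<close>.\<close>
  have "0 \<le> E + 2 * \<delta>" using y0(2) delta_nonneg by simp
  from extension[OF inv_closed[OF v] this]
  obtain w where w: "w \<in> carrier G" "E + 2 * \<delta> \<le> len w" "gp (inv v) w \<le> \<delta>" by blast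
  define x where "x = v \<otimes> w"
  have x: "x \<in> carrier G" using v w by (simp add: x_def)
  have lx: "len v + E + \<delta> \<le> len x" using len_mult[OF v w(1)] w by (simp add: x_def)
  have vx: "2 * len v - \<delta> \<le> gp v x" using gp_prefix[OF v w(1)] w(3) by (simp add: x_def)
  define good where "good k \<longleftrightarrow> (\<forall>s\<in>S. \<forall>y\<in>cone. gp (inv x) (s \<otimes> t k \<otimes> y) \<le> E + \<delta>)" for k
  \<comment> \<open>Two elements following \<open>inv x\<close> beyond \<open>E + \<delta>\<close>
    follow each other beyond \<open>E\<close>, which different translates of the cone do
    not.\<close>
  have "good k \<or> good l" if kl: "k < 4" "l < 4" "k \<noteq> l" for k l
  proof (rule ccontr)
    assume "\<not> ?thesis"
    then obtain s y s' y' where b: "s \<in> S" "y \<in> cone" "\<not> gp (inv x) (s \<otimes> t k \<otimes> y) \<le> E + \<delta>"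
      "s' \<in> S" "y' \<in> cone" "\<not> gp (inv x) (s' \<otimes> t l \<otimes> y') \<le> E + \<delta>"
      unfolding good_def by blast
    have q: "s \<otimes> t k \<in> Q" "s' \<otimes> t l \<in> Q" "s \<otimes> t k \<noteq> s' \<otimes> t l" using b kl t(2) by (auto simp: Q_def)
    have "gp (s \<otimes> t k \<otimes> y) (s' \<otimes> t l \<otimes> y') \<le> E" using b q by (intro E) (auto simp: cone_def)
    moreover have "s \<otimes> t k \<otimes> y \<in> carrier G" "s' \<otimes> t l \<otimes> y' \<in> carrier G"
      using b q Q by (auto simp: cone_def)
    ultimately show False
      using gp_four_point[of "s \<otimes> t k \<otimes> y" "inv x" "s' \<otimes> t l \<otimes> y'"] gp_sym[of "s \<otimes> t k \<otimes> y" "inv x"] b x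
      by auto
  qed
  then have "good 0 \<or> good 1" "good 0 \<or> good 2" "good 0 \<or> good 3" "good 1 \<or> good 2" "good 1 \<or> good 3" "good 2 \<or> good 3"
    by simp_all
  moreover have "\<exists>i j k. {i, j, k} \<subseteq> {..<4} \<and> distinct [i, j, k] \<and> good i \<and> good j \<and> good k"
    if "{a, b, c} \<subseteq> {..<4}" "distinct [a, b, c]" "good a" "good b" "good c" for a b c :: nat
    using that by blast
  from this[of 0 1 2] this[of 0 1 3] this[of 0 2 3] this[of 1 2 3]
  have "good 0 \<Longrightarrow> good 1 \<Longrightarrow> good 2 \<Longrightarrow> \<exists>i j k. {i, j, k} \<subseteq> {..<4} \<and> distinct [i, j, k] \<and> good i \<and> good j \<and> good k"
    "good 0 \<Longrightarrow> good 1 \<Longrightarrow> good 3 \<Longrightarrow> \<exists>i j k. {i, j, k} \<subseteq> {..<4} \<and> distinct [i, j, k] \<and> good i \<and> good j \<and> good k"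
    "good 0 \<Longrightarrow> good 2 \<Longrightarrow> good 3 \<Longrightarrow> \<exists>i j k. {i, j, k} \<subseteq> {..<4} \<and> distinct [i, j, k] \<and> good i \<and> good j \<and> good k"
    "good 1 \<Longrightarrow> good 2 \<Longrightarrow> good 3 \<Longrightarrow> \<exists>i j k. {i, j, k} \<subseteq> {..<4} \<and> distinct [i, j, k] \<and> good i \<and> good j \<and> good k"
    by simp_all
  ultimately obtain i j k where ijk: "i < 4" "j < 4" "k < 4" "i \<noteq> j" "i \<noteq> k" "j \<noteq> k" "good i" "good j" "good k"
    by auto
  \<comment> \<open>\<open>apart\<close> needs \<open>E + 2 * len x\<close>, where the second term
    is the shift by \<open>x\<close>; \<open>ends\<close> needs the \<open>3 * \<delta>\<close> of
    \<open>extension_pair\<close> and twice the lengths of two prefixes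
    \<open>x \<otimes> q\<close>, each at most \<open>len x + M\<close>. No summand refers to
    \<open>y\<close>.\<close>
  define D where "D = 3 * \<delta> + E + 4 * (len x + M)"
  have D0: "0 \<le> D" using delta_nonneg y0(2) M0 len_nonneg[OF x] by (simp add: D_def)
  define n where "n = D + 10 * \<delta> + len v + len x + M + 1"
  have n0: "0 \<le> n" using delta_nonneg D0 M0 len_nonneg[OF x] len_nonneg[OF v] by (simp add: n_def)
  obtain y y' where y: "y \<in> carrier G" "y' \<in> carrier G" "n \<le> len y" "n \<le> len y'"
    "2 * len y0 - 2 * \<delta> \<le> gp y0 y" "2 * len y0 - 2 * \<delta> \<le> gp y0 y'" "gp (inv y) (inv y') \<le> 3 * \<delta>"
    using extension_pair[OF y0(1) n0] by blast
  have cone: "y \<in> cone" "y' \<in> cone" using y by (auto simp: cone_def)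
  have block: "gp v (x \<otimes> (s \<otimes> t a \<otimes> z)) \<ge> 2 * len v - 2 * \<delta>" "D + 10 * \<delta> + len v < len (x \<otimes> (s \<otimes> t a \<otimes> z))"
    if a: "good a" "a < 4" and z: "z \<in> cone" "n \<le> len z" and s: "s \<in> S" for a z s
  proof -
    define q where "q = s \<otimes> t a"
    have q: "q \<in> Q" "q \<in> carrier G" using a s Q by (auto simp: q_def Q_def)
    have zG: "z \<in> carrier G" using z by (simp add: cone_def)
    have qz: "gp (inv x) (q \<otimes> z) \<le> E + \<delta>" using a z s by (auto simp: good_def q_def)
    have "gp v x \<le> gp v (x \<otimes> (q \<otimes> z)) + \<delta> \<or> gp x (x \<otimes> (q \<otimes> z)) \<le> gp v (x \<otimes> (q \<otimes> z)) + \<delta>"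
      using gp_four_point[of v x "x \<otimes> (q \<otimes> z)"] v x q zG by simp
    moreover have "gp x (x \<otimes> (q \<otimes> z)) \<ge> 2 * len x - E - \<delta>" using gp_prefix[of x "q \<otimes> z"] x q zG qz by simp
    ultimately show "gp v (x \<otimes> (s \<otimes> t a \<otimes> z)) \<ge> 2 * len v - 2 * \<delta>"
      using vx lx y0(2) delta_nonneg unfolding q_def by auto
    have "len z - len q \<le> len (q \<otimes> z)" "len (q \<otimes> z) - len x \<le> len (x \<otimes> (q \<otimes> z))"
      using len_translate_ge x q zG by auto
    then show "D + 10 * \<delta> + len v < len (x \<otimes> (s \<otimes> t a \<otimes> z))"
      using z(2) M[OF q(1)] unfolding q_def n_def by linarith
  qed
  have apart: "gp (x \<otimes> (s \<otimes> t a \<otimes> z)) (x \<otimes> (s' \<otimes> t b \<otimes> z')) \<le> D"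
    if a: "a < 4" "b < 4" "a \<noteq> b \<or> s \<noteq> s'" and z: "z \<in> cone" "z' \<in> cone" and s: "s \<in> S" "s' \<in> S" for a b z z' s s'
  proof -
    have q: "s \<otimes> t a \<in> Q" "s' \<otimes> t b \<in> Q" using a s by (auto simp: Q_def)
    have "s \<otimes> t a \<noteq> s' \<otimes> t b"
    proof (cases "a = b")
      case True
      then show ?thesis using a s S(3) t(1) by (simp add: subset_eq)
    qed (use a s t(2) in auto)
    then have "gp (s \<otimes> t a \<otimes> z) (s' \<otimes> t b \<otimes> z') \<le> E" using z q by (intro E) (auto simp: cone_def)
    moreover have "s \<otimes> t a \<otimes> z \<in> carrier G" "s' \<otimes> t b \<otimes> z' \<in> carrier G" using z q Q by (auto simp: cone_def)
    ultimately have "gp (x \<otimes> (s \<otimes> t a \<otimes> z)) (x \<otimes> (s' \<otimes> t b \<otimes> z')) \<le> E + 2 * len x"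
      using gp_translate_le[of x "s \<otimes> t a \<otimes> z" "s' \<otimes> t b \<otimes> z'"] x by simp
    then show ?thesis using delta_nonneg M0 len_nonneg[OF x] by (simp add: D_def)
  qed
  have ends: "gp (inv (x \<otimes> (s \<otimes> t i \<otimes> y))) (inv (x \<otimes> (s \<otimes> t j \<otimes> y'))) \<le> D" if s: "s \<in> S" for s
  proof -
    let ?g = "x \<otimes> (s \<otimes> t i)" and ?h = "x \<otimes> (s \<otimes> t j)"
    have q: "s \<otimes> t i \<in> Q" "s \<otimes> t j \<in> Q" using ijk s by (auto simp: Q_def)
    then have qG: "s \<otimes> t i \<in> carrier G" "s \<otimes> t j \<in> carrier G" using Q by auto
    have gh: "?g \<in> carrier G" "?h \<in> carrier G" "len ?g \<le> len x + M" "len ?h \<le> len x + M"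
      using len_mult_le[OF x, of "s \<otimes> t i"] len_mult_le[OF x, of "s \<otimes> t j"] M[OF q(1)] M[OF q(2)] qG x by auto
    have "gp (inv y \<otimes> inv ?g) (inv y' \<otimes> inv ?h) \<le> gp (inv y) (inv y') + 2 * len ?g + 2 * len ?h"
      using gp_mult_right_le[of "inv y" "inv y'" "inv ?g" "inv ?h"] gh y by simp
    also have "\<dots> \<le> D" using y(7) gh y0(2) by (simp add: D_def)
    finally have "gp (inv y \<otimes> inv ?g) (inv y' \<otimes> inv ?h) \<le> D" .
    moreover have "inv y \<otimes> inv ?g = inv (x \<otimes> (s \<otimes> t i \<otimes> y))" "inv y' \<otimes> inv ?h = inv (x \<otimes> (s \<otimes> t j \<otimes> y'))"
      using x y qG gh by (simp_all add: inv_mult_group[symmetric] m_assoc[symmetric])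
    ultimately show ?thesis by simp
  qed
  obtain s0 where s0: "s0 \<in> S" using S(2) by blast
  have assoc: "s \<otimes> (t a \<otimes> z) = s \<otimes> t a \<otimes> z" if "s \<in> S" "a < 4" "z \<in> cone" for s a z
    using that S(3) t(1) by (auto simp: m_assoc cone_def)
  have tG: "t i \<in> carrier G" "t j \<in> carrier G" using t(1) ijk by auto
  \<comment> \<open>The multipliers \<open>t i\<close> and \<open>t j\<close> are absorbed into the
    right factors; any \<open>s0\<close> serves for the reserved prefix, whose index
    \<open>k\<close> differs from both.\<close>
  have "separated_block S v x (t i \<otimes> y) (t j \<otimes> y') (x \<otimes> (s0 \<otimes> t k \<otimes> y)) D"
    unfolding separated_block_def
  proof (intro conjI ballI impI)
    fix s z assume sz: "s \<in> S" "z \<in> {t i \<otimes> y, t j \<otimes> y'}"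
    show "gp (x \<otimes> (s \<otimes> z)) (x \<otimes> (s0 \<otimes> t k \<otimes> y)) \<le> D"
      using sz apart ijk cone s0 by (auto simp: assoc)
    show "D + 10 * \<delta> < len (x \<otimes> (s \<otimes> z))"
      using sz block(2)[of i y s] block(2)[of j y' s] ijk cone y len_nonneg[OF v] by (auto simp: assoc)
    show "2 * len v - 2 * \<delta> \<le> gp v (x \<otimes> (s \<otimes> z))"
      using sz block(1)[of i y s] block(1)[of j y' s] ijk cone y by (auto simp: assoc)
  next
    show "D + 10 * \<delta> + len v < len (x \<otimes> (s0 \<otimes> t k \<otimes> y))" using block(2) ijk cone y s0 by simp
    show "2 * len v - 2 * \<delta> \<le> gp v (x \<otimes> (s0 \<otimes> t k \<otimes> y))" using block(1) ijk cone y s0 by simp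
    show "x \<otimes> (s0 \<otimes> t k \<otimes> y) \<in> carrier G" using s0 S t(1) ijk x y by auto
  qed (use D0 tG x y in \<open>simp_all add: assoc ijk cone apart ends\<close>)
  then show ?thesis by blast
qed

text \<open>The prefix reserved by one block is the \<open>v\<close> of the next. Elements of block
  \<open>i\<close> leave this prefix within \<open>D i\<close>, whereas all later blocks follow it
  nearly to its end. In the conclusion, \<open>u \<otimes> h \<noteq> \<one>\<close> and
  \<open>u \<otimes> h \<notin> H i\<close> ensure that neither the value \<open>1\<close> of a
  combination nor the summands \<open>1\<close> of its generators interfere at
  \<open>u \<otimes> h\<close>.\<close>

theorem unique_product_translates:
  fixes S :: "nat \<Rightarrow> 'a set"
  assumes S: "\<And>i. finite (S i)" "\<And>i. S i \<noteq> {}" "\<And>i. S i \<subseteq> carrier G"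
  obtains x y y' U where "\<And>i. x i \<in> carrier G" "\<And>i. y i \<in> carrier G" "\<And>i. y' i \<in> carrier G"
    "\<And>i s s'. s \<in> S i \<Longrightarrow> s' \<in> S i \<Longrightarrow> x i \<otimes> (s \<otimes> y i) \<noteq> x i \<otimes> (s' \<otimes> y' i)"
    "\<And>i. U i = (\<lambda>s. x i \<otimes> (s \<otimes> y i)) ` S i \<union> (\<lambda>s. x i \<otimes> (s \<otimes> y' i)) ` S i"
    "\<And>I H. finite I \<Longrightarrow> (\<And>i. i \<in> I \<Longrightarrow> finite (H i) \<and> H i \<subseteq> carrier G) \<Longrightarrow> \<exists>i\<in>I. H i \<noteq> {} \<Longrightarrow>
      \<exists>j\<in>I. \<exists>u\<in>U j. \<exists>h\<in>H j. u \<otimes> h \<noteq> \<one> \<and> (\<forall>i\<in>I. u \<otimes> h \<notin> H i) \<and>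
        (\<forall>i\<in>I. \<forall>u'\<in>U i. \<forall>h'\<in>H i. u' \<otimes> h' = u \<otimes> h \<longrightarrow> i = j \<and> u' = u)"
proof -
  define P where "P i v p \<longleftrightarrow> (case p of (x, y, y', v', D) \<Rightarrow> separated_block (S i) v x y y' v' D)" for i v p
  define f where "f i v = (SOME p. P i v p)" for i v
  have f: "P i v (f i v)" if "v \<in> carrier G" for i v
  proof -
    from separated_block_exists[OF S that, of i] obtain x y y' v' D
      where "separated_block (S i) v x y y' v' D" by (elim exE)
    then have "P i v (x, y, y', v', D)" by (simp add: P_def)
    then show ?thesis unfolding f_def by (rule someI)
  qed
  define fv where "fv i v = fst (snd (snd (snd (f i v))))" for i v
  define v where "v = rec_nat \<one> fv"
  have v_Suc: "v (Suc i) = fv i (v i)" for i by (simp add: v_def)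
  have v: "v i \<in> carrier G" for i
  proof (induction i)
    case (Suc i)
    then show ?case using f[OF Suc, of i] by (auto simp: v_Suc fv_def P_def separated_block_def split: prod.splits)
  qed (simp add: v_def)
  define x where "x i = fst (f i (v i))" for i
  define y where "y i = fst (snd (f i (v i)))" for i
  define y' where "y' i = fst (snd (snd (f i (v i))))" for i
  define D where "D i = snd (snd (snd (snd (f i (v i)))))" for i
  have P: "separated_block (S i) (v i) (x i) (y i) (y' i) (v (Suc i)) (D i)" for i
    using f[OF v, of i i] by (simp add: P_def v_Suc fv_def x_def y_def y'_def D_def case_prod_beta)
  have G: "x i \<in> carrier G" "y i \<in> carrier G" "y' i \<in> carrier G" "0 \<le> D i" for i
    using P[of i] by (simp_all add: separated_block_def)
  have vv: "D i + 10 * \<delta> + len (v i) < len (v (Suc i))" "2 * len (v i) - 2 * \<delta> \<le> gp (v i) (v (Suc i))" for i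
    using P[of i] by (simp_all add: separated_block_def)
  define U where "U i = (\<lambda>s. x i \<otimes> (s \<otimes> y i)) ` S i \<union> (\<lambda>s. x i \<otimes> (s \<otimes> y' i)) ` S i" for i
  have UG: "U i \<subseteq> carrier G" for i using S(3)[of i] G[of i] by (auto simp: U_def)
  have U1: "gp u (v (Suc i)) \<le> D i" "D i + 10 * \<delta> < len u" "2 * len (v i) - 2 * \<delta> \<le> gp (v i) u" if "u \<in> U i" for u i
    using that P[of i] unfolding U_def separated_block_def by blast+
  have cross: "gp (x i \<otimes> (s \<otimes> y i)) (x i \<otimes> (s' \<otimes> y' i)) \<le> D i" if "s \<in> S i" "s' \<in> S i" for i s s'
    using that P[of i] unfolding separated_block_def by blast
  have U2: "gp u u' \<le> D i" if u: "u \<in> U i" "u' \<in> U i" "u \<noteq> u'" for u u' i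
  proof -
    have same: "gp (x i \<otimes> (s \<otimes> y i)) (x i \<otimes> (s' \<otimes> y i)) \<le> D i" "gp (x i \<otimes> (s \<otimes> y' i)) (x i \<otimes> (s' \<otimes> y' i)) \<le> D i"
      if "s \<in> S i" "s' \<in> S i" "s \<noteq> s'" for s s'
      using that P[of i] unfolding separated_block_def by blast+
    have sym: "gp u u' = gp u' u" using UG u by (intro gp_sym) auto
    consider (1) s s' where "s \<in> S i" "s' \<in> S i" "u = x i \<otimes> (s \<otimes> y i)" "u' = x i \<otimes> (s' \<otimes> y i)"
      | (2) s s' where "s \<in> S i" "s' \<in> S i" "u = x i \<otimes> (s \<otimes> y' i)" "u' = x i \<otimes> (s' \<otimes> y' i)"
      | (3) s s' where "s \<in> S i" "s' \<in> S i" "u = x i \<otimes> (s \<otimes> y i)" "u' = x i \<otimes> (s' \<otimes> y' i)"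
      | (4) s s' where "s \<in> S i" "s' \<in> S i" "u' = x i \<otimes> (s \<otimes> y i)" "u = x i \<otimes> (s' \<otimes> y' i)"
      using u(1,2) unfolding U_def by blast
    then show ?thesis
    proof cases
      case 1 then show ?thesis using same(1)[of s s'] u(3) by blast
    next
      case 2 then show ?thesis using same(2)[of s s'] u(3) by blast
    next
      case 3 then show ?thesis using cross[of s i s'] by simp
    next
      case 4 then show ?thesis using cross[of s i s'] sym by simp
    qed
  qed
  \<comment> \<open>The loss does not grow with \<open>j - i\<close>: \<open>v (Suc i)\<close> is
    longer than \<open>v i\<close> by more than \<open>10 * \<delta>\<close>, so the loss of the
    previous step is irrelevant at \<open>v i\<close>, and the new one is
    \<open>2 * \<delta>\<close> from \<open>vv\<close> plus one \<open>\<delta>\<close>.\<close>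
  have chain: "2 * len (v i) - 3 * \<delta> \<le> gp (v i) u" if "i \<le> j" "u \<in> U j" for i j u
    using that(1)
  proof (induction i rule: inc_induct)
    case base
    then show ?case using U1(3)[OF that(2)] delta_nonneg by simp
  next
    case (step i)
    have "gp (v i) (v (Suc i)) \<le> gp (v i) u + \<delta> \<or> gp (v (Suc i)) u \<le> gp (v i) u + \<delta>"
      using gp_four_point[of "v i" "v (Suc i)" u] v UG that(2) by auto
    then show ?case using step.IH vv[of i] G(4)[of i] delta_nonneg by auto
  qed
  have sep_less: "gp u u' + \<delta> < len u \<and> gp u u' + \<delta> < len u'" if "i < j" "u \<in> U i" "u' \<in> U j" for i j u u'
  proof -
    have c: "2 * len (v (Suc i)) - 3 * \<delta> \<le> gp (v (Suc i)) u'" using chain[of "Suc i" j u'] that by simp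
    have G': "u \<in> carrier G" "u' \<in> carrier G" using UG that by auto
    have big: "D i + 10 * \<delta> < len (v (Suc i))" using vv(1)[of i] len_nonneg[OF v[of i]] by simp
    have "gp u u' \<le> gp u (v (Suc i)) + \<delta> \<or> gp u' (v (Suc i)) \<le> gp u (v (Suc i)) + \<delta>"
      using gp_four_point[of u u' "v (Suc i)"] G' v by simp
    then have "gp u u' \<le> D i + \<delta>"
      using U1(1)[OF that(2)] c big gp_sym[of u' "v (Suc i)"] G' v delta_nonneg G(4)[of i] by auto
    moreover have "2 * len (v (Suc i)) - 3 * \<delta> \<le> 2 * len u'" using c gp_le'[of "v (Suc i)" u'] G' v by simp
    ultimately show ?thesis using U1(2)[OF that(2)] big delta_nonneg G(4)[of i] by auto
  qed
  have sep: "gp u u' + \<delta> < len u \<and> gp u u' + \<delta> < len u'" if u: "u \<in> U i" "u' \<in> U j" "(i, u) \<noteq> (j, u')" for i j u u'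
  proof (cases i j rule: linorder_cases)
    case less
    then show ?thesis using sep_less u by blast
  next
    case equal
    then show ?thesis using u U2[of u i u'] U1(2)[of u i] U1(2)[of u' i] delta_nonneg by auto
  next
    case greater
    moreover have "u \<in> carrier G" "u' \<in> carrier G" using UG u by auto
    ultimately show ?thesis using sep_less[of j i u' u] u gp_sym[of u u'] by simp
  qed
  have two: "\<exists>u\<in>U i. \<exists>u'\<in>U i. gp (inv u) (inv u') + \<delta> < len u \<and> gp (inv u) (inv u') + \<delta> < len u'" for i
  proof -
    obtain s where s: "s \<in> S i" using S(2)[of i] by blast
    have "gp (inv (x i \<otimes> (s \<otimes> y i))) (inv (x i \<otimes> (s \<otimes> y' i))) \<le> D i" using s P[of i] unfolding separated_block_def by blast
    moreover have "x i \<otimes> (s \<otimes> y i) \<in> U i" "x i \<otimes> (s \<otimes> y' i) \<in> U i" using s by (auto simp: U_def)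
    ultimately show ?thesis using U1(2)[of "x i \<otimes> (s \<otimes> y i)" i] U1(2)[of "x i \<otimes> (s \<otimes> y' i)" i] delta_nonneg
      by (intro bexI[of _ "x i \<otimes> (s \<otimes> y i)"] bexI[of _ "x i \<otimes> (s \<otimes> y' i)"]) auto
  qed
  have distinct: "x i \<otimes> (s \<otimes> y i) \<noteq> x i \<otimes> (s' \<otimes> y' i)" if s: "s \<in> S i" "s' \<in> S i" for i s s'
  proof
    let ?u = "x i \<otimes> (s \<otimes> y i)"
    assume "?u = x i \<otimes> (s' \<otimes> y' i)"
    moreover have u: "?u \<in> U i" using s by (auto simp: U_def)
    ultimately show False
      using cross[OF s] gp_self[of ?u] U1(2)[OF u] UG[of i] G(4)[of i] delta_nonneg by auto
  qed
  show thesis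
  proof (rule that[of x y y' U])
    fix I and H :: "nat \<Rightarrow> 'a set"
    assume IH: "finite I" "\<And>i. i \<in> I \<Longrightarrow> finite (H i) \<and> H i \<subseteq> carrier G" "\<exists>i\<in>I. H i \<noteq> {}"
    show "\<exists>j\<in>I. \<exists>u\<in>U j. \<exists>h\<in>H j. u \<otimes> h \<noteq> \<one> \<and> (\<forall>i\<in>I. u \<otimes> h \<notin> H i) \<and>
        (\<forall>i\<in>I. \<forall>u'\<in>U i. \<forall>h'\<in>H i. u' \<otimes> h' = u \<otimes> h \<longrightarrow> i = j \<and> u' = u)"
      by (rule unique_longest_product[OF UG sep two IH])
  qed (use G distinct U_def in auto)
qed

end

section \<open>Cayley graphs\<close>

locale cayley_graph = group G for G (structure) +
  fixes X :: "'a set"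
  assumes finite_X: "finite X" and X_carrier: "X \<subseteq> carrier G" and X_gen: "generate G X = carrier G"
begin

abbreviation adj where "adj \<equiv> cayley_adj G X"
abbreviation vd where "vd \<equiv> vertex_dist G X"

lemma adj_iff: "(g, h) \<in> adj \<longleftrightarrow> g \<in> carrier G \<and> h \<in> carrier G \<and> (\<exists>x\<in>X. h = g \<otimes> x \<or> g = h \<otimes> x)"
  by (simp add: cayley_adj_def)

lemma adj_sym: "(g, h) \<in> adj \<Longrightarrow> (h, g) \<in> adj"
  by (auto simp: adj_iff)

lemma adj_translate:
  assumes "(g, h) \<in> adj" "k \<in> carrier G"
  shows "(k \<otimes> g, k \<otimes> h) \<in> adj"
proof -
  obtain x where x: "x \<in> X" "h = g \<otimes> x \<or> g = h \<otimes> x" "g \<in> carrier G" "h \<in> carrier G"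
    using assms(1) by (auto simp: adj_iff)
  then have "x \<in> carrier G" using X_carrier by auto
  then have "k \<otimes> h = k \<otimes> g \<otimes> x \<or> k \<otimes> g = k \<otimes> h \<otimes> x" using x assms(2) by (auto simp: m_assoc)
  then show ?thesis using x assms(2) by (auto simp: adj_iff)
qed

lemma relpow_adj_sym: "(g, h) \<in> adj ^^ n \<Longrightarrow> (h, g) \<in> adj ^^ n"
proof (induction n arbitrary: h)
  case (Suc n)
  then obtain k where "(g, k) \<in> adj ^^ n" "(k, h) \<in> adj" by auto
  then show ?case using Suc.IH adj_sym by (meson relpow_Suc_I2)
qed simp

lemma relpow_adj_translate: "(g, h) \<in> adj ^^ n \<Longrightarrow> k \<in> carrier G \<Longrightarrow> (k \<otimes> g, k \<otimes> h) \<in> adj ^^ n"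
proof (induction n arbitrary: h)
  case (Suc n)
  then obtain l where "(g, l) \<in> adj ^^ n" "(l, h) \<in> adj" by auto
  then show ?case using Suc adj_translate by (meson relpow_Suc_I)
qed simp

lemma reachable_from_one: "g \<in> generate G X \<Longrightarrow> (\<one>, g) \<in> adj\<^sup>*"
proof (induction rule: generate.induct)
  case (incl x)
  then have "x \<in> carrier G" using X_carrier by auto
  then show ?case using incl by (intro r_into_rtrancl) (auto simp: adj_iff intro!: bexI[of _ x])
next
  case (inv x)
  then have "x \<in> carrier G" using X_carrier by auto
  then show ?case using inv by (intro r_into_rtrancl) (auto simp: adj_iff intro!: bexI[of _ x])
next
  case (eng g h)
  have g: "g \<in> carrier G" using eng.hyps(1) X_gen by simp
  obtain m n where "(\<one>, g) \<in> adj ^^ m" "(\<one>, h) \<in> adj ^^ n" using eng.IH by (meson rtrancl_imp_relpow)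
  then have "(\<one>, g) \<in> adj ^^ m" "(g, g \<otimes> h) \<in> adj ^^ n"
    using relpow_adj_translate[of \<one> h n g] g by auto
  then show ?case by (meson relpow_imp_rtrancl rtrancl_trans)
qed simp

lemma connected:
  assumes "g \<in> carrier G" "h \<in> carrier G"
  shows "\<exists>n. (g, h) \<in> adj ^^ n"
proof -
  have "(\<one>, inv g \<otimes> h) \<in> adj\<^sup>*" using assms X_gen by (intro reachable_from_one) auto
  then obtain n where "(\<one>, inv g \<otimes> h) \<in> adj ^^ n" by (meson rtrancl_imp_relpow)
  then have "(g \<otimes> \<one>, g \<otimes> (inv g \<otimes> h)) \<in> adj ^^ n" using assms(1) by (rule relpow_adj_translate)
  then show ?thesis using assms by auto
qed

lemma vd_path: "g \<in> carrier G \<Longrightarrow> h \<in> carrier G \<Longrightarrow> (g, h) \<in> adj ^^ vd g h"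
  unfolding vertex_dist_def using connected by (rule LeastI_ex)

lemma vd_le: "(g, h) \<in> adj ^^ n \<Longrightarrow> vd g h \<le> n"
  unfolding vertex_dist_def by (rule Least_le)

lemma vd_self [simp]: "vd g g = 0"
  using vd_le[of g g 0] by simp

lemma vd_sym: "g \<in> carrier G \<Longrightarrow> h \<in> carrier G \<Longrightarrow> vd g h = vd h g"
  by (meson antisym relpow_adj_sym vd_le vd_path)

lemma vd_triangle:
  assumes "g \<in> carrier G" "h \<in> carrier G" "k \<in> carrier G"
  shows "vd g k \<le> vd g h + vd h k"
  using vd_path[of g h] vd_path[of h k] assms by (intro vd_le) (auto simp: relpow_add)

lemma vd_translate_le:
  "\<lbrakk>g \<in> carrier G; h \<in> carrier G; k \<in> carrier G\<rbrakk> \<Longrightarrow> vd (k \<otimes> g) (k \<otimes> h) \<le> vd g h"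
  by (intro vd_le relpow_adj_translate vd_path)

lemma vd_eq_len:
  assumes "g \<in> carrier G" "h \<in> carrier G"
  shows "vd g h = vd \<one> (inv g \<otimes> h)"
  using vd_translate_le[of g h "inv g"] vd_translate_le[of \<one> "inv g \<otimes> h" g] assms by simp

lemma finite_ball: "finite {h \<in> carrier G. vd \<one> h \<le> r}"
proof -
  have "finite {h. (\<one>, h) \<in> adj ^^ n}" for n
  proof (induction n)
    case (Suc n)
    have "{h. (\<one>, h) \<in> adj ^^ Suc n} \<subseteq> (\<Union>g\<in>{h. (\<one>, h) \<in> adj ^^ n}. (\<lambda>x. g \<otimes> x) ` X \<union> (\<lambda>x. g \<otimes> inv x) ` X)"
    proof
      fix h assume "h \<in> {h. (\<one>, h) \<in> adj ^^ Suc n}"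
      then obtain g where g: "(\<one>, g) \<in> adj ^^ n" "(g, h) \<in> adj" by auto
      then obtain x where x: "x \<in> X" "h = g \<otimes> x \<or> g = h \<otimes> x" "g \<in> carrier G" "h \<in> carrier G"
        by (auto simp: adj_iff)
      have "x \<in> carrier G" using x X_carrier by auto
      then have "h = g \<otimes> x \<or> h = g \<otimes> inv x" using x by (auto simp: m_assoc)
      then show "h \<in> (\<Union>g\<in>{h. (\<one>, h) \<in> adj ^^ n}. (\<lambda>x. g \<otimes> x) ` X \<union> (\<lambda>x. g \<otimes> inv x) ` X)"
        using g(1) x(1) by blast
    qed
    then show ?case by (rule finite_subset) (use Suc finite_X in simp)
  qed simp
  then have "finite (\<Union>n\<in>{..r}. {h. (\<one>, h) \<in> adj ^^ n})" by auto
  moreover have "{h \<in> carrier G. vd \<one> h \<le> r} \<subseteq> (\<Union>n\<in>{..r}. {h. (\<one>, h) \<in> adj ^^ n})"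
    using vd_path by auto
  ultimately show ?thesis by (rule rev_finite_subset)
qed

section \<open>Geodesic vertex paths and their realization\<close>

definition geodesic :: "(nat \<Rightarrow> 'a) \<Rightarrow> nat \<Rightarrow> bool" where
  "geodesic p n \<longleftrightarrow> (\<forall>i<n. (p i, p (Suc i)) \<in> adj) \<and> (\<forall>i\<le>n. p i \<in> carrier G) \<and>
    (\<forall>i\<le>n. \<forall>j\<le>n. real (vd (p i) (p j)) = \<bar>real i - real j\<bar>)"

lemma geodesic_exists:
  assumes gh: "g \<in> carrier G" "h \<in> carrier G"
  obtains p where "geodesic p (vd g h)" "p 0 = g" "p (vd g h) = h"
proof -
  define n where "n = vd g h"
  obtain p where p: "p 0 = g" "p n = h" "\<And>i. i < n \<Longrightarrow> (p i, p (Suc i)) \<in> adj"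
    using vd_path[OF gh] unfolding relpow_fun_conv n_def by auto
  have G: "p i \<in> carrier G" if "i \<le> n" for i
    using that p gh by (cases "i = n") (auto simp: adj_iff)
  have up: "vd (p i) (p (i + m)) \<le> m" if "i + m \<le> n" for i m
  proof -
    have "(p i, p (i + m)) \<in> adj ^^ m"
      unfolding relpow_fun_conv using that p(3) by (intro exI[of _ "\<lambda>j. p (i + j)"]) auto
    then show ?thesis by (rule vd_le)
  qed
  have le: "vd (p i) (p j) = j - i" if "i \<le> j" "j \<le> n" for i j
  proof -
    have "n \<le> vd (p 0) (p i) + vd (p i) (p j) + vd (p j) (p n)"
      using vd_triangle[of "p 0" "p i" "p n"] vd_triangle[of "p i" "p j" "p n"] G that gh p by (simp add: n_def)
    moreover have "vd (p 0) (p i) \<le> i" "vd (p i) (p j) \<le> j - i" "vd (p j) (p n) \<le> n - j"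
      using up[of 0 i] up[of i "j - i"] up[of j "n - j"] that by auto
    ultimately show ?thesis using that by linarith
  qed
  have "real (vd (p i) (p j)) = \<bar>real i - real j\<bar>" if "i \<le> n" "j \<le> n" for i j
    using le[of i j] le[of j i] vd_sym[of "p i" "p j"] G that by (cases "i \<le> j") auto
  then have "geodesic p n" using p G by (auto simp: geodesic_def)
  then show thesis using that p by (simp add: n_def)
qed

lemma geodesic_inj: "geodesic p n \<Longrightarrow> i \<le> n \<Longrightarrow> j \<le> n \<Longrightarrow> p i = p j \<Longrightarrow> i = j"
  unfolding geodesic_def by (metis abs_eq_0 eq_iff_diff_eq_0 of_nat_0 of_nat_eq_iff vd_self)

lemma exits_finite [simp]: "finite (exits G P)"
  by (cases P) auto

lemma along_edge_finite [simp]: "finite (along_edge P Q)"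
  by (cases P; cases Q) auto

text \<open>
  A geodesic vertex path is realized as the curve through its edges; the exits of its point at
  time \<open>t\<close> are the vertices at the two neighbouring integer times.
\<close>

lemma geodesic_realization:
  assumes p: "geodesic p n"
  obtains c where "\<And>k. k \<le> n \<Longrightarrow> c (real k) = Vertex (p k)"
    "\<And>t. 0 \<le> t \<Longrightarrow> t \<le> real n \<Longrightarrow> c t \<in> cayley_points G X"
    "\<And>t. 0 \<le> t \<Longrightarrow> t \<le> real n \<Longrightarrow> exits G (c t) = (\<lambda>i. (p i, \<bar>t - real i\<bar>)) ` {nat \<lfloor>t\<rfloor>, nat \<lceil>t\<rceil>}"
    "\<And>s t. 0 \<le> s \<Longrightarrow> s \<le> real n \<Longrightarrow> 0 \<le> t \<Longrightarrow> t \<le> real n \<Longrightarrow> cayley_dist G X (c s) (c t) = \<bar>s - t\<bar>"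
proof -
  have adj: "(p k, p (Suc k)) \<in> adj" if "k < n" for k using p that by (simp add: geodesic_def)
  have pG: "p k \<in> carrier G" if "k \<le> n" for k using p that by (simp add: geodesic_def)
  have dist: "real (vd (p i) (p j)) = \<bar>real i - real j\<bar>" if "i \<le> n" "j \<le> n" for i j
    using p that by (simp add: geodesic_def)
  \<comment> \<open>Edges are directed. Where a step could use edges of both directions the forward
    one is taken, so that every step runs along one definite edge.\<close>
  define fwd where "fwd k \<longleftrightarrow> (\<exists>x\<in>X. p (Suc k) = p k \<otimes> x)" for k
  define lab where "lab k = (if fwd k then SOME x. x \<in> X \<and> p (Suc k) = p k \<otimes> x
    else SOME x. x \<in> X \<and> p k = p (Suc k) \<otimes> x)" for k
  have lab: "lab k \<in> X" "if fwd k then p (Suc k) = p k \<otimes> lab k else p k = p (Suc k) \<otimes> lab k" if k: "k < n" for k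
  proof -
    have "lab k \<in> X \<and> (if fwd k then p (Suc k) = p k \<otimes> lab k else p k = p (Suc k) \<otimes> lab k)"
    proof (cases "fwd k")
      case True
      then have "\<exists>x. x \<in> X \<and> p (Suc k) = p k \<otimes> x" by (auto simp: fwd_def)
      from someI_ex[OF this] True show ?thesis by (simp add: lab_def)
    next
      case False
      then have "\<exists>x. x \<in> X \<and> p k = p (Suc k) \<otimes> x" using adj[OF k] by (auto simp: fwd_def adj_iff)
      from someI_ex[OF this] False show ?thesis by (simp add: lab_def)
    qed
    then show "lab k \<in> X" "if fwd k then p (Suc k) = p k \<otimes> lab k else p k = p (Suc k) \<otimes> lab k" by auto
  qed
  \<comment> \<open>On a backward edge the parameter is measured from \<open>p (Suc k)\<close>, so
    it decreases from 1 to 0.\<close>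
  define c where "c t = (let k = nat \<lfloor>t\<rfloor> in if t = real k then Vertex (p k)
     else if fwd k then On_edge (p k) (lab k) (t - real k)
     else On_edge (p (Suc k)) (lab k) (real (Suc k) - t))" for t
  have c_int: "c (real k) = Vertex (p k)" for k by (simp add: c_def)
  have split: thesis if t: "0 \<le> t" "t \<le> real n"
    and int: "\<And>k. k \<le> n \<Longrightarrow> t = real k \<Longrightarrow> thesis"
    and frac: "\<And>k. k < n \<Longrightarrow> real k < t \<Longrightarrow> t < real (Suc k) \<Longrightarrow> nat \<lfloor>t\<rfloor> = k \<Longrightarrow> nat \<lceil>t\<rceil> = Suc k \<Longrightarrow> thesis"
    for t thesis
  proof (cases "t = real (nat \<lfloor>t\<rfloor>)")
    case True
    then have "nat \<lfloor>t\<rfloor> \<le> n" using t by linarith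
    then show ?thesis using True int by blast
  next
    case False
    define k where "k = nat \<lfloor>t\<rfloor>"
    have k: "real k \<le> t" "t < real k + 1" using t(1) by (auto simp: k_def)
    have "t \<noteq> real k" using False by (simp add: k_def)
    then have kt: "real k < t" "t < real (Suc k)" using k by auto
    then have "\<lceil>t\<rceil> = int k + 1" by (simp add: ceiling_eq_iff)
    then have "nat \<lceil>t\<rceil> = Suc k" by simp
    moreover have "k < n" using kt(1) t(2) by linarith
    moreover have "nat \<lfloor>t\<rfloor> = k" by (simp add: k_def)
    ultimately show ?thesis using kt by (intro frac)
  qed
  have c_frac: "c t = (if fwd k then On_edge (p k) (lab k) (t - real k) else On_edge (p (Suc k)) (lab k) (real (Suc k) - t))"
    if "nat \<lfloor>t\<rfloor> = k" "real k < t" for t k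
    using that by (auto simp: c_def Let_def)
  have ex: "exits G (c t) = (\<lambda>i. (p i, \<bar>t - real i\<bar>)) ` {nat \<lfloor>t\<rfloor>, nat \<lceil>t\<rceil>}" if t: "0 \<le> t" "t \<le> real n" for t
    using t
  proof (rule split)
    fix k assume k: "k < n" "real k < t" "t < real (Suc k)" "nat \<lfloor>t\<rfloor> = k" "nat \<lceil>t\<rceil> = Suc k"
    have "\<bar>t - real k\<bar> = t - real k" "\<bar>t - real (Suc k)\<bar> = real (Suc k) - t" using k by auto
    then show ?thesis unfolding k(4,5) using lab(2)[OF k(1)] c_frac[OF k(4,2)] by (cases "fwd k") auto
  qed (simp add: c_int)
  have inj: "i = j" if "i \<le> n" "j \<le> n" "p i = p j" for i j using geodesic_inj[OF p that] .
  \<comment> \<open>Different steps never share an edge: a common edge would give equal end points,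
    hence equal indices by injectivity, or two steps each preceding the other.\<close>
  have along: "along_edge (c s) (c t) \<subseteq> {\<bar>s - t\<bar>}" if s: "0 \<le> s" "s \<le> real n" and t: "0 \<le> t" "t \<le> real n" for s t
    using s
  proof (rule split)
    fix k assume k: "k < n" "real k < s" "s < real (Suc k)" "nat \<lfloor>s\<rfloor> = k"
    show ?thesis using t
    proof (rule split)
      fix l assume l: "l < n" "real l < t" "t < real (Suc l)" "nat \<lfloor>t\<rfloor> = l"
      note cc = c_frac[OF k(4,2)] c_frac[OF l(4,2)] and labs = lab(2)[OF k(1)] lab(2)[OF l(1)]
      show ?thesis
      proof (cases "k = l")
        case True
        then show ?thesis unfolding cc by auto
      next
        case False
        have "along_edge (c s) (c t) = {}"
        proof (rule ccontr)
          assume "along_edge (c s) (c t) \<noteq> {}"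
          then have "(fwd k \<and> fwd l \<and> p k = p l) \<or> (\<not> fwd k \<and> \<not> fwd l \<and> p (Suc k) = p (Suc l)) \<or>
            (fwd k \<and> \<not> fwd l \<and> p k = p (Suc l) \<and> lab k = lab l) \<or> (\<not> fwd k \<and> fwd l \<and> p (Suc k) = p l \<and> lab k = lab l)"
            unfolding cc by (auto split: if_splits)
          then consider "p k = p l" | "p (Suc k) = p (Suc l)" | "p k = p (Suc l)" "p (Suc k) = p l"
            using labs by fastforce
          then show False
          proof cases
            case 3
            then have "k = Suc l" "Suc k = l" using inj k l by auto
            then show False by simp
          qed (use inj[of k l] inj[of "Suc k" "Suc l"] k l False in auto)
        qed
        then show ?thesis by simp
      qed
    qed (use cayley_point.exhaust in \<open>auto simp: c_int c_frac[OF k(4,2)]\<close>)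
  qed (simp add: c_int)
  have ends: "nat \<lfloor>t\<rfloor> \<le> n" "nat \<lceil>t\<rceil> \<le> n" if "0 \<le> t" "t \<le> real n" for t
    using that by (auto simp: nat_le_iff ceiling_le_iff floor_le_iff)
  have ub: "\<bar>s - t\<bar> \<in> along_edge (c s) (c t) \<union>
      (\<lambda>((u, a), (v, b)). a + real (vd u v) + b) ` (exits G (c s) \<times> exits G (c t))"
    if s: "0 \<le> s" "s \<le> real n" and t: "0 \<le> t" "t \<le> real n" for s t
  proof -
    have via: ?thesis if "i \<in> {nat \<lfloor>s\<rfloor>, nat \<lceil>s\<rceil>}" "j \<in> {nat \<lfloor>t\<rfloor>, nat \<lceil>t\<rceil>}"
      "\<bar>s - real i\<bar> + \<bar>real i - real j\<bar> + \<bar>t - real j\<bar> = \<bar>s - t\<bar>" for i j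
    proof -
      have "i \<le> n" "j \<le> n" using that(1,2) ends[OF s] ends[OF t] by auto
      then have "\<bar>s - t\<bar> = (\<lambda>((u, a), (v, b)). a + real (vd u v) + b) ((p i, \<bar>s - real i\<bar>), (p j, \<bar>t - real j\<bar>))"
        using that(3) dist by simp
      then show ?thesis unfolding ex[OF s] ex[OF t] using that(1,2) by blast
    qed
    \<comment> \<open>If an integer time separates \<open>s\<close> from \<open>t\<close>, the exits
      facing each other realize the distance; otherwise both points are interior to the same
      edge.\<close>
    consider "\<lceil>s\<rceil> \<le> \<lfloor>t\<rfloor>" | "\<lceil>t\<rceil> \<le> \<lfloor>s\<rfloor>" | "\<lfloor>t\<rfloor> < \<lceil>s\<rceil>" "\<lfloor>s\<rfloor> < \<lceil>t\<rceil>" by linarith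
    then show ?thesis
    proof cases
      case 1
      have "real (nat \<lceil>s\<rceil>) = of_int \<lceil>s\<rceil>" "real (nat \<lfloor>t\<rfloor>) = of_int \<lfloor>t\<rfloor>" using s t by auto
      then show ?thesis using 1 by (intro via[of "nat \<lceil>s\<rceil>" "nat \<lfloor>t\<rfloor>"]) (simp_all, linarith)
    next
      case 2
      have "real (nat \<lceil>t\<rceil>) = of_int \<lceil>t\<rceil>" "real (nat \<lfloor>s\<rfloor>) = of_int \<lfloor>s\<rfloor>" using s t by auto
      then show ?thesis using 2 by (intro via[of "nat \<lfloor>s\<rfloor>" "nat \<lceil>t\<rceil>"]) (simp_all, linarith)
    next
      case 3
      have fl: "\<lfloor>s\<rfloor> = \<lfloor>t\<rfloor>" using 3 by linarith
      have ks: "of_int \<lfloor>s\<rfloor> < s" "of_int \<lfloor>t\<rfloor> < t" using 3 fl by (simp_all add: less_ceiling_iff)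
      define k where "k = nat \<lfloor>s\<rfloor>"
      have "nat \<lfloor>t\<rfloor> = k" "real k < s" "real k < t" using fl ks s t by (auto simp: k_def)
      then show ?thesis using c_frac[of s k] c_frac[of t k] by (auto simp: k_def)
    qed
  qed
  have lb: "\<bar>s - t\<bar> \<le> r" if s: "0 \<le> s" "s \<le> real n" and t: "0 \<le> t" "t \<le> real n"
    and r: "r \<in> along_edge (c s) (c t) \<union> (\<lambda>((u, a), (v, b)). a + real (vd u v) + b) ` (exits G (c s) \<times> exits G (c t))" for r s t
    using r
  proof
    assume "r \<in> along_edge (c s) (c t)"
    then show ?thesis using along[OF s t] by auto
  next
    assume "r \<in> (\<lambda>((u, a), (v, b)). a + real (vd u v) + b) ` (exits G (c s) \<times> exits G (c t))"
    then obtain i j where ij: "i \<in> {nat \<lfloor>s\<rfloor>, nat \<lceil>s\<rceil>}" "j \<in> {nat \<lfloor>t\<rfloor>, nat \<lceil>t\<rceil>}"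
      "r = \<bar>s - real i\<bar> + real (vd (p i) (p j)) + \<bar>t - real j\<bar>" unfolding ex[OF s] ex[OF t] by auto
    then have "i \<le> n" "j \<le> n" using ends[OF s] ends[OF t] by auto
    then show ?thesis using ij(3) dist by simp
  qed
  have cd: "cayley_dist G X (c s) (c t) = \<bar>s - t\<bar>" if s: "0 \<le> s" "s \<le> real n" and t: "0 \<le> t" "t \<le> real n" for s t
    unfolding cayley_dist_def using lb[OF s t] ub[OF s t] by (intro Min_eqI) auto
  have pts: "c t \<in> cayley_points G X" if t: "0 \<le> t" "t \<le> real n" for t
    using t
  proof (rule split)
    fix k assume k: "k < n" "real k < t" "t < real (Suc k)" "nat \<lfloor>t\<rfloor> = k"
    then show ?thesis using c_frac[OF k(4,2)] lab(1)[OF k(1)] pG[of k] pG[of "Suc k"]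
      by (auto simp: cayley_points_def)
  qed (use pG in \<open>auto simp: c_int cayley_points_def\<close>)
  show thesis using that[of c] c_int pts ex cd by blast
qed

section \<open>Thin triangles and the four-point inequality\<close>

definition between :: "'a \<Rightarrow> 'a \<Rightarrow> 'a \<Rightarrow> bool" where
  "between g q h \<longleftrightarrow> q \<in> carrier G \<and> vd g q + vd q h = vd g h"

lemma geodesic_between:
  assumes "geodesic p n" "k \<le> n"
  shows "between (p 0) (p k) (p n)"
proof -
  have "real (vd (p 0) (p k)) = real k" "real (vd (p k) (p n)) = real (n - k)" "real (vd (p 0) (p n)) = real n"
    using assms by (auto simp: geodesic_def)
  then show ?thesis using assms by (simp add: between_def geodesic_def)
qed

text \<open>The point that thinness provides may lie inside an edge. A path to it from a vertex
  enters through one of its exits, which is a vertex of the same geodesic and no farther away, so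
  the bound \<open>\<epsilon>\<close> survives without rounding.\<close>

lemma thin_vertex_triangles:
  assumes thin: "thin_triangles (cayley_points G X) (cayley_dist G X) \<epsilon>"
    and p: "geodesic p n" "k \<le> n" and z: "z \<in> carrier G"
  shows "\<exists>q. (between (p n) q z \<or> between z q (p 0)) \<and> real (vd (p k) q) < \<epsilon>"
proof -
  let ?M = "cayley_points G X" and ?d = "cayley_dist G X"
  have side: "\<exists>A. geodesic_segment ?M ?d (Vertex (r 0)) (Vertex (r m)) A \<and> (\<forall>i\<le>m. Vertex (r i) \<in> A) \<and>
      (\<forall>a\<in>A. \<forall>g. ?d (Vertex g) a < \<epsilon> \<longrightarrow> (\<exists>i\<le>m. real (vd g (r i)) < \<epsilon>))"
    if r: "geodesic r m" for r m
    using r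
  proof (rule geodesic_realization)
    fix c assume c: "\<And>k. k \<le> m \<Longrightarrow> c (real k) = Vertex (r k)"
      "\<And>t. 0 \<le> t \<Longrightarrow> t \<le> real m \<Longrightarrow> c t \<in> ?M"
      "\<And>t. 0 \<le> t \<Longrightarrow> t \<le> real m \<Longrightarrow> exits G (c t) = (\<lambda>i. (r i, \<bar>t - real i\<bar>)) ` {nat \<lfloor>t\<rfloor>, nat \<lceil>t\<rceil>}"
      "\<And>s t. 0 \<le> s \<Longrightarrow> s \<le> real m \<Longrightarrow> 0 \<le> t \<Longrightarrow> t \<le> real m \<Longrightarrow> ?d (c s) (c t) = \<bar>s - t\<bar>"
    have "geodesic_segment ?M ?d (Vertex (r 0)) (Vertex (r m)) (c ` {0..real m})"
      unfolding geodesic_segment_def using c(2,4) c(1)[of 0] c(1)[of m]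
      by (intro exI[of _ c] exI[of _ "real m"]) auto
    moreover have "Vertex (r i) \<in> c ` {0..real m}" if "i \<le> m" for i
      using c(1)[OF that] that by (intro image_eqI[of _ c "real i"]) auto
    moreover have "\<exists>i\<le>m. real (vd g (r i)) < \<epsilon>" if a: "a \<in> c ` {0..real m}" and near: "?d (Vertex g) a < \<epsilon>" for a g
    proof -
      obtain t where t: "0 \<le> t" "t \<le> real m" "a = c t" using a by auto
      let ?E = "(\<lambda>((u, a), (v, b)). a + real (vd u v) + b) ` (exits G (Vertex g) \<times> exits G (c t))"
      have "?E \<noteq> {}" "finite ?E" unfolding c(3)[OF t(1,2)] by simp_all
      then have "Min ?E \<in> ?E" by (intro Min_in)
      \<comment> \<open>A vertex lies in no open edge, so only the routes through exits
        compete.\<close>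
      moreover have "?d (Vertex g) a = Min ?E" unfolding t(3) cayley_dist_def by simp
      ultimately obtain i where i: "i \<in> {nat \<lfloor>t\<rfloor>, nat \<lceil>t\<rceil>}" "?d (Vertex g) a = real (vd g (r i)) + \<bar>t - real i\<bar>"
        unfolding c(3)[OF t(1,2)] by auto
      have "i \<le> m" using i(1) t by (auto simp: nat_le_iff ceiling_le_iff floor_le_iff)
      moreover have "real (vd g (r i)) < \<epsilon>" using i(2) near by linarith
      ultimately show ?thesis by blast
    qed
    ultimately show ?thesis by (intro exI[of _ "c ` {0..real m}"]) blast
  qed
  have pG: "p 0 \<in> carrier G" "p n \<in> carrier G" using p(1) by (auto simp: geodesic_def)
  obtain r m where r: "geodesic r m" "r 0 = p n" "r m = z" by (rule geodesic_exists[OF pG(2) z])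
  obtain s l where s: "geodesic s l" "s 0 = z" "s l = p 0" by (rule geodesic_exists[OF z pG(1)])
  obtain A where A: "geodesic_segment ?M ?d (Vertex (p 0)) (Vertex (p n)) A" "\<forall>i\<le>n. Vertex (p i) \<in> A"
    using side[OF p(1)] by (elim exE conjE)
  obtain B where B: "geodesic_segment ?M ?d (Vertex (p n)) (Vertex z) B"
    "\<forall>a\<in>B. \<forall>g. ?d (Vertex g) a < \<epsilon> \<longrightarrow> (\<exists>i\<le>m. real (vd g (r i)) < \<epsilon>)"
    using side[OF r(1)] unfolding r(2,3) by (elim exE conjE)
  obtain C where C: "geodesic_segment ?M ?d (Vertex z) (Vertex (p 0)) C"
    "\<forall>a\<in>C. \<forall>g. ?d (Vertex g) a < \<epsilon> \<longrightarrow> (\<exists>i\<le>l. real (vd g (s i)) < \<epsilon>)"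
    using side[OF s(1)] unfolding s(2,3) by (elim exE conjE)
  have "A \<subseteq> metric_nbhd ?M ?d \<epsilon> (B \<union> C)"
    using thin A(1) B(1) C(1) unfolding thin_triangles_def by blast
  then obtain a where a: "a \<in> B \<union> C" "?d (Vertex (p k)) a < \<epsilon>"
    using A(2) p(2) unfolding metric_nbhd_def by blast
  from a(1) show ?thesis
  proof
    assume "a \<in> B"
    then obtain i where "i \<le> m" "real (vd (p k) (r i)) < \<epsilon>" using B(2) a(2) by blast
    then show ?thesis using geodesic_between[OF r(1), of i] r(2,3) by auto
  next
    assume "a \<in> C"
    then obtain i where "i \<le> l" "real (vd (p k) (s i)) < \<epsilon>" using C(2) a(2) by blast
    then show ?thesis using geodesic_between[OF s(1), of i] s(2,3) by auto
  qed
qed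

text \<open>
  Somewhere along a side \<open>xz\<close> of a thin triangle \<open>wxz\<close> a vertex \<open>q\<close> is near both other sides; its
  distance from \<open>w\<close> is nearly the Gromov product of \<open>x\<close> and \<open>z\<close>. As \<open>q\<close> is also near the side
  \<open>xy\<close> or \<open>yz\<close> of the triangle \<open>xyz\<close>, the Gromov product of those vertices is not much larger.
\<close>

lemma thin_triangles_four_point:
  assumes thin: "thin_triangles (cayley_points G X) (cayley_dist G X) \<epsilon>" and D: "\<epsilon> \<le> real D"
    and w: "w \<in> carrier G" and xyz: "x \<in> carrier G" "y \<in> carrier G" "z \<in> carrier G"
  shows "min (int (vd w x) + int (vd w y) - int (vd x y)) (int (vd w y) + int (vd w z) - int (vd y z))
    - int (6 * D + 2) \<le> int (vd w x) + int (vd w z) - int (vd x z)"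
proof -
  define n where "n = vd x z"
  obtain p where p: "geodesic p n" "p 0 = x" "p n = z"
    unfolding n_def by (rule geodesic_exists[OF xyz(1,3)])
  have pG: "p k \<in> carrier G" if "k \<le> n" for k using p(1) that by (simp add: geodesic_def)
  have thin': "\<exists>q. (between z q v \<or> between v q x) \<and> vd (p k) q \<le> D" if vk: "v \<in> carrier G" "k \<le> n" for v k
  proof -
    obtain q where "between z q v \<or> between v q x" "real (vd (p k) q) < \<epsilon>"
      using thin_vertex_triangles[OF thin p(1) vk(2,1)] p by auto
    then show ?thesis using D by (intro exI[of _ q]) auto
  qed
  \<comment> \<open>A vertex between \<open>a\<close> and \<open>b\<close> is at least as far from
    \<open>w\<close> as their Gromov product.\<close>
  have proj: "2 * vd w q + vd a b \<ge> vd w a + vd w b" if "between a q b" "a \<in> carrier G" "b \<in> carrier G" for a b q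
    using that vd_triangle[of w q a] vd_triangle[of w q b] vd_sym[of a q] w by (auto simp: between_def)
  \<comment> \<open>Discrete intermediate value: the start \<open>x\<close> is near the side
    \<open>wx\<close>. Where nearness first fails, the vertex is near \<open>wz\<close> instead, and
    its predecessor is one step away, hence \<open>D + 1\<close>. If the last vertex is near, it is
    \<open>z\<close>, which lies on \<open>wz\<close> itself.\<close>
  define near where "near k \<longleftrightarrow> (\<exists>q. between w q x \<and> vd (p k) q \<le> D)" for k
  obtain k q q' where k: "k \<le> n" and q: "between w q x" "vd (p k) q \<le> D"
    and q': "between z q' w" "vd (p k) q' \<le> D + 1"
  proof (cases "near n")
    case True
    then obtain q where "between w q x" "vd (p n) q \<le> D" by (auto simp: near_def)
    moreover have "between z z w" "vd (p n) z \<le> D + 1" using xyz p by (auto simp: between_def)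
    ultimately show thesis using that by blast
  next
    case False
    have "near 0" using xyz p by (auto simp: near_def between_def intro!: exI[of _ x])
    then obtain k where k: "k < n" "near k" "\<not> near (Suc k)"
      using ex_least_nat_less[of "\<lambda>k. \<not> near k" n] False by blast
    then obtain q where q: "between w q x" "vd (p k) q \<le> D" by (auto simp: near_def)
    obtain q' where q': "between z q' w" "vd (p (Suc k)) q' \<le> D"
      using thin'[OF w, of "Suc k"] k by (auto simp: near_def)
    have "real (vd (p k) (p (Suc k))) = 1" using p(1) k(1) by (simp add: geodesic_def)
    then have "vd (p k) q' \<le> D + 1"
      using vd_triangle[of "p k" "p (Suc k)" q'] q' pG k(1) by (simp add: between_def)
    then show thesis using that[of k q q'] q q' k(1) by simp
  qed
  let ?p = "p k"
  have b: "vd x ?p + vd ?p z = vd x z" using geodesic_between[OF p(1) k] p by (simp add: between_def)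
  have qG: "q \<in> carrier G" "q' \<in> carrier G" using q q' by (auto simp: between_def)
  have "vd w ?p \<le> vd w q + D" "vd ?p x \<le> D + vd q x" "vd w ?p \<le> vd w q' + (D + 1)" "vd ?p z \<le> (D + 1) + vd q' z"
    using vd_triangle[of w q ?p] vd_triangle[of ?p q x] vd_triangle[of w q' ?p] vd_triangle[of ?p q' z]
      vd_sym[of q ?p] vd_sym[of q' ?p] w pG[OF k] qG xyz q q' by auto
  \<comment> \<open>Twice \<open>D\<close> from the side \<open>wx\<close> and twice
    \<open>D + 1\<close> from \<open>wz\<close>; the vertex \<open>r\<close> below adds another
    \<open>2 * D\<close>, giving \<open>6 * D + 2\<close>.\<close>
  then have 1: "2 * vd w ?p + vd x z \<le> vd w x + vd w z + (4 * D + 2)"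
    using q(1) q'(1) b vd_sym[of x ?p] vd_sym[of z q'] vd_sym[of q' w] vd_sym[of z w] w pG[OF k] qG xyz
    by (auto simp: between_def)
  obtain r where r: "between z r y \<or> between y r x" "vd ?p r \<le> D" using thin'[OF xyz(2) k] by blast
  have rG: "r \<in> carrier G" using r by (auto simp: between_def)
  have 2: "vd w r \<le> vd w ?p + D" using vd_triangle[of w ?p r] r w pG[OF k] rG by simp
  from r(1) have "2 * vd w r + vd y z \<ge> vd w y + vd w z \<or> 2 * vd w r + vd x y \<ge> vd w x + vd w y"
    using proj[of z r y] proj[of y r x] xyz vd_sym[of z y] vd_sym[of y x] by auto
  then show ?thesis using 1 2 by auto
qed

lemma hyperbolic_length:
  assumes thin: "thin_triangles (cayley_points G X) (cayley_dist G X) \<epsilon>"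
  shows "\<exists>\<delta>. hyperbolic_length G (\<lambda>g. int (vd \<one> g)) X \<delta>"
proof (intro exI hyperbolic_length.intro hyperbolic_length_axioms.intro group_axioms)
  let ?D = "nat \<lceil>\<epsilon>\<rceil>"
  fix x y z assume xyz: "x \<in> carrier G" "y \<in> carrier G" "z \<in> carrier G"
  have D: "\<epsilon> \<le> real ?D" by linarith
  show "min (int (vd \<one> x) + int (vd \<one> y) - int (vd \<one> (inv x \<otimes> y)))
      (int (vd \<one> y) + int (vd \<one> z) - int (vd \<one> (inv y \<otimes> z))) - int (6 * ?D + 2)
    \<le> int (vd \<one> x) + int (vd \<one> z) - int (vd \<one> (inv x \<otimes> z))"
    using thin_triangles_four_point[OF thin D one_closed xyz] xyz by (simp only: vd_eq_len)
next
  fix x assume x: "x \<in> carrier G"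
  show "int (vd \<one> (inv x)) = int (vd \<one> x)"
    using vd_eq_len[of x \<one>] vd_sym[of x \<one>] x by simp
  fix r assume r: "0 \<le> r" "r \<le> int (vd \<one> x)"
  obtain p where p: "geodesic p (vd \<one> x)" "p 0 = \<one>" "p (vd \<one> x) = x"
    by (rule geodesic_exists[OF one_closed x])
  have k: "nat r \<le> vd \<one> x" using r by simp
  have pG: "p (nat r) \<in> carrier G" using p(1) k by (simp add: geodesic_def)
  have "real (vd (p 0) (p (nat r))) = real (nat r)" using p(1) k by (simp add: geodesic_def)
  then have "vd \<one> (p (nat r)) = nat r" using p(2) by simp
  moreover have "vd \<one> (p (nat r)) + vd (p (nat r)) x = vd \<one> x"
    using geodesic_between[OF p(1) k] p by (simp add: between_def)
  ultimately show "\<exists>q\<in>carrier G. int (vd \<one> q) = r \<and> int (vd \<one> (inv q \<otimes> x)) = int (vd \<one> x) - r"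
    using pG vd_eq_len[OF pG x] r by (intro bexI[of _ "p (nat r)"]) auto
next
  fix x y assume xy: "x \<in> carrier G" "y \<in> carrier G"
  show "int (vd \<one> (x \<otimes> y)) \<le> int (vd \<one> x) + int (vd \<one> y)"
    using vd_triangle[of \<one> x "x \<otimes> y"] vd_eq_len[of x "x \<otimes> y"] xy by simp
next
  fix r show "finite {x \<in> carrier G. int (vd \<one> x) \<le> r}"
    by (rule finite_subset[OF _ finite_ball[of "nat r"]]) auto
qed (auto simp: finite_X X_gen intro: subsetD[OF X_carrier])

end

section \<open>Primitivity from a comaximal right ideal\<close>

text \<open>Closure under negatives follows on multiplying by
  \<open>\<ominus> \<one>\<close>.\<close>

definition right_ideal :: "('s, 'n) ring_scheme \<Rightarrow> 's set \<Rightarrow> bool" where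
  "right_ideal S J \<longleftrightarrow> J \<subseteq> carrier S \<and> \<zero>\<^bsub>S\<^esub> \<in> J \<and> (\<forall>a\<in>J. \<forall>b\<in>J. a \<oplus>\<^bsub>S\<^esub> b \<in> J) \<and>
     (\<forall>a\<in>J. \<forall>s\<in>carrier S. a \<otimes>\<^bsub>S\<^esub> s \<in> J)"

lemma right_ideal_minus:
  fixes S (structure)
  assumes "ring S" "right_ideal S J" "a \<in> J"
  shows "\<ominus> a \<in> J"
proof -
  interpret ring S by fact
  have "a \<in> carrier S" using assms by (auto simp: right_ideal_def)
  then have "\<ominus> a = a \<otimes> (\<ominus> \<one>)" by (simp add: r_minus)
  then show ?thesis using assms by (simp add: right_ideal_def)
qed

lemma right_ideal_Union_chain:
  assumes "\<C> \<noteq> {}" "\<And>K. K \<in> \<C> \<Longrightarrow> right_ideal S K" "\<And>K L. K \<in> \<C> \<Longrightarrow> L \<in> \<C> \<Longrightarrow> K \<subseteq> L \<or> L \<subseteq> K"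
  shows "right_ideal S (\<Union>\<C>)"
  unfolding right_ideal_def
proof (intro conjI ballI)
  show "\<Union>\<C> \<subseteq> carrier S" "\<zero>\<^bsub>S\<^esub> \<in> \<Union>\<C>" using assms(1,2) unfolding right_ideal_def by blast+
  fix a assume "a \<in> \<Union>\<C>"
  then obtain K where K: "K \<in> \<C>" "a \<in> K" by blast
  then show "a \<otimes>\<^bsub>S\<^esub> s \<in> \<Union>\<C>" if "s \<in> carrier S" for s
    using assms(2)[OF K(1)] that unfolding right_ideal_def by blast
  fix b assume "b \<in> \<Union>\<C>"
  then obtain L where L: "L \<in> \<C>" "b \<in> L" by blast
  show "a \<oplus>\<^bsub>S\<^esub> b \<in> \<Union>\<C>"
    using assms(3)[OF K(1) L(1)] assms(2)[OF K(1)] assms(2)[OF L(1)] K L unfolding right_ideal_def by blast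
qed

lemma maximal_right_ideal_exists:
  assumes J: "right_ideal S J" "\<one>\<^bsub>S\<^esub> \<notin> J"
  shows "\<exists>M. right_ideal S M \<and> J \<subseteq> M \<and> \<one>\<^bsub>S\<^esub> \<notin> M \<and>
    (\<forall>K. right_ideal S K \<longrightarrow> M \<subseteq> K \<longrightarrow> \<one>\<^bsub>S\<^esub> \<notin> K \<longrightarrow> K = M)"
proof -
  define A where "A = {K. right_ideal S K \<and> J \<subseteq> K \<and> \<one>\<^bsub>S\<^esub> \<notin> K}"
  have "\<exists>M\<in>A. \<forall>K\<in>A. M \<subseteq> K \<longrightarrow> K = M"
  proof (rule subset_Zorn_nonempty)
    show "A \<noteq> {}" using J by (auto simp: A_def)
    fix \<C> assume C: "\<C> \<noteq> {}" "subset.chain A \<C>"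
    then have "\<C> \<subseteq> A" "\<And>K L. K \<in> \<C> \<Longrightarrow> L \<in> \<C> \<Longrightarrow> K \<subseteq> L \<or> L \<subseteq> K"
      by (auto simp: subset_chain_def)
    then show "\<Union>\<C> \<in> A" using C(1) right_ideal_Union_chain[of \<C> S] by (auto simp: A_def)
  qed
  then obtain M where M: "M \<in> A" "\<forall>K\<in>A. M \<subseteq> K \<longrightarrow> K = M" by (elim bexE)
  then show ?thesis by (intro exI[of _ M]) (auto simp: A_def)
qed

text \<open>Enlarge \<open>J\<close> to a maximal right ideal \<open>M\<close> and take
  \<open>S\<close> modulo \<open>M\<close>, which is simple. Its annihilator is a two-sided ideal
  contained in \<open>M\<close>; if it were not zero, it would contain some \<open>e\<close> with
  \<open>\<one> \<oplus> e \<in> M\<close>, so \<open>\<one> \<in> M\<close>.\<close>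

lemma right_primitive_of_comaximal:
  fixes S (structure)
  assumes S: "ring S" and J: "right_ideal S J" "\<one> \<notin> J"
    and comax: "\<And>I. ideal I S \<Longrightarrow> I \<noteq> {\<zero>} \<Longrightarrow> \<exists>e\<in>I. \<one> \<oplus> e \<in> J"
  shows "right_primitive S"
proof -
  interpret ring S by fact
  obtain M where M: "right_ideal S M" "J \<subseteq> M" "\<one> \<notin> M"
    "\<And>K. right_ideal S K \<Longrightarrow> M \<subseteq> K \<Longrightarrow> \<one> \<notin> K \<Longrightarrow> K = M"
    using maximal_right_ideal_exists[OF J] by blast
  have MS: "a \<in> carrier S" if "a \<in> M" for a using M(1) that by (auto simp: right_ideal_def)
  have Madd: "a \<oplus> b \<in> M" if "a \<in> M" "b \<in> M" for a b using M(1) that by (auto simp: right_ideal_def)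
  have Mmult: "a \<otimes> s \<in> M" if "a \<in> M" "s \<in> carrier S" for a s using M(1) that by (auto simp: right_ideal_def)
  have M0: "\<zero> \<in> M" using M(1) by (auto simp: right_ideal_def)
  have Mneg: "\<ominus> a \<in> M" if "a \<in> M" for a by (rule right_ideal_minus[OF S M(1) that])
  \<comment> \<open>Cosets are sets of ring elements, the carrier type that
    \<open>right_primitive\<close> asks for.\<close>
  define cl where "cl a = {b \<in> carrier S. b \<ominus> a \<in> M}" for a
  have cl_eq: "cl a = cl b \<longleftrightarrow> a \<ominus> b \<in> M" if ab: "a \<in> carrier S" "b \<in> carrier S" for a b
  proof
    assume "cl a = cl b"
    moreover have "a \<in> cl a" using ab M0 by (simp add: cl_def r_neg minus_eq)
    ultimately show "a \<ominus> b \<in> M" by (simp add: cl_def)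
  next
    assume d: "a \<ominus> b \<in> M"
    have tele: "x \<ominus> z = (x \<ominus> y) \<oplus> (y \<ominus> z)" if "x \<in> carrier S" "y \<in> carrier S" "z \<in> carrier S" for x y z
      using that by (simp add: minus_eq a_assoc r_neg1)
    have "\<ominus> (a \<ominus> b) = b \<ominus> a" using ab by (simp add: minus_eq minus_add a_comm)
    then have "b \<ominus> a \<in> M" using Mneg[OF d] by simp
    then have "c \<ominus> b \<in> M \<longleftrightarrow> c \<ominus> a \<in> M" if "c \<in> carrier S" for c
      using tele[OF that ab] tele[OF that ab(2,1)] Madd d by metis
    then show "cl a = cl b" by (auto simp: cl_def)
  qed
  define rep where "rep X = (SOME a. a \<in> carrier S \<and> cl a = X)" for X
  have rep: "rep (cl a) \<in> carrier S" "cl (rep (cl a)) = cl a" if "a \<in> carrier S" for a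
    using someI_ex[of "\<lambda>b. b \<in> carrier S \<and> cl b = cl a"] that by (auto simp: rep_def)
  have rep_diff: "rep (cl a) \<ominus> a \<in> M" if "a \<in> carrier S" for a
    using cl_eq[OF rep(1)[OF that] that] rep(2)[OF that] by simp
  define N :: "('a, 'a set) module" where
    "N = \<lparr>carrier = cl ` carrier S, mult = undefined, one = undefined, zero = cl \<zero>,
          add = (\<lambda>x y. cl (rep x \<oplus> rep y)), smult = (\<lambda>s x. cl (rep x \<otimes> s))\<rparr>"
  have add: "cl a \<oplus>\<^bsub>N\<^esub> cl b = cl (a \<oplus> b)" if ab: "a \<in> carrier S" "b \<in> carrier S" for a b
  proof -
    from Madd[OF rep_diff[OF ab(1)] rep_diff[OF ab(2)]] have "(rep (cl a) \<oplus> rep (cl b)) \<ominus> (a \<oplus> b) \<in> M"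
      using rep(1) ab by (simp add: minus_eq minus_add a_ac)
    then show ?thesis using cl_eq rep(1) ab by (simp add: N_def)
  qed
  have smult: "s \<odot>\<^bsub>N\<^esub> cl a = cl (a \<otimes> s)" if a: "a \<in> carrier S" and s: "s \<in> carrier S" for a s
  proof -
    from Mmult[OF rep_diff[OF a] s] have "(rep (cl a) \<otimes> s) \<ominus> (a \<otimes> s) \<in> M"
      using rep(1) a s by (simp add: minus_eq l_distr l_minus)
    then show ?thesis using cl_eq rep(1) a s by (simp add: N_def)
  qed
  have carr: "carrier N = cl ` carrier S" and zero: "\<zero>\<^bsub>N\<^esub> = cl \<zero>" by (simp_all add: N_def)
  have ab: "abelian_group N"
  proof (rule abelian_groupI)
    fix x assume "x \<in> carrier N"
    then show "\<exists>y\<in>carrier N. y \<oplus>\<^bsub>N\<^esub> x = \<zero>\<^bsub>N\<^esub>"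
      by (auto simp: carr zero add l_neg intro!: bexI[of _ "\<ominus> _"])
  qed (auto simp: carr zero add a_ac)
  have rm: "right_module S N"
    by (intro right_module.intro ab ring_axioms right_module_axioms.intro)
       (auto simp: carr zero add smult l_distr r_distr m_assoc)
  have zero_iff: "cl a = \<zero>\<^bsub>N\<^esub> \<longleftrightarrow> a \<in> M" if "a \<in> carrier S" for a
    using cl_eq[OF that zero_closed] that by (simp add: zero minus_eq)
  have "simple_right_module S N"
    unfolding simple_right_module_def
  proof (intro conjI rm allI impI)
    show "carrier N \<noteq> {\<zero>\<^bsub>N\<^esub>}" using zero_iff[OF one_closed] M(3) by (auto simp: carr)
    fix L assume L: "right_submodule S N L"
    define K where "K = {a \<in> carrier S. cl a \<in> L}"
    have "right_ideal S K"
      unfolding right_ideal_def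
    proof (intro conjI ballI)
      show "K \<subseteq> carrier S" "\<zero> \<in> K" using L by (auto simp: K_def right_submodule_def zero)
      fix a assume a: "a \<in> K"
      show "a \<oplus> b \<in> K" if "b \<in> K" for b
        using a that L by (simp add: K_def right_submodule_def add[symmetric])
      show "a \<otimes> s \<in> K" if "s \<in> carrier S" for s
        using a that L by (simp add: K_def right_submodule_def smult[symmetric])
    qed
    moreover have "M \<subseteq> K"
    proof
      fix a assume a: "a \<in> M"
      then have "cl a = \<zero>\<^bsub>N\<^esub>" using zero_iff MS by simp
      then show "a \<in> K" using L a MS by (simp add: K_def right_submodule_def)
    qed
    ultimately have "K = M \<or> \<one> \<in> K" using M(4) by blast
    moreover have LK: "L = cl ` K" using L by (auto simp: K_def right_submodule_def carr)
    moreover have "K = carrier S" if "\<one> \<in> K"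
    proof -
      have "a \<in> K" if "a \<in> carrier S" for a
        using \<open>right_ideal S K\<close> \<open>\<one> \<in> K\<close> that l_one[OF that] unfolding right_ideal_def by metis
      then show ?thesis by (auto simp: K_def)
    qed
    moreover have "cl ` M = {\<zero>\<^bsub>N\<^esub>}"
    proof -
      have "cl a = \<zero>\<^bsub>N\<^esub>" if "a \<in> M" for a using zero_iff[OF MS[OF that]] that by simp
      then have "cl ` M = (\<lambda>_. \<zero>\<^bsub>N\<^esub>) ` M" by (intro image_cong) auto
      then show ?thesis using M0 by (simp add: image_constant)
    qed
    ultimately show "L = {\<zero>\<^bsub>N\<^esub>} \<or> L = carrier N" by (auto simp: carr)
  qed
  moreover have "faithful_right_module S N"
    unfolding faithful_right_module_def
  proof (intro conjI rm ballI impI, rule ccontr)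
    fix s assume s: "s \<in> carrier S" "\<forall>x\<in>carrier N. s \<odot>\<^bsub>N\<^esub> x = \<zero>\<^bsub>N\<^esub>" "s \<noteq> \<zero>"
    \<comment> \<open>The annihilator of \<open>N\<close>: \<open>a \<otimes> s \<in> M\<close> for
      all \<open>a\<close> says that \<open>s\<close> kills every coset, and
      \<open>a = \<one>\<close> places \<open>s\<close> in \<open>M\<close>.\<close>
    define I where "I = {s \<in> carrier S. \<forall>a\<in>carrier S. a \<otimes> s \<in> M}"
    have sI: "s \<in> I" using s(1,2) zero_iff smult by (auto simp: I_def carr)
    have "ideal I S"
    proof (rule idealI)
      show "ring S" by fact
      show "subgroup I (add_monoid S)"
      proof (rule add.subgroupI)
        show "I \<subseteq> carrier S" by (auto simp: I_def)
        show "I \<noteq> {}" using sI by blast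
        fix x assume x: "x \<in> I"
        then show "\<ominus> x \<in> I" using Mneg by (auto simp: I_def r_minus)
        fix y assume "y \<in> I"
        then show "x \<oplus> y \<in> I" using x Madd by (auto simp: I_def r_distr)
      qed
      fix a x assume ax: "a \<in> I" "x \<in> carrier S"
      have "b \<otimes> (x \<otimes> a) \<in> M" if "b \<in> carrier S" for b
        using ax that by (simp add: I_def m_assoc[symmetric])
      then show "x \<otimes> a \<in> I" using ax by (auto simp: I_def)
      have "b \<otimes> (a \<otimes> x) \<in> M" if "b \<in> carrier S" for b
        using ax that Mmult by (simp add: I_def m_assoc[symmetric])
      then show "a \<otimes> x \<in> I" using ax by (auto simp: I_def)
    qed
    moreover have "I \<noteq> {\<zero>}" using sI s(3) by blast
    ultimately obtain e where e: "e \<in> I" "\<one> \<oplus> e \<in> M" using comax M(2) by blast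
    have eS: "e \<in> carrier S" and "\<one> \<otimes> e \<in> M" using e(1) one_closed unfolding I_def by blast+
    then have "\<ominus> e \<in> M" using Mneg by simp
    from Madd[OF e(2) this] have "\<one> \<in> M" using eS by (simp add: a_assoc r_neg)
    then show False using M(3) by blast
  qed
  ultimately show ?thesis by (auto simp: right_primitive_def)
qed

section \<open>Computations in group rings\<close>

locale group_ring_setup = R: ring R + G: group G for R (structure) and G (structure)
begin

abbreviation A where "A \<equiv> group_ring R G"
abbreviation supp where "supp f \<equiv> {x. f x \<noteq> \<zero>\<^bsub>R\<^esub>}"

sublocale A: ring A
  by (rule group_ring_is_ring[OF R.ring_axioms G.group_axioms])

lemma carrier_iff: "f \<in> carrier A \<longleftrightarrow> (\<forall>g. f g \<in> carrier R) \<and> (\<forall>g. g \<notin> carrier G \<longrightarrow> f g = \<zero>\<^bsub>R\<^esub>) \<and> finite (supp f)"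
  by (simp add: group_ring_def)

lemma coeff_closed [simp]: "f \<in> carrier A \<Longrightarrow> f g \<in> carrier R"
  by (simp add: carrier_iff)

lemma coeff_outside: "f \<in> carrier A \<Longrightarrow> g \<notin> carrier G \<Longrightarrow> f g = \<zero>\<^bsub>R\<^esub>"
  by (simp add: carrier_iff)

lemma supp_carrier: "f \<in> carrier A \<Longrightarrow> supp f \<subseteq> carrier G"
  by (auto simp: carrier_iff)

lemma finite_supp: "f \<in> carrier A \<Longrightarrow> finite (supp f)"
  by (simp add: carrier_iff)

lemma zero_apply: "\<zero>\<^bsub>A\<^esub> g = \<zero>\<^bsub>R\<^esub>" and one_apply: "\<one>\<^bsub>A\<^esub> g = (if g = \<one>\<^bsub>G\<^esub> then \<one>\<^bsub>R\<^esub> else \<zero>\<^bsub>R\<^esub>)"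
  and add_apply: "(f \<oplus>\<^bsub>A\<^esub> h) g = f g \<oplus>\<^bsub>R\<^esub> h g"
  unfolding group_ring_def by simp_all

lemma eq_zero_iff: "f = \<zero>\<^bsub>A\<^esub> \<longleftrightarrow> (\<forall>g. f g = \<zero>\<^bsub>R\<^esub>)"
  by (simp add: fun_eq_iff zero_apply)

lemma minus_apply: "f \<in> carrier A \<Longrightarrow> (\<ominus>\<^bsub>A\<^esub> f) g = \<ominus>\<^bsub>R\<^esub> f g"
proof -
  assume f: "f \<in> carrier A"
  have "(\<ominus>\<^bsub>A\<^esub> f \<oplus>\<^bsub>A\<^esub> f) g = \<zero>\<^bsub>A\<^esub> g" using f by (simp only: A.l_neg)
  then have "(\<ominus>\<^bsub>A\<^esub> f) g \<oplus>\<^bsub>R\<^esub> f g = \<zero>\<^bsub>R\<^esub>" by (simp only: add_apply zero_apply)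
  then show "(\<ominus>\<^bsub>A\<^esub> f) g = \<ominus>\<^bsub>R\<^esub> f g" using f by (intro R.minus_equality[symmetric]) auto
qed

lemma mult_apply:
  assumes "f \<in> carrier A" "h \<in> carrier A" "finite B" "supp f \<subseteq> B" "g \<in> carrier G"
  shows "(f \<otimes>\<^bsub>A\<^esub> h) g = (\<Oplus>\<^bsub>R\<^esub>x\<in>B. f x \<otimes>\<^bsub>R\<^esub> h (inv\<^bsub>G\<^esub> x \<otimes>\<^bsub>G\<^esub> g))"
  using group_ring_mult_eq[OF R.ring_axioms G.group_axioms assms] .

lemma finsum_apply:
  assumes "finite I" "\<And>i. i \<in> I \<Longrightarrow> F i \<in> carrier A"
  shows "(\<Oplus>\<^bsub>A\<^esub>i\<in>I. F i) g = (\<Oplus>\<^bsub>R\<^esub>i\<in>I. F i g)"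
  using assms
proof (induction I)
  case empty
  then show ?case by (simp add: zero_apply)
next
  case (insert i I)
  then show ?case by (subst A.finsum_insert R.finsum_insert; auto simp: add_apply)+
qed

lemma finsum_single_term:
  assumes "finite I" "\<And>i. i \<in> I \<Longrightarrow> F i \<in> carrier R" "\<And>i. i \<in> I \<Longrightarrow> i \<noteq> j \<Longrightarrow> F i = \<zero>\<^bsub>R\<^esub>" "j \<in> I"
  shows "(\<Oplus>\<^bsub>R\<^esub>i\<in>I. F i) = F j"
proof -
  have "(\<Oplus>\<^bsub>R\<^esub>i\<in>I. F i) = (\<Oplus>\<^bsub>R\<^esub>i\<in>I. if j = i then F i else \<zero>\<^bsub>R\<^esub>)"
    using assms by (intro R.finsum_cong') auto
  also have "\<dots> = F j" using assms by (intro R.add.finprod_singleton) auto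
  finally show ?thesis .
qed

text \<open>For \<open>g = \<one>\<close> these are the scalars, for \<open>c = \<one>\<close> the
  group elements.\<close>

definition single :: "'a \<Rightarrow> 'c \<Rightarrow> 'c \<Rightarrow> 'a" where
  "single c g = (\<lambda>x. if x = g then c else \<zero>\<^bsub>R\<^esub>)"

lemma single_closed [simp]:
  assumes "c \<in> carrier R" "g \<in> carrier G"
  shows "single c g \<in> carrier A"
  using assms by (auto simp: carrier_iff single_def)

lemma single_mult:
  assumes c: "c \<in> carrier R" and g: "g \<in> carrier G" and f: "f \<in> carrier A" and x: "x \<in> carrier G"
  shows "(single c g \<otimes>\<^bsub>A\<^esub> f) x = c \<otimes>\<^bsub>R\<^esub> f (inv\<^bsub>G\<^esub> g \<otimes>\<^bsub>G\<^esub> x)"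
proof -
  have "(single c g \<otimes>\<^bsub>A\<^esub> f) x = (\<Oplus>\<^bsub>R\<^esub>y\<in>{g}. single c g y \<otimes>\<^bsub>R\<^esub> f (inv\<^bsub>G\<^esub> y \<otimes>\<^bsub>G\<^esub> x))"
    using assms single_closed[OF c g] by (intro mult_apply) (simp_all, auto simp: single_def)
  also have "\<dots> = c \<otimes>\<^bsub>R\<^esub> f (inv\<^bsub>G\<^esub> g \<otimes>\<^bsub>G\<^esub> x)"
    using assms by (subst finsum_single_term[of _ _ g]) (simp_all add: single_def)
  finally show ?thesis .
qed

lemma mult_single:
  assumes c: "c \<in> carrier R" and g: "g \<in> carrier G" and f: "f \<in> carrier A" and x: "x \<in> carrier G"
  shows "(f \<otimes>\<^bsub>A\<^esub> single c g) x = f (x \<otimes>\<^bsub>G\<^esub> inv\<^bsub>G\<^esub> g) \<otimes>\<^bsub>R\<^esub> c"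
proof -
  let ?y = "x \<otimes>\<^bsub>G\<^esub> inv\<^bsub>G\<^esub> g"
  have y: "inv\<^bsub>G\<^esub> z \<otimes>\<^bsub>G\<^esub> x = g \<longleftrightarrow> z = ?y" if "z \<in> carrier G" for z
    using that g x by (metis G.inv_closed G.inv_solve_left G.inv_solve_right)
  have "(f \<otimes>\<^bsub>A\<^esub> single c g) x = (\<Oplus>\<^bsub>R\<^esub>z\<in>insert ?y (supp f). f z \<otimes>\<^bsub>R\<^esub> single c g (inv\<^bsub>G\<^esub> z \<otimes>\<^bsub>G\<^esub> x))"
    using assms finite_supp[OF f] by (intro mult_apply) auto
  also have "\<dots> = f ?y \<otimes>\<^bsub>R\<^esub> single c g (inv\<^bsub>G\<^esub> ?y \<otimes>\<^bsub>G\<^esub> x)"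
    using assms finite_supp[OF f] supp_carrier[OF f] y by (intro finsum_single_term) (auto simp: single_def)
  also have "\<dots> = f ?y \<otimes>\<^bsub>R\<^esub> c" using y[of ?y] g x by (simp add: single_def)
  finally show ?thesis .
qed

text \<open>The two translates of the support are disjoint, so nothing cancels in the sum, and the
  coefficients of \<open>b\<close> reappear unchanged because they are only multiplied by
  \<open>\<one>\<close>.\<close>

lemma sandwich_supp:
  assumes b: "b \<in> carrier A" and x: "x \<in> carrier G" and y: "y \<in> carrier G" "y' \<in> carrier G"
    and disj: "\<And>s s'. s \<in> supp b \<Longrightarrow> s' \<in> supp b \<Longrightarrow> x \<otimes>\<^bsub>G\<^esub> (s \<otimes>\<^bsub>G\<^esub> y) \<noteq> x \<otimes>\<^bsub>G\<^esub> (s' \<otimes>\<^bsub>G\<^esub> y')"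
  shows "supp (single \<one>\<^bsub>R\<^esub> x \<otimes>\<^bsub>A\<^esub> b \<otimes>\<^bsub>A\<^esub> (single \<one>\<^bsub>R\<^esub> y \<oplus>\<^bsub>A\<^esub> single \<one>\<^bsub>R\<^esub> y'))
    = (\<lambda>s. x \<otimes>\<^bsub>G\<^esub> (s \<otimes>\<^bsub>G\<^esub> y)) ` supp b \<union> (\<lambda>s. x \<otimes>\<^bsub>G\<^esub> (s \<otimes>\<^bsub>G\<^esub> y')) ` supp b"
    (is "supp ?e = ?U")
proof -
  have e: "?e \<in> carrier A" using assms by simp
  have mem: "b (inv\<^bsub>G\<^esub> x \<otimes>\<^bsub>G\<^esub> (g \<otimes>\<^bsub>G\<^esub> inv\<^bsub>G\<^esub> z)) \<noteq> \<zero>\<^bsub>R\<^esub> \<longleftrightarrow> g \<in> (\<lambda>s. x \<otimes>\<^bsub>G\<^esub> (s \<otimes>\<^bsub>G\<^esub> z)) ` supp b"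
    if g: "g \<in> carrier G" and z: "z \<in> carrier G" for g z
  proof
    assume "b (inv\<^bsub>G\<^esub> x \<otimes>\<^bsub>G\<^esub> (g \<otimes>\<^bsub>G\<^esub> inv\<^bsub>G\<^esub> z)) \<noteq> \<zero>\<^bsub>R\<^esub>"
    moreover have "g = x \<otimes>\<^bsub>G\<^esub> ((inv\<^bsub>G\<^esub> x \<otimes>\<^bsub>G\<^esub> (g \<otimes>\<^bsub>G\<^esub> inv\<^bsub>G\<^esub> z)) \<otimes>\<^bsub>G\<^esub> z)"
      using g z x by (simp add: G.m_assoc)
    ultimately show "g \<in> (\<lambda>s. x \<otimes>\<^bsub>G\<^esub> (s \<otimes>\<^bsub>G\<^esub> z)) ` supp b" by blast
  next
    assume "g \<in> (\<lambda>s. x \<otimes>\<^bsub>G\<^esub> (s \<otimes>\<^bsub>G\<^esub> z)) ` supp b"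
    then obtain s where s: "b s \<noteq> \<zero>\<^bsub>R\<^esub>" "g = x \<otimes>\<^bsub>G\<^esub> (s \<otimes>\<^bsub>G\<^esub> z)" by blast
    then have "s \<in> carrier G" using supp_carrier[OF b] by blast
    then have "inv\<^bsub>G\<^esub> x \<otimes>\<^bsub>G\<^esub> (g \<otimes>\<^bsub>G\<^esub> inv\<^bsub>G\<^esub> z) = s" using s(2) x z by (simp add: G.m_assoc)
    then show "b (inv\<^bsub>G\<^esub> x \<otimes>\<^bsub>G\<^esub> (g \<otimes>\<^bsub>G\<^esub> inv\<^bsub>G\<^esub> z)) \<noteq> \<zero>\<^bsub>R\<^esub>" using s(1) by simp
  qed
  have val: "?e g = b (inv\<^bsub>G\<^esub> x \<otimes>\<^bsub>G\<^esub> (g \<otimes>\<^bsub>G\<^esub> inv\<^bsub>G\<^esub> y)) \<oplus>\<^bsub>R\<^esub> b (inv\<^bsub>G\<^esub> x \<otimes>\<^bsub>G\<^esub> (g \<otimes>\<^bsub>G\<^esub> inv\<^bsub>G\<^esub> y'))"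
    if "g \<in> carrier G" for g
    using that assms by (simp add: A.r_distr add_apply mult_single single_mult)
  have U: "?U \<subseteq> carrier G" using supp_carrier[OF b] x y by auto
  have "?e g \<noteq> \<zero>\<^bsub>R\<^esub> \<longleftrightarrow> g \<in> ?U" for g
  proof (cases "g \<in> carrier G")
    case True
    have "g \<notin> (\<lambda>s. x \<otimes>\<^bsub>G\<^esub> (s \<otimes>\<^bsub>G\<^esub> y)) ` supp b \<or> g \<notin> (\<lambda>s. x \<otimes>\<^bsub>G\<^esub> (s \<otimes>\<^bsub>G\<^esub> y')) ` supp b"
      using disj by blast
    then show ?thesis
      using mem[OF True y(1)] mem[OF True y(2)] val[OF True] b by (metis R.l_zero R.r_zero UnCI UnE coeff_closed)
  next
    case False
    then show ?thesis using coeff_outside[OF e False] U by blast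
  qed
  then show ?thesis by blast
qed

text \<open>The coefficient at \<open>uh\<close> of the sum is the single product \<open>\<epsilon>\<^sub>j(u) r\<^sub>j(h)\<close>.\<close>

lemma proper_combination:
  assumes dom: "nc_domain R" and e: "\<And>i::nat. e i \<in> carrier A" and r: "\<And>i. r i \<in> carrier A"
    and unique: "\<And>I H. finite I \<Longrightarrow> (\<And>i. i \<in> I \<Longrightarrow> finite (H i) \<and> H i \<subseteq> carrier G) \<Longrightarrow> \<exists>i\<in>I. H i \<noteq> {} \<Longrightarrow>
      \<exists>j\<in>I. \<exists>u\<in>supp (e j). \<exists>h\<in>H j. u \<otimes>\<^bsub>G\<^esub> h \<noteq> \<one>\<^bsub>G\<^esub> \<and> (\<forall>i\<in>I. u \<otimes>\<^bsub>G\<^esub> h \<notin> H i) \<and>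
        (\<forall>i\<in>I. \<forall>u'\<in>supp (e i). \<forall>h'\<in>H i. u' \<otimes>\<^bsub>G\<^esub> h' = u \<otimes>\<^bsub>G\<^esub> h \<longrightarrow> i = j \<and> u' = u)"
  shows "(\<Oplus>\<^bsub>A\<^esub>i\<in>{..<n}. (\<one>\<^bsub>A\<^esub> \<oplus>\<^bsub>A\<^esub> e i) \<otimes>\<^bsub>A\<^esub> r i) \<noteq> \<one>\<^bsub>A\<^esub>"
proof
  assume sum: "(\<Oplus>\<^bsub>A\<^esub>i\<in>{..<n}. (\<one>\<^bsub>A\<^esub> \<oplus>\<^bsub>A\<^esub> e i) \<otimes>\<^bsub>A\<^esub> r i) = \<one>\<^bsub>A\<^esub>"
  have at: "(\<Oplus>\<^bsub>R\<^esub>i\<in>{..<n}. ((\<one>\<^bsub>A\<^esub> \<oplus>\<^bsub>A\<^esub> e i) \<otimes>\<^bsub>A\<^esub> r i) g) = \<one>\<^bsub>A\<^esub> g" for g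
  proof -
    have "(\<Oplus>\<^bsub>A\<^esub>i\<in>{..<n}. (\<one>\<^bsub>A\<^esub> \<oplus>\<^bsub>A\<^esub> e i) \<otimes>\<^bsub>A\<^esub> r i) g = \<one>\<^bsub>A\<^esub> g" by (simp only: sum)
    then show ?thesis using e r by (subst (asm) finsum_apply) simp_all
  qed
  show False
  proof (cases "\<exists>i\<in>{..<n}. supp (r i) \<noteq> {}")
    case False
    then have "r i = \<zero>\<^bsub>A\<^esub>" if "i < n" for i using that by (simp add: eq_zero_iff)
    then have "((\<one>\<^bsub>A\<^esub> \<oplus>\<^bsub>A\<^esub> e i) \<otimes>\<^bsub>A\<^esub> r i) \<one>\<^bsub>G\<^esub> = \<zero>\<^bsub>R\<^esub>" if "i < n" for i using that e by (simp add: zero_apply)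
    then have "(\<Oplus>\<^bsub>R\<^esub>i\<in>{..<n}. ((\<one>\<^bsub>A\<^esub> \<oplus>\<^bsub>A\<^esub> e i) \<otimes>\<^bsub>A\<^esub> r i) \<one>\<^bsub>G\<^esub>) = \<zero>\<^bsub>R\<^esub>"
      by (intro R.add.finprod_one_eqI) simp
    then have "\<one>\<^bsub>A\<^esub> \<one>\<^bsub>G\<^esub> = \<zero>\<^bsub>R\<^esub>" using at[of "\<one>\<^bsub>G\<^esub>"] by simp
    then show False using dom by (simp add: one_apply nc_domain_def)
  next
    case True
    have "finite (supp (r i)) \<and> supp (r i) \<subseteq> carrier G" for i using finite_supp[OF r] supp_carrier[OF r] by blast
    from unique[OF finite_lessThan this True] obtain j u h where raw: "j \<in> {..<n}" "u \<in> supp (e j)" "h \<in> supp (r j)"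
      "u \<otimes>\<^bsub>G\<^esub> h \<noteq> \<one>\<^bsub>G\<^esub>" "\<forall>i\<in>{..<n}. u \<otimes>\<^bsub>G\<^esub> h \<notin> supp (r i)"
      "\<forall>i\<in>{..<n}. \<forall>u'\<in>supp (e i). \<forall>h'\<in>supp (r i). u' \<otimes>\<^bsub>G\<^esub> h' = u \<otimes>\<^bsub>G\<^esub> h \<longrightarrow> i = j \<and> u' = u"
      by (elim bexE conjE)
    have j: "j < n" and u: "e j u \<noteq> \<zero>\<^bsub>R\<^esub>" and h: "r j h \<noteq> \<zero>\<^bsub>R\<^esub>" using raw(1-3) by simp_all
    have k: "u \<otimes>\<^bsub>G\<^esub> h \<noteq> \<one>\<^bsub>G\<^esub>" "r i (u \<otimes>\<^bsub>G\<^esub> h) = \<zero>\<^bsub>R\<^esub>" if "i < n" for i using raw(4,5) that by simp_all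
    have un: "i = j \<and> u' = u" if "i < n" "e i u' \<noteq> \<zero>\<^bsub>R\<^esub>" "r i h' \<noteq> \<zero>\<^bsub>R\<^esub>" "u' \<otimes>\<^bsub>G\<^esub> h' = u \<otimes>\<^bsub>G\<^esub> h" for i u' h'
      using raw(6)[rule_format, of i u' h'] that by simp
    have uG: "u \<in> carrier G" and hG: "h \<in> carrier G" using coeff_outside[OF e, of u j] coeff_outside[OF r, of h j] u h by auto
    let ?k = "u \<otimes>\<^bsub>G\<^esub> h"
    have vanish: "e i x \<otimes>\<^bsub>R\<^esub> r i (inv\<^bsub>G\<^esub> x \<otimes>\<^bsub>G\<^esub> ?k) = \<zero>\<^bsub>R\<^esub>" if "i < n" "x \<in> supp (e i)" "\<not> (i = j \<and> x = u)" for i x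
    proof -
      have "x \<in> carrier G" using supp_carrier[OF e] that(2) by blast
      then have "x \<otimes>\<^bsub>G\<^esub> (inv\<^bsub>G\<^esub> x \<otimes>\<^bsub>G\<^esub> ?k) = ?k" using uG hG by (simp add: G.m_assoc[symmetric])
      then have "r i (inv\<^bsub>G\<^esub> x \<otimes>\<^bsub>G\<^esub> ?k) = \<zero>\<^bsub>R\<^esub>" using un[of i x "inv\<^bsub>G\<^esub> x \<otimes>\<^bsub>G\<^esub> ?k"] that by auto
      then show ?thesis using e by simp
    qed
    \<comment> \<open>At \<open>?k\<close> the summand \<open>\<one>\<close> contributes
      \<open>r i ?k\<close>, which vanishes, so only \<open>e i \<otimes> r i\<close>
      remains.\<close>
    have val: "((\<one>\<^bsub>A\<^esub> \<oplus>\<^bsub>A\<^esub> e i) \<otimes>\<^bsub>A\<^esub> r i) ?k = (\<Oplus>\<^bsub>R\<^esub>x\<in>supp (e i). e i x \<otimes>\<^bsub>R\<^esub> r i (inv\<^bsub>G\<^esub> x \<otimes>\<^bsub>G\<^esub> ?k))" if "i < n" for i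
    proof -
      have "((\<one>\<^bsub>A\<^esub> \<oplus>\<^bsub>A\<^esub> e i) \<otimes>\<^bsub>A\<^esub> r i) ?k = (e i \<otimes>\<^bsub>A\<^esub> r i) ?k"
        using e r k(2)[OF that] by (simp add: A.l_distr add_apply)
      also have "\<dots> = (\<Oplus>\<^bsub>R\<^esub>x\<in>supp (e i). e i x \<otimes>\<^bsub>R\<^esub> r i (inv\<^bsub>G\<^esub> x \<otimes>\<^bsub>G\<^esub> ?k))"
        using e r finite_supp[OF e] uG hG by (intro mult_apply) auto
      finally show ?thesis .
    qed
    have "((\<one>\<^bsub>A\<^esub> \<oplus>\<^bsub>A\<^esub> e i) \<otimes>\<^bsub>A\<^esub> r i) ?k = \<zero>\<^bsub>R\<^esub>" if "i < n" "i \<noteq> j" for i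
      unfolding val[OF that(1)] using vanish that by (intro R.add.finprod_one_eqI) auto
    then have "(\<Oplus>\<^bsub>R\<^esub>i\<in>{..<n}. ((\<one>\<^bsub>A\<^esub> \<oplus>\<^bsub>A\<^esub> e i) \<otimes>\<^bsub>A\<^esub> r i) ?k) = ((\<one>\<^bsub>A\<^esub> \<oplus>\<^bsub>A\<^esub> e j) \<otimes>\<^bsub>A\<^esub> r j) ?k"
      using j e r by (intro finsum_single_term) auto
    then have "\<one>\<^bsub>A\<^esub> ?k = ((\<one>\<^bsub>A\<^esub> \<oplus>\<^bsub>A\<^esub> e j) \<otimes>\<^bsub>A\<^esub> r j) ?k" using at[of ?k] by simp
    also have "\<dots> = e j u \<otimes>\<^bsub>R\<^esub> r j (inv\<^bsub>G\<^esub> u \<otimes>\<^bsub>G\<^esub> ?k)"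
      unfolding val[OF j] using finite_supp[OF e] vanish[OF j] u e r by (intro finsum_single_term) auto
    also have "inv\<^bsub>G\<^esub> u \<otimes>\<^bsub>G\<^esub> ?k = h" using uG hG by (simp add: G.m_assoc[symmetric])
    finally have "e j u \<otimes>\<^bsub>R\<^esub> r j h = \<zero>\<^bsub>R\<^esub>" using k(1)[OF j] by (simp add: one_apply)
    then show False using dom u h e r unfolding nc_domain_def by auto
  qed
qed

end

text \<open>Coefficient families are total and sums run over initial segments, so two sums of
  different lengths can be padded by zeros and added term by term.\<close>

lemma right_ideal_generated:
  fixes S (structure)
  assumes S: "ring S" and e: "\<And>i::nat. e i \<in> carrier S"
  defines "J \<equiv> {\<Oplus>\<^bsub>S\<^esub>i\<in>{..<n}. e i \<otimes> r i | n r. \<forall>i. r i \<in> carrier S}"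
  shows "right_ideal S J" "e k \<in> J"
proof -
  interpret ring S by fact
  have JI: "(\<Oplus>i\<in>{..<n}. e i \<otimes> r i) \<in> J" if "\<And>i. r i \<in> carrier S" for n r
    using that unfolding J_def by (intro CollectI exI[of _ n] exI[of _ r]) simp
  have pad: "(\<Oplus>i\<in>{..<n}. e i \<otimes> r i) = (\<Oplus>i\<in>{..<m}. e i \<otimes> (if i < n then r i else \<zero>))"
    if "n \<le> m" "\<forall>i. r i \<in> carrier S" for n m r
    using that e by (intro add.finprod_mono_neutral_cong_left) auto
  show "right_ideal S J"
    unfolding right_ideal_def
  proof (intro conjI ballI)
    show "J \<subseteq> carrier S" using e by (auto simp: J_def)
    show "\<zero> \<in> J" using JI[of "\<lambda>_. \<zero>" 0] by simp
    fix a assume "a \<in> J"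
    then obtain n r where a: "a = (\<Oplus>i\<in>{..<n}. e i \<otimes> r i)" "\<forall>i. r i \<in> carrier S" by (auto simp: J_def)
    show "a \<otimes> s \<in> J" if s: "s \<in> carrier S" for s
    proof -
      have "a \<otimes> s = (\<Oplus>i\<in>{..<n}. e i \<otimes> (r i \<otimes> s))"
        using a e s by (simp add: finsum_ldistr m_assoc Pi_def)
      then show ?thesis using JI[of "\<lambda>i. r i \<otimes> s" n] a s by simp
    qed
    fix b assume "b \<in> J"
    then obtain m q where b: "b = (\<Oplus>i\<in>{..<m}. e i \<otimes> q i)" "\<forall>i. q i \<in> carrier S" by (auto simp: J_def)
    define t where "t i = (if i < n then r i else \<zero>) \<oplus> (if i < m then q i else \<zero>)" for i
    have "a \<oplus> b = (\<Oplus>i\<in>{..<max n m}. e i \<otimes> (if i < n then r i else \<zero>)) \<oplus> (\<Oplus>i\<in>{..<max n m}. e i \<otimes> (if i < m then q i else \<zero>))"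
      unfolding a(1) b(1) pad[OF max.cobounded1 a(2), of n m] pad[OF max.cobounded2 b(2), of m n] ..
    also have "\<dots> = (\<Oplus>i\<in>{..<max n m}. e i \<otimes> t i)"
      using a(2) b(2) e by (subst finsum_addf[symmetric]) (auto simp: t_def r_distr intro!: finsum_cong')
    finally have "a \<oplus> b = (\<Oplus>i\<in>{..<max n m}. e i \<otimes> t i)" .
    then show "a \<oplus> b \<in> J" using JI[of t "max n m"] a b by (simp add: t_def)
  qed
  have "e k = (\<Oplus>i\<in>{..<Suc k}. if k = i then e i else \<zero>)" using e by (subst add.finprod_singleton) auto
  also have "\<dots> = (\<Oplus>i\<in>{..<Suc k}. e i \<otimes> (if k = i then \<one> else \<zero>))" using e by (intro finsum_cong') auto
  finally show "e k \<in> J" using JI[of "\<lambda>i. if k = i then \<one> else \<zero>" "Suc k"] by simp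
qed

text \<open>An equation between such products with \<open>g \<noteq> g'\<close> turns into
  \<open>inv x \<otimes> ((inv g' \<otimes> g) \<otimes> x) = h' \<otimes> inv h\<close>, a short
  conjugate of one of finitely many nontrivial elements; \<open>x\<close> is chosen to make all
  these conjugates long. With such an \<open>x\<close> in the middle, coefficients of products can
  be read off.\<close>

lemma (in torsion_free_nonelementary) generic_middle:
  assumes T: "finite T" "T \<subseteq> carrier G"
  shows "\<exists>x\<in>carrier G. \<forall>g\<in>T. \<forall>g'\<in>T. \<forall>h\<in>T. \<forall>h'\<in>T. g \<otimes> (x \<otimes> h) = g' \<otimes> (x \<otimes> h') \<longrightarrow> g = g' \<and> h = h'"
proof -
  define D where "D = (\<Union>g\<in>T. (\<lambda>g'. inv g' \<otimes> g) ` (T - {g}))"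
  have TG: "g \<in> carrier G" if "g \<in> T" for g using T that by auto
  have D: "finite D" "D \<subseteq> carrier G - {\<one>}"
    using T TG by (auto simp: D_def dest: inv_equality)
  define M where "M = (\<Sum>g\<in>T. len g)"
  have M: "len g \<le> M" if "g \<in> T" for g
    unfolding M_def using that T TG len_nonneg by (intro member_le_sum) auto
  obtain x where x: "x \<in> carrier G" "\<forall>t\<in>D. 2 * M < len (inv x \<otimes> (t \<otimes> x))"
    using conjugates_leave_balls[OF D] by blast
  have "g = g' \<and> h = h'" if g: "g \<in> T" "g' \<in> T" "h \<in> T" "h' \<in> T" and eq: "g \<otimes> (x \<otimes> h) = g' \<otimes> (x \<otimes> h')" for g g' h h'
  proof -
    note G = TG[OF g(1)] TG[OF g(2)] TG[OF g(3)] TG[OF g(4)]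
    have "inv x \<otimes> (inv g' \<otimes> (g \<otimes> (x \<otimes> h))) \<otimes> inv h = h' \<otimes> inv h"
      unfolding eq using G x(1) by simp
    then have "inv x \<otimes> ((inv g' \<otimes> g) \<otimes> x) = h' \<otimes> inv h" using G x(1) by (simp add: m_assoc)
    moreover have "len (h' \<otimes> inv h) \<le> 2 * M"
      using len_mult_le[of h' "inv h"] M[OF g(3)] M[OF g(4)] G by simp
    ultimately have "inv g' \<otimes> g \<notin> D" using x(2) by force
    then have gg: "g = g'" using g by (auto simp: D_def)
    then have "x \<otimes> h = x \<otimes> h'" using eq G x(1) by simp
    then show ?thesis using gg G x(1) by simp
  qed
  then show ?thesis using x(1) by blast
qed

section \<open>Primitivity from a countable test set\<close>

context group_ring_setup
begin

text \<open>Every ideal containing \<open>b i\<close> contains the two-sided multiple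
  \<open>e i\<close>, and \<open>\<one> \<oplus> e i\<close> is among the generators of the right
  ideal. The enumeration may repeat elements of \<open>B\<close>, since blocks are attached to
  indices.\<close>

lemma right_primitive_of_test_set:
  assumes dom: "nc_domain R" and hyp: "torsion_free_nonelementary G len X \<delta>"
    and B: "countable B" "B \<subseteq> carrier A - {\<zero>\<^bsub>A\<^esub>}"
    and test: "\<And>I. ideal I A \<Longrightarrow> I \<noteq> {\<zero>\<^bsub>A\<^esub>} \<Longrightarrow> I \<inter> B \<noteq> {}"
  shows "right_primitive A"
proof -
  interpret H: torsion_free_nonelementary G len X \<delta> by (rule hyp)
  have one_nz: "\<one>\<^bsub>A\<^esub> \<noteq> \<zero>\<^bsub>A\<^esub>"
    using dom one_apply[of "\<one>\<^bsub>G\<^esub>"] zero_apply[of "\<one>\<^bsub>G\<^esub>"] by (auto simp: nc_domain_def)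
  then have "carrier A \<noteq> {\<zero>\<^bsub>A\<^esub>}" using A.one_closed by blast
  \<comment> \<open>The test is applied to the whole ring; an enumeration needs a nonempty
    set.\<close>
  then have "B \<noteq> {}" using test[OF A.oneideal] by blast
  define b where "b = from_nat_into B"
  have rb: "range b = B" unfolding b_def using \<open>B \<noteq> {}\<close> B(1) by (rule range_from_nat_into)
  have b: "b i \<in> carrier A" "b i \<noteq> \<zero>\<^bsub>A\<^esub>" for i using rb B(2) by auto
  have S: "finite (supp (b i))" "supp (b i) \<noteq> {}" "supp (b i) \<subseteq> carrier G" for i
    using finite_supp[OF b(1)] supp_carrier[OF b(1)] b(2)[of i] eq_zero_iff[of "b i"] by auto
  show ?thesis
    using S
  proof (rule H.unique_product_translates)
    fix x y y' U
    assume xy: "\<And>i. x i \<in> carrier G" "\<And>i. y i \<in> carrier G" "\<And>i. y' i \<in> carrier G"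
      and disj: "\<And>i s s'. s \<in> supp (b i) \<Longrightarrow> s' \<in> supp (b i) \<Longrightarrow> x i \<otimes>\<^bsub>G\<^esub> (s \<otimes>\<^bsub>G\<^esub> y i) \<noteq> x i \<otimes>\<^bsub>G\<^esub> (s' \<otimes>\<^bsub>G\<^esub> y' i)"
      and U: "\<And>i. U i = (\<lambda>s. x i \<otimes>\<^bsub>G\<^esub> (s \<otimes>\<^bsub>G\<^esub> y i)) ` supp (b i) \<union> (\<lambda>s. x i \<otimes>\<^bsub>G\<^esub> (s \<otimes>\<^bsub>G\<^esub> y' i)) ` supp (b i)"
      and unique: "\<And>I H. finite I \<Longrightarrow> (\<And>i. i \<in> I \<Longrightarrow> finite (H i) \<and> H i \<subseteq> carrier G) \<Longrightarrow> \<exists>i\<in>I. H i \<noteq> {} \<Longrightarrow>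
      \<exists>j\<in>I. \<exists>u\<in>U j. \<exists>h\<in>H j. u \<otimes>\<^bsub>G\<^esub> h \<noteq> \<one>\<^bsub>G\<^esub> \<and> (\<forall>i\<in>I. u \<otimes>\<^bsub>G\<^esub> h \<notin> H i) \<and>
        (\<forall>i\<in>I. \<forall>u'\<in>U i. \<forall>h'\<in>H i. u' \<otimes>\<^bsub>G\<^esub> h' = u \<otimes>\<^bsub>G\<^esub> h \<longrightarrow> i = j \<and> u' = u)"
    define e where "e i = single \<one>\<^bsub>R\<^esub> (x i) \<otimes>\<^bsub>A\<^esub> b i \<otimes>\<^bsub>A\<^esub> (single \<one>\<^bsub>R\<^esub> (y i) \<oplus>\<^bsub>A\<^esub> single \<one>\<^bsub>R\<^esub> (y' i))" for i
    have e: "e i \<in> carrier A" for i using b xy by (simp add: e_def)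
    have U_eq: "U i = supp (e i)" for i
      unfolding U e_def by (rule sandwich_supp[OF b(1) xy disj, symmetric])
    have e1: "\<one>\<^bsub>A\<^esub> \<oplus>\<^bsub>A\<^esub> e i \<in> carrier A" for i using e by simp
    let ?J = "{\<Oplus>\<^bsub>A\<^esub>i\<in>{..<n}. (\<one>\<^bsub>A\<^esub> \<oplus>\<^bsub>A\<^esub> e i) \<otimes>\<^bsub>A\<^esub> r i | n r. \<forall>i. r i \<in> carrier A}"
    show "right_primitive A"
    proof (rule right_primitive_of_comaximal[OF A.ring_axioms])
      show "right_ideal A ?J" by (rule right_ideal_generated(1)[OF A.ring_axioms e1])
      show "\<one>\<^bsub>A\<^esub> \<notin> ?J"
      proof
        assume "\<one>\<^bsub>A\<^esub> \<in> ?J"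
        then obtain n r where r: "\<one>\<^bsub>A\<^esub> = (\<Oplus>\<^bsub>A\<^esub>i\<in>{..<n}. (\<one>\<^bsub>A\<^esub> \<oplus>\<^bsub>A\<^esub> e i) \<otimes>\<^bsub>A\<^esub> r i)" "\<And>i. r i \<in> carrier A" by blast
        have "(\<Oplus>\<^bsub>A\<^esub>i\<in>{..<n}. (\<one>\<^bsub>A\<^esub> \<oplus>\<^bsub>A\<^esub> e i) \<otimes>\<^bsub>A\<^esub> r i) \<noteq> \<one>\<^bsub>A\<^esub>"
          by (rule proper_combination[OF dom e r(2)], rule unique[unfolded U_eq])
        then show False using r(1) by simp
      qed
      fix I assume I: "ideal I A" "I \<noteq> {\<zero>\<^bsub>A\<^esub>}"
      interpret I: ideal I A by (rule I(1))
      from test[OF I] obtain i where i: "b i \<in> I" using rb by auto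
      have "e i \<in> I" unfolding e_def using i xy by (intro I.I_r_closed I.I_l_closed) simp_all
      moreover have "\<one>\<^bsub>A\<^esub> \<oplus>\<^bsub>A\<^esub> e i \<in> ?J" by (rule right_ideal_generated(2)[OF A.ring_axioms e1])
      ultimately show "\<exists>e\<in>I. \<one>\<^bsub>A\<^esub> \<oplus>\<^bsub>A\<^esub> e \<in> ?J" by blast
    qed
  qed
qed

definition coeffs_in :: "'a set \<Rightarrow> ('c \<Rightarrow> 'a) set" where
  "coeffs_in C = {f \<in> carrier A. \<forall>g. f g \<in> C}"

text \<open>A member is determined by its graph over the support, a finite subset of the countable
  set \<open>carrier G \<times> C\<close>.\<close>

lemma countable_coeffs_in:
  assumes "countable (carrier G)" "countable C"
  shows "countable (coeffs_in C)"
proof -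
  define \<phi> where "\<phi> f = (\<lambda>g. (g, f g)) ` supp f" for f :: "'c \<Rightarrow> 'a"
  have "inj_on \<phi> (coeffs_in C)"
  proof (rule inj_onI)
    have *: "f g = h g" if "\<phi> f = \<phi> h" "f g \<noteq> \<zero>\<^bsub>R\<^esub>" for f h g
    proof -
      have "(g, f g) \<in> \<phi> h" using that by (auto simp: \<phi>_def simp flip: that(1))
      then show ?thesis by (auto simp: \<phi>_def)
    qed
    fix f h assume fh: "\<phi> f = \<phi> h"
    show "f = h"
    proof
      fix g show "f g = h g" using *[OF fh, of g] *[OF fh[symmetric], of g] by metis
    qed
  qed
  moreover have "\<phi> ` coeffs_in C \<subseteq> {Y. finite Y \<and> Y \<subseteq> carrier G \<times> C}"
    using supp_carrier finite_supp by (fastforce simp: \<phi>_def coeffs_in_def)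
  moreover have "countable {Y. finite Y \<and> Y \<subseteq> carrier G \<times> C}"
    using assms by (intro countable_Collect_finite_subset) simp
  ultimately show ?thesis by (meson countable_image_inj_on countable_subset)
qed

end

lemma (in hyperbolic_length) countable_carrier: "countable (carrier G)"
proof -
  have "carrier G \<subseteq> (\<Union>n::nat. {x \<in> carrier G. len x \<le> int n})"
  proof
    fix x assume "x \<in> carrier G"
    then show "x \<in> (\<Union>n::nat. {x \<in> carrier G. len x \<le> int n})"
      by (intro UN_I[of "nat (len x)"]) auto
  qed
  moreover have "countable (\<Union>n::nat. {x \<in> carrier G. len x \<le> int n})"
    using finite_len_ball by (intro countable_UN) (auto intro: countable_finite)
  ultimately show ?thesis by (rule countable_subset)
qed

theorem right_primitive_countable_domain:
  assumes dom: "nc_domain R" "countable (carrier R)" and hyp: "torsion_free_nonelementary G len X \<delta>"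
  shows "right_primitive (group_ring R G)"
proof -
  interpret H: torsion_free_nonelementary G len X \<delta> by (rule hyp)
  interpret group_ring_setup R G
    using dom(1) H.group_axioms by (simp add: nc_domain_def group_ring_setup_def)
  have "coeffs_in (carrier R) = carrier A" by (auto simp: coeffs_in_def)
  then have "countable (carrier A)" using countable_coeffs_in[OF H.countable_carrier dom(2)] by simp
  then show ?thesis
  proof (intro right_primitive_of_test_set[OF dom(1) hyp, of "carrier A - {\<zero>\<^bsub>A\<^esub>}"])
    fix I assume I: "ideal I A" "I \<noteq> {\<zero>\<^bsub>A\<^esub>}"
    interpret I: ideal I A by (rule I(1))
    have "\<zero>\<^bsub>A\<^esub> \<in> I" "I \<subseteq> carrier A" using I.zero_closed I.a_subset by auto
    then show "I \<inter> (carrier A - {\<zero>\<^bsub>A\<^esub>}) \<noteq> {}" using I(2) by blast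
  qed auto
qed

section \<open>Descent to integral coefficients\<close>

context group_ring_setup
begin

lemma finsum_in_subset:
  assumes "finite I" "\<And>i. i \<in> I \<Longrightarrow> F i \<in> C" and C: "subring C R"
  shows "(\<Oplus>\<^bsub>R\<^esub>i\<in>I. F i) \<in> C"
  using assms(1,2)
proof (induction I)
  case (insert i I)
  then have "F \<in> insert i I \<rightarrow> carrier R" using subringE(1)[OF C] by auto
  then show ?case using insert subringE(7)[OF C] by (subst R.finsum_insert) auto
qed (use subringE(2)[OF C] in simp)

lemma coeffs_in_subring:
  assumes C: "subring C R"
  shows "f \<in> coeffs_in C \<Longrightarrow> h \<in> coeffs_in C \<Longrightarrow> f \<otimes>\<^bsub>A\<^esub> h \<in> coeffs_in C"
    and "f \<in> coeffs_in C \<Longrightarrow> h \<in> coeffs_in C \<Longrightarrow> f \<ominus>\<^bsub>A\<^esub> h \<in> coeffs_in C"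
    and "g \<in> carrier G \<Longrightarrow> single \<one>\<^bsub>R\<^esub> g \<in> coeffs_in C"
    and "\<zero>\<^bsub>A\<^esub> \<in> coeffs_in C"
proof -
  show "g \<in> carrier G \<Longrightarrow> single \<one>\<^bsub>R\<^esub> g \<in> coeffs_in C"
    using single_closed[of "\<one>\<^bsub>R\<^esub>" g] subringE(2,3)[OF C] by (simp add: coeffs_in_def) (simp add: single_def)
  show "\<zero>\<^bsub>A\<^esub> \<in> coeffs_in C" using subringE(2)[OF C] by (simp add: coeffs_in_def zero_apply)
next
  assume f: "f \<in> coeffs_in C" and h: "h \<in> coeffs_in C"
  then have fh: "f \<in> carrier A" "h \<in> carrier A" "\<And>g. f g \<in> C" "\<And>g. h g \<in> C" by (auto simp: coeffs_in_def)
  then show "f \<ominus>\<^bsub>A\<^esub> h \<in> coeffs_in C"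
    using subringE(5,7)[OF C] by (simp add: coeffs_in_def A.minus_eq add_apply minus_apply)
  have "(f \<otimes>\<^bsub>A\<^esub> h) g \<in> C" for g
  proof (cases "g \<in> carrier G")
    case True
    then have "(f \<otimes>\<^bsub>A\<^esub> h) g = (\<Oplus>\<^bsub>R\<^esub>x\<in>supp f. f x \<otimes>\<^bsub>R\<^esub> h (inv\<^bsub>G\<^esub> x \<otimes>\<^bsub>G\<^esub> g))"
      using fh finite_supp by (intro mult_apply) auto
    also have "\<dots> \<in> C" using fh C finite_supp subringE(6)[OF C] by (intro finsum_in_subset) auto
    finally show ?thesis .
  next
    case False
    then show ?thesis using coeff_outside[OF A.m_closed[OF fh(1,2)]] subringE(2)[OF C] by simp
  qed
  then show "f \<otimes>\<^bsub>A\<^esub> h \<in> coeffs_in C" using fh by (simp add: coeffs_in_def)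
qed

lemma eqI_on_carrier:
  assumes "f \<in> carrier A" "h \<in> carrier A" "\<And>g. g \<in> carrier G \<Longrightarrow> f g = h g"
  shows "f = h"
proof
  fix g show "f g = h g"
    using assms coeff_outside[of f g] coeff_outside[of h g] by (cases "g \<in> carrier G") auto
qed

text \<open>By genericity the element can be written in one way only with outer factors in
  \<open>T\<close>, so the convolution has a single term. \<open>T\<close> may exceed either
  support: the formula also covers zero coefficients, as comparing two products requires.\<close>

lemma generic_product_apply:
  assumes f: "f \<in> carrier A" "f' \<in> carrier A" and T: "finite T" "T \<subseteq> carrier G" "supp f \<subseteq> T" "supp f' \<subseteq> T"
    and x: "x \<in> carrier G"
    and gen: "\<And>g g' h h'. g \<in> T \<Longrightarrow> g' \<in> T \<Longrightarrow> h \<in> T \<Longrightarrow> h' \<in> T \<Longrightarrow>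
      g \<otimes>\<^bsub>G\<^esub> (x \<otimes>\<^bsub>G\<^esub> h) = g' \<otimes>\<^bsub>G\<^esub> (x \<otimes>\<^bsub>G\<^esub> h') \<Longrightarrow> g = g' \<and> h = h'"
    and gh: "g \<in> T" "h \<in> T"
  shows "(f \<otimes>\<^bsub>A\<^esub> (single \<one>\<^bsub>R\<^esub> x \<otimes>\<^bsub>A\<^esub> f')) (g \<otimes>\<^bsub>G\<^esub> (x \<otimes>\<^bsub>G\<^esub> h)) = f g \<otimes>\<^bsub>R\<^esub> f' h"
proof -
  have G: "g \<in> carrier G" "h \<in> carrier G" using gh T by auto
  let ?k = "g \<otimes>\<^bsub>G\<^esub> (x \<otimes>\<^bsub>G\<^esub> h)"
  have s: "single \<one>\<^bsub>R\<^esub> x \<in> carrier A" using x by simp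
  have "(f \<otimes>\<^bsub>A\<^esub> (single \<one>\<^bsub>R\<^esub> x \<otimes>\<^bsub>A\<^esub> f')) ?k = (\<Oplus>\<^bsub>R\<^esub>y\<in>T. f y \<otimes>\<^bsub>R\<^esub> (single \<one>\<^bsub>R\<^esub> x \<otimes>\<^bsub>A\<^esub> f') (inv\<^bsub>G\<^esub> y \<otimes>\<^bsub>G\<^esub> ?k))"
    using f s T(1,3) G x by (intro mult_apply) simp_all
  also have "\<dots> = f g \<otimes>\<^bsub>R\<^esub> (single \<one>\<^bsub>R\<^esub> x \<otimes>\<^bsub>A\<^esub> f') (inv\<^bsub>G\<^esub> g \<otimes>\<^bsub>G\<^esub> ?k)"
  proof (intro finsum_single_term T(1) gh(1))
    fix y assume y: "y \<in> T"
    show "f y \<otimes>\<^bsub>R\<^esub> (single \<one>\<^bsub>R\<^esub> x \<otimes>\<^bsub>A\<^esub> f') (inv\<^bsub>G\<^esub> y \<otimes>\<^bsub>G\<^esub> ?k) \<in> carrier R" using f s by simp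
    assume ne: "y \<noteq> g"
    have yG: "y \<in> carrier G" using y T by auto
    define h' where "h' = inv\<^bsub>G\<^esub> x \<otimes>\<^bsub>G\<^esub> (inv\<^bsub>G\<^esub> y \<otimes>\<^bsub>G\<^esub> ?k)"
    have "y \<otimes>\<^bsub>G\<^esub> (x \<otimes>\<^bsub>G\<^esub> h') = ?k" using yG x G by (simp add: h'_def)
    then have "h' \<notin> T" using gen[OF y gh(1) _ gh(2), of h'] ne by auto
    then have "f' h' = \<zero>\<^bsub>R\<^esub>" using T(4) by auto
    then show "f y \<otimes>\<^bsub>R\<^esub> (single \<one>\<^bsub>R\<^esub> x \<otimes>\<^bsub>A\<^esub> f') (inv\<^bsub>G\<^esub> y \<otimes>\<^bsub>G\<^esub> ?k) = \<zero>\<^bsub>R\<^esub>"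
      using f yG x G by (subst single_mult) (simp_all flip: h'_def)
  qed
  also have "\<dots> = f g \<otimes>\<^bsub>R\<^esub> f' h" using f x G by (subst single_mult) simp_all
  finally show ?thesis .
qed

text \<open>The scalar is split off so that the other factor has coefficients \<open>\<zero>\<close>
  and \<open>\<one>\<close> only, hence in any subring; the family is extended by
  \<open>\<zero>\<close> beyond \<open>n\<close> to have this property at every index.\<close>

lemma sum_of_singles:
  fixes n :: nat
  assumes f: "f \<in> carrier A" and h: "bij_betw h {..<n} (supp f)"
  shows "f = (\<Oplus>\<^bsub>A\<^esub>i\<in>{..<n}. single (f (h i)) \<one>\<^bsub>G\<^esub> \<otimes>\<^bsub>A\<^esub> (if i < n then single \<one>\<^bsub>R\<^esub> (h i) else \<zero>\<^bsub>A\<^esub>))"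
proof (rule eqI_on_carrier[OF f])
  have hG: "h i \<in> carrier G" if "i < n" for i
    using h that supp_carrier[OF f] by (auto simp: bij_betw_def)
  have cl: "single (f (h i)) \<one>\<^bsub>G\<^esub> \<otimes>\<^bsub>A\<^esub> (if i < n then single \<one>\<^bsub>R\<^esub> (h i) else \<zero>\<^bsub>A\<^esub>) \<in> carrier A" if "i < n" for i
    using f hG that by simp
  then show "(\<Oplus>\<^bsub>A\<^esub>i\<in>{..<n}. single (f (h i)) \<one>\<^bsub>G\<^esub> \<otimes>\<^bsub>A\<^esub> (if i < n then single \<one>\<^bsub>R\<^esub> (h i) else \<zero>\<^bsub>A\<^esub>)) \<in> carrier A"
    by (intro A.finsum_closed) auto
  fix g assume g: "g \<in> carrier G"
  have val: "(single (f (h i)) \<one>\<^bsub>G\<^esub> \<otimes>\<^bsub>A\<^esub> (if i < n then single \<one>\<^bsub>R\<^esub> (h i) else \<zero>\<^bsub>A\<^esub>)) g = (if g = h i then f g else \<zero>\<^bsub>R\<^esub>)"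
    if "i < n" for i
    using that hG[OF that] f g by (simp add: single_mult) (simp add: single_def)
  have "(\<Oplus>\<^bsub>A\<^esub>i\<in>{..<n}. single (f (h i)) \<one>\<^bsub>G\<^esub> \<otimes>\<^bsub>A\<^esub> (if i < n then single \<one>\<^bsub>R\<^esub> (h i) else \<zero>\<^bsub>A\<^esub>)) g
    = (\<Oplus>\<^bsub>R\<^esub>i\<in>{..<n}. (single (f (h i)) \<one>\<^bsub>G\<^esub> \<otimes>\<^bsub>A\<^esub> (if i < n then single \<one>\<^bsub>R\<^esub> (h i) else \<zero>\<^bsub>A\<^esub>)) g)"
    using cl by (intro finsum_apply) auto
  also have "\<dots> = (\<Oplus>\<^bsub>R\<^esub>i\<in>{..<n}. if g = h i then f g else \<zero>\<^bsub>R\<^esub>)"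
    using val f by (intro R.finsum_cong') auto
  also have "\<dots> = f g"
  proof (cases "g \<in> supp f")
    case True
    then obtain j where j: "j < n" "g = h j" using h by (auto simp: bij_betw_def)
    have "(\<Oplus>\<^bsub>R\<^esub>i\<in>{..<n}. if g = h i then f g else \<zero>\<^bsub>R\<^esub>) = (if g = h j then f g else \<zero>\<^bsub>R\<^esub>)"
      using j f h by (intro finsum_single_term) (auto simp: bij_betw_def inj_on_def)
    then show ?thesis using j by simp
  next
    case False
    then have "f g = \<zero>\<^bsub>R\<^esub>" by simp
    then show ?thesis by (intro trans[OF R.add.finprod_one_eqI]) auto
  qed
  finally show "f g = (\<Oplus>\<^bsub>A\<^esub>i\<in>{..<n}. single (f (h i)) \<one>\<^bsub>G\<^esub> \<otimes>\<^bsub>A\<^esub> (if i < n then single \<one>\<^bsub>R\<^esub> (h i) else \<zero>\<^bsub>A\<^esub>)) g"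
    by simp
qed

text \<open>
  Take a nonzero \<open>\<alpha> = \<Sum> k\<^sub>i a\<^sub>i\<close> in the ideal with as few summands as possible, the \<open>a\<^sub>i\<close> having
  coefficients in \<open>C\<close>, and let \<open>p\<close> be one of the \<open>a\<^sub>i\<close>. For group elements \<open>x\<close>, the combination
  \<open>p x \<alpha> - \<alpha> x p\<close> has fewer summands, so it vanishes; for generic \<open>x\<close> this makes \<open>\<alpha>\<close> and \<open>p\<close>
  proportional.
\<close>

lemma ideal_meets_coeffs_in:
  assumes K: "field R"
    and C: "subring C R"
    and generic: "\<And>T. finite T \<Longrightarrow> T \<subseteq> carrier G \<Longrightarrow> \<exists>x\<in>carrier G. \<forall>g\<in>T. \<forall>g'\<in>T. \<forall>h\<in>T. \<forall>h'\<in>T.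
      g \<otimes>\<^bsub>G\<^esub> (x \<otimes>\<^bsub>G\<^esub> h) = g' \<otimes>\<^bsub>G\<^esub> (x \<otimes>\<^bsub>G\<^esub> h') \<longrightarrow> g = g' \<and> h = h'"
    and I: "ideal I A" "I \<noteq> {\<zero>\<^bsub>A\<^esub>}"
  shows "I \<inter> (coeffs_in C - {\<zero>\<^bsub>A\<^esub>}) \<noteq> {}"
proof -
  interpret K: field R by (rule K)
  interpret I: ideal I A by (rule I(1))
  note sub = coeffs_in_subring[OF C]
  have CA: "f \<in> carrier A" if "f \<in> coeffs_in C" for f using that by (simp add: coeffs_in_def)
  let ?K = "\<lambda>c. single c \<one>\<^bsub>G\<^esub>"
  \<comment> \<open>Commutativity of the coefficients enters here: scalars pass through
    \<open>p \<otimes> s\<close>.\<close>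
  have central: "?K c \<otimes>\<^bsub>A\<^esub> f = f \<otimes>\<^bsub>A\<^esub> ?K c" if "c \<in> carrier R" "f \<in> carrier A" for c f
    using that by (intro eqI_on_carrier) (simp_all add: single_mult mult_single K.m_comm)
  define Q where "Q n \<longleftrightarrow> (\<exists>\<alpha> k a. \<alpha> \<in> I \<and> \<alpha> \<noteq> \<zero>\<^bsub>A\<^esub> \<and> (\<forall>i. k i \<in> carrier R) \<and> (\<forall>i. a i \<in> coeffs_in C) \<and>
    \<alpha> = (\<Oplus>\<^bsub>A\<^esub>i\<in>{..<n}. ?K (k i) \<otimes>\<^bsub>A\<^esub> a i))" for n :: nat
  have "\<exists>n. Q n"
  proof -
    have "\<zero>\<^bsub>A\<^esub> \<in> I" by (rule I.zero_closed)
    then obtain \<alpha> where \<alpha>: "\<alpha> \<in> I" "\<alpha> \<noteq> \<zero>\<^bsub>A\<^esub>" using I(2) by blast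
    have \<alpha>A: "\<alpha> \<in> carrier A" using I.a_subset \<alpha>(1) by blast
    define n where "n = card (supp \<alpha>)"
    obtain h where h: "bij_betw h {..<n} (supp \<alpha>)"
      using ex_bij_betw_nat_finite[OF finite_supp[OF \<alpha>A]] by (auto simp: n_def lessThan_atLeast0)
    have hG: "h i \<in> carrier G" if "i < n" for i
      using h that supp_carrier[OF \<alpha>A] by (auto simp: bij_betw_def)
    define a where "a i = (if i < n then single \<one>\<^bsub>R\<^esub> (h i) else \<zero>\<^bsub>A\<^esub>)" for i
    have 1: "a i \<in> coeffs_in C" for i using sub(3)[OF hG] sub(4) by (simp add: a_def)
    have 2: "\<alpha> = (\<Oplus>\<^bsub>A\<^esub>i\<in>{..<n}. ?K (\<alpha> (h i)) \<otimes>\<^bsub>A\<^esub> a i)"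
      unfolding a_def by (rule sum_of_singles[OF \<alpha>A h])
    have 3: "\<alpha> (h i) \<in> carrier R" for i using \<alpha>A by simp
    show ?thesis unfolding Q_def
      by (rule exI[of _ n], rule exI[of _ \<alpha>], rule exI[of _ "\<lambda>i. \<alpha> (h i)"], rule exI[of _ a],
          intro conjI allI \<alpha> 1 2 3)
  qed
  then obtain n where n: "Q n" "\<And>m. m < n \<Longrightarrow> \<not> Q m" using exists_least_iff[of Q] by blast
  obtain \<alpha> k a where \<alpha>: "\<alpha> \<in> I" "\<alpha> \<noteq> \<zero>\<^bsub>A\<^esub>" "\<And>i. k i \<in> carrier R" "\<And>i. a i \<in> coeffs_in C"
    "\<alpha> = (\<Oplus>\<^bsub>A\<^esub>i\<in>{..<n}. ?K (k i) \<otimes>\<^bsub>A\<^esub> a i)"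
    using n(1) unfolding Q_def by (elim exE conjE) (rule that, simp_all only: simp_thms)
  have \<alpha>A: "\<alpha> \<in> carrier A" using I.a_subset \<alpha>(1) by blast
  have aA: "a i \<in> carrier A" and KA: "?K (k i) \<in> carrier A" for i using CA \<alpha>(3,4) by simp_all
  have "n \<noteq> 0" using \<alpha>(2,5) by auto
  then obtain m where m: "n = Suc m" by (cases n) auto
  have drop: "(\<Oplus>\<^bsub>A\<^esub>i\<in>{..<n}. ?K (k i) \<otimes>\<^bsub>A\<^esub> b i) = (\<Oplus>\<^bsub>A\<^esub>i\<in>{..<m}. ?K (k i) \<otimes>\<^bsub>A\<^esub> b i)"
    if b: "\<And>i. b i \<in> coeffs_in C" "b m = \<zero>\<^bsub>A\<^esub>" for b
  proof -
    have "(\<Oplus>\<^bsub>A\<^esub>i\<in>{..<n}. ?K (k i) \<otimes>\<^bsub>A\<^esub> b i) = ?K (k m) \<otimes>\<^bsub>A\<^esub> b m \<oplus>\<^bsub>A\<^esub> (\<Oplus>\<^bsub>A\<^esub>i\<in>{..<m}. ?K (k i) \<otimes>\<^bsub>A\<^esub> b i)"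
      unfolding m lessThan_Suc using CA[OF b(1)] KA by (intro A.finsum_insert) auto
    also have "\<dots> = (\<Oplus>\<^bsub>A\<^esub>i\<in>{..<m}. ?K (k i) \<otimes>\<^bsub>A\<^esub> b i)" using b(2) CA[OF b(1)] KA by simp
    finally show ?thesis .
  qed
  \<comment> \<open>A sum with the same scalars and vanishing last term is a shorter one, so
    minimality of \<open>n\<close> forces it to be zero.\<close>
  have small: "(\<Oplus>\<^bsub>A\<^esub>i\<in>{..<n}. ?K (k i) \<otimes>\<^bsub>A\<^esub> b i) = \<zero>\<^bsub>A\<^esub>"
    if b: "\<And>i. b i \<in> coeffs_in C" "b m = \<zero>\<^bsub>A\<^esub>" "(\<Oplus>\<^bsub>A\<^esub>i\<in>{..<n}. ?K (k i) \<otimes>\<^bsub>A\<^esub> b i) \<in> I" for b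
  proof (rule ccontr)
    assume "(\<Oplus>\<^bsub>A\<^esub>i\<in>{..<n}. ?K (k i) \<otimes>\<^bsub>A\<^esub> b i) \<noteq> \<zero>\<^bsub>A\<^esub>"
    then have nz: "(\<Oplus>\<^bsub>A\<^esub>i\<in>{..<m}. ?K (k i) \<otimes>\<^bsub>A\<^esub> b i) \<noteq> \<zero>\<^bsub>A\<^esub>" using drop[of b, OF b(1,2)] by simp
    have mem: "(\<Oplus>\<^bsub>A\<^esub>i\<in>{..<m}. ?K (k i) \<otimes>\<^bsub>A\<^esub> b i) \<in> I" using b(3) drop[of b, OF b(1,2)] by simp
    have "Q m" unfolding Q_def
      by (rule exI[of _ "\<Oplus>\<^bsub>A\<^esub>i\<in>{..<m}. ?K (k i) \<otimes>\<^bsub>A\<^esub> b i"], rule exI[of _ k], rule exI[of _ b],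
          intro conjI allI nz mem \<alpha>(3) b(1) refl)
    then show False using n(2)[of m] m by simp
  qed
  define p where "p = a m"
  have p: "p \<in> coeffs_in C" "p \<in> carrier A" using \<alpha>(4) aA by (simp_all add: p_def)
  \<comment> \<open>Otherwise \<open>\<alpha>\<close> itself would be a shorter sum.\<close>
  have p0: "p \<noteq> \<zero>\<^bsub>A\<^esub>" using small[of a] \<alpha> by (auto simp: p_def)
  define T where "T = supp \<alpha> \<union> supp p"
  have T: "finite T" "T \<subseteq> carrier G"
    using finite_supp[OF \<alpha>A] finite_supp[OF p(2)] supp_carrier[OF \<alpha>A] supp_carrier[OF p(2)] by (auto simp: T_def)
  from generic[OF T] obtain x where x: "x \<in> carrier G"
    and gen: "\<forall>g\<in>T. \<forall>g'\<in>T. \<forall>h\<in>T. \<forall>h'\<in>T. g \<otimes>\<^bsub>G\<^esub> (x \<otimes>\<^bsub>G\<^esub> h) = g' \<otimes>\<^bsub>G\<^esub> (x \<otimes>\<^bsub>G\<^esub> h') \<longrightarrow> g = g' \<and> h = h'"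
    by (elim bexE)
  define s where "s = single \<one>\<^bsub>R\<^esub> x"
  have s: "s \<in> coeffs_in C" "s \<in> carrier A" using sub(3)[OF x] CA by (simp_all add: s_def)
  \<comment> \<open>Formed term by term, \<open>p x \<alpha> - \<alpha> x p\<close> keeps the
    scalars \<open>k i\<close>, and its last term vanishes since \<open>p = a m\<close>.\<close>
  define b where "b i = p \<otimes>\<^bsub>A\<^esub> (s \<otimes>\<^bsub>A\<^esub> a i) \<ominus>\<^bsub>A\<^esub> a i \<otimes>\<^bsub>A\<^esub> (s \<otimes>\<^bsub>A\<^esub> p)" for i
  have b: "b i \<in> coeffs_in C" for i unfolding b_def using p s \<alpha>(4) by (intro sub(1,2))
  have bA: "b i \<in> carrier A" for i using CA b .
  have "b m = \<zero>\<^bsub>A\<^esub>" using p s by (simp add: b_def A.r_neg A.minus_eq flip: p_def)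
  let ?L = "\<Oplus>\<^bsub>A\<^esub>i\<in>{..<n}. ?K (k i) \<otimes>\<^bsub>A\<^esub> b i"
  have L: "?L \<in> carrier A" using bA KA by (intro A.finsum_closed) simp
  have left: "p \<otimes>\<^bsub>A\<^esub> (s \<otimes>\<^bsub>A\<^esub> \<alpha>) = (\<Oplus>\<^bsub>A\<^esub>i\<in>{..<n}. ?K (k i) \<otimes>\<^bsub>A\<^esub> (p \<otimes>\<^bsub>A\<^esub> (s \<otimes>\<^bsub>A\<^esub> a i)))"
  proof -
    have "p \<otimes>\<^bsub>A\<^esub> (s \<otimes>\<^bsub>A\<^esub> \<alpha>) = (p \<otimes>\<^bsub>A\<^esub> s) \<otimes>\<^bsub>A\<^esub> \<alpha>" using p s \<alpha>A by (simp add: A.m_assoc)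
    also have "\<dots> = (\<Oplus>\<^bsub>A\<^esub>i\<in>{..<n}. (p \<otimes>\<^bsub>A\<^esub> s) \<otimes>\<^bsub>A\<^esub> (?K (k i) \<otimes>\<^bsub>A\<^esub> a i))"
      unfolding \<alpha>(5) using p s aA KA by (intro A.finsum_rdistr) auto
    also have "\<dots> = (\<Oplus>\<^bsub>A\<^esub>i\<in>{..<n}. ?K (k i) \<otimes>\<^bsub>A\<^esub> (p \<otimes>\<^bsub>A\<^esub> (s \<otimes>\<^bsub>A\<^esub> a i)))"
    proof (rule A.finsum_cong'[OF refl])
      fix i
      have "(p \<otimes>\<^bsub>A\<^esub> s) \<otimes>\<^bsub>A\<^esub> (?K (k i) \<otimes>\<^bsub>A\<^esub> a i) = ((p \<otimes>\<^bsub>A\<^esub> s) \<otimes>\<^bsub>A\<^esub> ?K (k i)) \<otimes>\<^bsub>A\<^esub> a i"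
        using p s aA[of i] KA[of i] by (simp add: A.m_assoc)
      also have "(p \<otimes>\<^bsub>A\<^esub> s) \<otimes>\<^bsub>A\<^esub> ?K (k i) = ?K (k i) \<otimes>\<^bsub>A\<^esub> (p \<otimes>\<^bsub>A\<^esub> s)"
        using central[OF \<alpha>(3)[of i], of "p \<otimes>\<^bsub>A\<^esub> s"] p s by simp
      finally show "(p \<otimes>\<^bsub>A\<^esub> s) \<otimes>\<^bsub>A\<^esub> (?K (k i) \<otimes>\<^bsub>A\<^esub> a i) = ?K (k i) \<otimes>\<^bsub>A\<^esub> (p \<otimes>\<^bsub>A\<^esub> (s \<otimes>\<^bsub>A\<^esub> a i))"
        using p s aA[of i] KA[of i] by (simp add: A.m_assoc)
    qed (use p s aA KA in auto)
    finally show ?thesis .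
  qed
  have right: "\<alpha> \<otimes>\<^bsub>A\<^esub> (s \<otimes>\<^bsub>A\<^esub> p) = (\<Oplus>\<^bsub>A\<^esub>i\<in>{..<n}. ?K (k i) \<otimes>\<^bsub>A\<^esub> (a i \<otimes>\<^bsub>A\<^esub> (s \<otimes>\<^bsub>A\<^esub> p)))"
  proof -
    have "\<alpha> \<otimes>\<^bsub>A\<^esub> (s \<otimes>\<^bsub>A\<^esub> p) = (\<Oplus>\<^bsub>A\<^esub>i\<in>{..<n}. (?K (k i) \<otimes>\<^bsub>A\<^esub> a i) \<otimes>\<^bsub>A\<^esub> (s \<otimes>\<^bsub>A\<^esub> p))"
      unfolding \<alpha>(5) using p s aA KA by (intro A.finsum_ldistr) auto
    also have "\<dots> = (\<Oplus>\<^bsub>A\<^esub>i\<in>{..<n}. ?K (k i) \<otimes>\<^bsub>A\<^esub> (a i \<otimes>\<^bsub>A\<^esub> (s \<otimes>\<^bsub>A\<^esub> p)))"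
      using p s aA KA by (intro A.finsum_cong') (auto simp: A.m_assoc)
    finally show ?thesis .
  qed
  have "p \<otimes>\<^bsub>A\<^esub> (s \<otimes>\<^bsub>A\<^esub> \<alpha>) = ?L \<oplus>\<^bsub>A\<^esub> \<alpha> \<otimes>\<^bsub>A\<^esub> (s \<otimes>\<^bsub>A\<^esub> p)"
  proof -
    have "?L \<oplus>\<^bsub>A\<^esub> \<alpha> \<otimes>\<^bsub>A\<^esub> (s \<otimes>\<^bsub>A\<^esub> p) =
        (\<Oplus>\<^bsub>A\<^esub>i\<in>{..<n}. ?K (k i) \<otimes>\<^bsub>A\<^esub> b i \<oplus>\<^bsub>A\<^esub> ?K (k i) \<otimes>\<^bsub>A\<^esub> (a i \<otimes>\<^bsub>A\<^esub> (s \<otimes>\<^bsub>A\<^esub> p)))"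
      unfolding right using p s aA KA bA by (intro A.finsum_addf[symmetric]) auto
    also have "\<dots> = (\<Oplus>\<^bsub>A\<^esub>i\<in>{..<n}. ?K (k i) \<otimes>\<^bsub>A\<^esub> (p \<otimes>\<^bsub>A\<^esub> (s \<otimes>\<^bsub>A\<^esub> a i)))"
    proof (rule A.finsum_cong'[OF refl])
      fix i
      have "b i \<oplus>\<^bsub>A\<^esub> a i \<otimes>\<^bsub>A\<^esub> (s \<otimes>\<^bsub>A\<^esub> p) = p \<otimes>\<^bsub>A\<^esub> (s \<otimes>\<^bsub>A\<^esub> a i)"
        using p s aA[of i] by (simp add: b_def A.minus_eq A.a_assoc A.l_neg)
      then show "?K (k i) \<otimes>\<^bsub>A\<^esub> b i \<oplus>\<^bsub>A\<^esub> ?K (k i) \<otimes>\<^bsub>A\<^esub> (a i \<otimes>\<^bsub>A\<^esub> (s \<otimes>\<^bsub>A\<^esub> p)) = ?K (k i) \<otimes>\<^bsub>A\<^esub> (p \<otimes>\<^bsub>A\<^esub> (s \<otimes>\<^bsub>A\<^esub> a i))"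
        using p s aA[of i] KA[of i] bA[of i] by (simp flip: A.r_distr)
    qed (use p s aA KA in auto)
    finally show ?thesis using left by simp
  qed
  moreover have "p \<otimes>\<^bsub>A\<^esub> (s \<otimes>\<^bsub>A\<^esub> \<alpha>) \<in> I" "\<alpha> \<otimes>\<^bsub>A\<^esub> (s \<otimes>\<^bsub>A\<^esub> p) \<in> I"
    using \<alpha>(1) p s by (auto intro: I.I_l_closed I.I_r_closed)
  ultimately have "?L \<in> I"
  proof -
    assume eq: "p \<otimes>\<^bsub>A\<^esub> (s \<otimes>\<^bsub>A\<^esub> \<alpha>) = ?L \<oplus>\<^bsub>A\<^esub> \<alpha> \<otimes>\<^bsub>A\<^esub> (s \<otimes>\<^bsub>A\<^esub> p)"
      and inI: "p \<otimes>\<^bsub>A\<^esub> (s \<otimes>\<^bsub>A\<^esub> \<alpha>) \<in> I" "\<alpha> \<otimes>\<^bsub>A\<^esub> (s \<otimes>\<^bsub>A\<^esub> p) \<in> I"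
    have "?L = p \<otimes>\<^bsub>A\<^esub> (s \<otimes>\<^bsub>A\<^esub> \<alpha>) \<oplus>\<^bsub>A\<^esub> \<ominus>\<^bsub>A\<^esub> (\<alpha> \<otimes>\<^bsub>A\<^esub> (s \<otimes>\<^bsub>A\<^esub> p))"
      unfolding eq using L p s \<alpha>A by (simp add: A.a_assoc A.r_neg)
    then show ?thesis using inI I.a_closed I.a_inv_closed by simp
  qed
  then have "?L = \<zero>\<^bsub>A\<^esub>" using small[of b, OF b \<open>b m = \<zero>\<^bsub>A\<^esub>\<close>] by blast
  then have comm: "p \<otimes>\<^bsub>A\<^esub> (s \<otimes>\<^bsub>A\<^esub> \<alpha>) = \<alpha> \<otimes>\<^bsub>A\<^esub> (s \<otimes>\<^bsub>A\<^esub> p)"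
    using \<open>p \<otimes>\<^bsub>A\<^esub> (s \<otimes>\<^bsub>A\<^esub> \<alpha>) = ?L \<oplus>\<^bsub>A\<^esub> \<alpha> \<otimes>\<^bsub>A\<^esub> (s \<otimes>\<^bsub>A\<^esub> p)\<close> p s \<alpha>A by simp
  have proportional: "p g \<otimes>\<^bsub>R\<^esub> \<alpha> h = \<alpha> g \<otimes>\<^bsub>R\<^esub> p h" for g h
  proof (cases "g \<in> T \<and> h \<in> T")
    case True
    have supp: "supp p \<subseteq> T" "supp \<alpha> \<subseteq> T" by (auto simp: T_def)
    note gen' = gen[rule_format]
    have "(p \<otimes>\<^bsub>A\<^esub> (s \<otimes>\<^bsub>A\<^esub> \<alpha>)) (g \<otimes>\<^bsub>G\<^esub> (x \<otimes>\<^bsub>G\<^esub> h)) = p g \<otimes>\<^bsub>R\<^esub> \<alpha> h"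
      unfolding s_def using True by (intro generic_product_apply[OF p(2) \<alpha>A T supp x gen']) auto
    moreover have "(\<alpha> \<otimes>\<^bsub>A\<^esub> (s \<otimes>\<^bsub>A\<^esub> p)) (g \<otimes>\<^bsub>G\<^esub> (x \<otimes>\<^bsub>G\<^esub> h)) = \<alpha> g \<otimes>\<^bsub>R\<^esub> p h"
      unfolding s_def using True by (intro generic_product_apply[OF \<alpha>A p(2) T supp(2,1) x gen']) auto
    ultimately show ?thesis using comm by simp
  next
    case False
    then have "p g = \<zero>\<^bsub>R\<^esub> \<and> \<alpha> g = \<zero>\<^bsub>R\<^esub> \<or> p h = \<zero>\<^bsub>R\<^esub> \<and> \<alpha> h = \<zero>\<^bsub>R\<^esub>" by (auto simp: T_def)
    then show ?thesis using p \<alpha>A by auto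
  qed
  obtain g where g: "p g \<noteq> \<zero>\<^bsub>R\<^esub>" using p0 by (auto simp: eq_zero_iff)
  obtain h where h: "\<alpha> h \<noteq> \<zero>\<^bsub>R\<^esub>" using \<alpha>(2) by (auto simp: eq_zero_iff)
  have "p g \<otimes>\<^bsub>R\<^esub> \<alpha> h \<noteq> \<zero>\<^bsub>R\<^esub>" using g h p \<alpha>A K.integral[of "p g" "\<alpha> h"] by auto
  \<comment> \<open>Dividing by \<open>\<alpha> g\<close> makes \<open>p\<close> a scalar multiple
    of \<open>\<alpha>\<close>; so \<open>p\<close> lies in \<open>I\<close>, while its coefficients
    lie in \<open>C\<close>.\<close>
  then have "\<alpha> g \<noteq> \<zero>\<^bsub>R\<^esub>" using proportional[of g h] p by auto
  then have "\<alpha> g \<in> Units R" using \<alpha>A by (simp add: K.field_Units)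
  then obtain c where c: "c \<in> carrier R" "c \<otimes>\<^bsub>R\<^esub> \<alpha> g = \<one>\<^bsub>R\<^esub>" using R.Units_l_inv_ex by blast
  have "p = ?K c \<otimes>\<^bsub>A\<^esub> (?K (p g) \<otimes>\<^bsub>A\<^esub> \<alpha>)"
  proof (rule eqI_on_carrier[OF p(2)])
    show "?K c \<otimes>\<^bsub>A\<^esub> (?K (p g) \<otimes>\<^bsub>A\<^esub> \<alpha>) \<in> carrier A" using c p \<alpha>A by simp
    fix u assume u: "u \<in> carrier G"
    have "(?K c \<otimes>\<^bsub>A\<^esub> (?K (p g) \<otimes>\<^bsub>A\<^esub> \<alpha>)) u = c \<otimes>\<^bsub>R\<^esub> (p g \<otimes>\<^bsub>R\<^esub> \<alpha> u)"
      using c p \<alpha>A u by (simp add: single_mult)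
    also have "\<dots> = (c \<otimes>\<^bsub>R\<^esub> \<alpha> g) \<otimes>\<^bsub>R\<^esub> p u" using c(1) p \<alpha>A by (simp add: proportional R.m_assoc)
    also have "\<dots> = p u" using c p by simp
    finally show "p u = (?K c \<otimes>\<^bsub>A\<^esub> (?K (p g) \<otimes>\<^bsub>A\<^esub> \<alpha>)) u" by simp
  qed
  also have "\<dots> \<in> I" using \<alpha>(1) c p by (intro I.I_l_closed) simp_all
  finally have "p \<in> I" .
  then show ?thesis using p p0 by blast
qed

end

theorem right_primitive_field:
  assumes K: "field K" and hyp: "torsion_free_nonelementary G len X \<delta>"
  shows "right_primitive (group_ring K G)"
proof -
  interpret K: field K by (rule K)
  interpret H: torsion_free_nonelementary G len X \<delta> by (rule hyp)
  interpret group_ring_setup K G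
    using K.ring_axioms H.group_axioms by (simp add: group_ring_setup_def)
  \<comment> \<open>The image of the integers is the smallest subring, countable whatever the size
    of \<open>K\<close>.\<close>
  define C where "C = range (\<lambda>z::int. [z] \<cdot>\<^bsub>K\<^esub> \<one>\<^bsub>K\<^esub>)"
  have C: "subring C K"
  proof (rule K.subringI)
    show "C \<subseteq> carrier K" by (auto simp: C_def)
    show "\<one>\<^bsub>K\<^esub> \<in> C" using range_eqI[of "\<one>\<^bsub>K\<^esub>" "\<lambda>z::int. [z] \<cdot>\<^bsub>K\<^esub> \<one>\<^bsub>K\<^esub>" 1] by (simp add: C_def)
    fix a assume a: "a \<in> C"
    then show "\<ominus>\<^bsub>K\<^esub> a \<in> C" by (auto simp: C_def K.add.int_pow_neg[symmetric])
    fix b assume b: "b \<in> C"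
    show "a \<otimes>\<^bsub>K\<^esub> b \<in> C" using a b by (auto simp: C_def K.add_pow_ldistr_int K.add.int_pow_pow)
    show "a \<oplus>\<^bsub>K\<^esub> b \<in> C" using a b by (auto simp: C_def K.add.int_pow_mult[symmetric])
  qed
  have "countable C" by (simp add: C_def)
  then have "countable (coeffs_in C - {\<zero>\<^bsub>A\<^esub>})"
    using countable_coeffs_in[OF H.countable_carrier] by (intro countable_Diff)
  moreover have "nc_domain K" using K.ring_axioms K.one_not_zero K.integral by (auto simp: nc_domain_def)
  moreover have "I \<inter> (coeffs_in C - {\<zero>\<^bsub>A\<^esub>}) \<noteq> {}" if "ideal I A" "I \<noteq> {\<zero>\<^bsub>A\<^esub>}" for I
    by (rule ideal_meets_coeffs_in[OF K C H.generic_middle that])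
  ultimately show ?thesis using hyp
    by (intro right_primitive_of_test_set[where B = "coeffs_in C - {\<zero>\<^bsub>A\<^esub>}"]) (auto simp: coeffs_in_def)
qed

theorem theorem6:
  fixes G :: "('g, 'm) monoid_scheme"
  assumes "group G"
    and "hyperbolic_group G"
    and "\<not> elementary_group G"
    and "torsion_free_group G"
  shows "(\<forall>R :: ('r, 'n) ring_scheme.
            nc_domain R \<and> countable (carrier R) \<longrightarrow> right_primitive (group_ring R G)) \<and>
         (\<forall>K :: ('k, 'l) ring_scheme.
            field K \<longrightarrow> right_primitive (group_ring K G))"
proof -
  obtain X \<epsilon> where X: "finite X" "X \<subseteq> carrier G" "generate G X = carrier G"
    "thin_triangles (cayley_points G X) (cayley_dist G X) \<epsilon>"
    using assms(2) by (auto simp: hyperbolic_group_def)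
  interpret cayley_graph G X
    using assms(1) X(1-3) by (intro cayley_graph.intro cayley_graph_axioms.intro)
  obtain \<delta> where "hyperbolic_length G (\<lambda>g. int (vertex_dist G X \<one>\<^bsub>G\<^esub> g)) X \<delta>"
    using hyperbolic_length[OF X(4)] by blast
  then have "torsion_free_nonelementary G (\<lambda>g. int (vertex_dist G X \<one>\<^bsub>G\<^esub> g)) X \<delta>"
    using assms(3,4)
    by (intro torsion_free_nonelementary.intro torsion_free_nonelementary_axioms.intro)
  then show ?thesis using right_primitive_countable_domain right_primitive_field by blast
qed

end
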